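(* Let $a,b,c,\alpha,\beta,\sigma>0$ with $b>a\beta$ and $2bc\ge\sigma^2$, and let $(r_t,N_t)_{t\ge0}$ be the Cox-Ingersoll-Ross process with Hawkes jumps, with deterministic initial value $r_0=r$. Then for any $r\in\mathbb{R}^+$: (i) $$\frac1t\int_0^t r_s\,ds\to\frac{bc+a\alpha}{b-a\beta}\quad\text{in }L^2(\mathbb{P})\text{ as }t\to\infty;$$ (ii) $$\frac{N_t}{t}\to\frac{b(\alpha+\beta c)}{b-a\beta}\quad\text{in }L^2(\mathbb{P})\text{ as }t\to\infty.$$
   Context: $\mathbb{R}^+=[0,\infty)$. The Cox-Ingersoll-Ross process with Hawkes jumps with parameters $a,b,c,\alpha,\beta,\sigma>0$ is the nonnegative càdlàg process $r_t$, adapted to a filtration on a probability space with measure $\mathbb{P}$, satisfying $$dr_t=b(c-r_t)\,dt+a\,dN_t+\sigma\sqrt{r_t}\,dW_t,$$ where $W_t$ is a standard Brownian motion for the filtration and $N_t$ is a simple point process with $N_0=0$ (jumps of size $1$) having intensity $\lambda_t=\alpha+\beta r_t$ at time $t$ (with $r$ evaluated at the left limit $r_{t-}$ to make the intensity predictable; thus $N_t-\int_0^t(\alpha+\beta r_s)\,ds$ is a local martingale). The process $r_t$ is Markov with generator $$\mathcal{A}f(r)=bcf'(r)-brf'(r)+\tfrac12\sigma^2 r f''(r)+(\alpha+\beta r)[f(r+a)-f(r)].$$ Standing assumptions: $b>a\beta$ and $2bc\ge\sigma^2$. *)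

theory Defs
  imports "HOL-Probability.Probability"
begin

text \<open>Time is the half-line \<open>t \<ge> 0\<close> of \<^typ>\<open>real\<close>; processes are never evaluated at negative times.
  The library's \<^locale>\<open>filtration\<close> is indexed by all of \<^typ>\<open>real\<close>, which is no restriction:
  a filtration on the half-line extends by \<open>F t = F 0\<close> for \<open>t < 0\<close>. The filtration is not assumed
  complete or right-continuous.\<close>

definition cadlag :: "(real \<Rightarrow> real) \<Rightarrow> bool" where
  "cadlag f \<longleftrightarrow> (\<forall>t\<ge>0. (f \<longlongrightarrow> f t) (at_right t)) \<and> (\<forall>t>0. \<exists>l. (f \<longlongrightarrow> l) (at_left t))"

text \<open>The convention \<open>f(0-) = f(0)\<close> is used.\<close>

definition left_lim :: "(real \<Rightarrow> real) \<Rightarrow> real \<Rightarrow> real" where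
  "left_lim f t = (if t \<le> 0 then f 0 else Lim (at_left t) f)"

definition counting_path :: "(real \<Rightarrow> nat) \<Rightarrow> bool" where
  "counting_path f \<longleftrightarrow> f 0 = 0 \<and> mono_on {0..} f \<and> cadlag (\<lambda>t. real (f t)) \<and>
     (\<forall>t>0. real (f t) - left_lim (\<lambda>s. real (f s)) t \<in> {0, 1})"

text \<open>Convergence in \<open>L\<^sup>2(M)\<close> as \<open>t \<rightarrow> \<infinity>\<close> of a family indexed by \<open>t > 0\<close>. Square integrability is
  stated separately, since the Bochner integral of a non-integrable function is \<open>0\<close>.\<close>

definition square_integrable :: "'a measure \<Rightarrow> ('a \<Rightarrow> real) \<Rightarrow> bool" where
  "square_integrable M X \<longleftrightarrow> X \<in> borel_measurable M \<and> integrable M (\<lambda>\<omega>. (X \<omega>)\<^sup>2)"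

definition tendsto_L2 :: "'a measure \<Rightarrow> (real \<Rightarrow> 'a \<Rightarrow> real) \<Rightarrow> ('a \<Rightarrow> real) \<Rightarrow> bool" where
  "tendsto_L2 M X Y \<longleftrightarrow> (\<forall>t>0. square_integrable M (X t)) \<and> square_integrable M Y \<and>
     ((\<lambda>t. \<integral>\<omega>. (X t \<omega> - Y \<omega>)\<^sup>2 \<partial>M) \<longlongrightarrow> 0) at_top"

locale filtered_prob_space = prob_space M + filtration "space M" F
  for M :: "'a measure" and F :: "real \<Rightarrow> 'a measure" +
  assumes subalgebra_F: "subalgebra M (F t)"
begin

definition tendsto_prob :: "(nat \<Rightarrow> 'a \<Rightarrow> real) \<Rightarrow> ('a \<Rightarrow> real) \<Rightarrow> bool" where
  "tendsto_prob X Y \<longleftrightarrow> (\<forall>k. X k \<in> borel_measurable M) \<and> Y \<in> borel_measurable M \<and>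
     (\<forall>\<epsilon>>0. (\<lambda>k. prob {\<omega> \<in> space M. \<epsilon> \<le> \<bar>X k \<omega> - Y \<omega>\<bar>}) \<longlonglongrightarrow> 0)"

definition adapted :: "(real \<Rightarrow> 'a \<Rightarrow> real) \<Rightarrow> bool" where
  "adapted X \<longleftrightarrow> (\<forall>t\<ge>0. X t \<in> borel_measurable (F t))"

definition progressive :: "(real \<Rightarrow> 'a \<Rightarrow> real) \<Rightarrow> bool" where
  "progressive X \<longleftrightarrow> (\<forall>t\<ge>0. (\<lambda>(s, \<omega>). X s \<omega>) \<in>
     borel_measurable (restrict_space borel {0..t} \<Otimes>\<^sub>M F t))"

definition predictable_sigma :: "(real \<times> 'a) measure" where
  "predictable_sigma = sigma ({0..} \<times> space M)
     ({{0} \<times> A | A. A \<in> sets (F 0)} \<union>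
      {{s<..t} \<times> A | s t A. 0 \<le> s \<and> s \<le> t \<and> A \<in> sets (F s)})"

definition predictable :: "(real \<Rightarrow> 'a \<Rightarrow> real) \<Rightarrow> bool" where
  "predictable X \<longleftrightarrow> (\<lambda>(t, \<omega>). X t \<omega>) \<in> borel_measurable predictable_sigma"

definition is_martingale :: "(real \<Rightarrow> 'a \<Rightarrow> real) \<Rightarrow> bool" where
  "is_martingale X \<longleftrightarrow> adapted X \<and> (\<forall>t\<ge>0. integrable M (X t)) \<and>
     (\<forall>s t. 0 \<le> s \<and> s \<le> t \<longrightarrow> (AE \<omega> in M. real_cond_exp M (F s) (X t) \<omega> = X s \<omega>))"

text \<open>Finite-valued localizing times suffice: an extended-valued localizing sequence \<open>\<tau> n\<close> may be
  replaced by \<open>min (\<tau> n) n\<close>. This notion is used for processes starting at \<open>0\<close>.\<close>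

definition local_martingale :: "(real \<Rightarrow> 'a \<Rightarrow> real) \<Rightarrow> bool" where
  "local_martingale X \<longleftrightarrow> adapted X \<and>
     (\<exists>\<tau> :: nat \<Rightarrow> 'a \<Rightarrow> real.
        (\<forall>n. stopping_time F (\<tau> n) \<and> (\<forall>\<omega>\<in>space M. 0 \<le> \<tau> n \<omega>)) \<and>
        (AE \<omega> in M. incseq (\<lambda>n. \<tau> n \<omega>) \<and> filterlim (\<lambda>n. \<tau> n \<omega>) at_top sequentially) \<and>
        (\<forall>n. is_martingale (\<lambda>t \<omega>. X (min t (\<tau> n \<omega>)) \<omega>)))"

definition brownian_motion :: "(real \<Rightarrow> 'a \<Rightarrow> real) \<Rightarrow> bool" where
  "brownian_motion W \<longleftrightarrow> adapted W \<and>
     (AE \<omega> in M. W 0 \<omega> = 0) \<and>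
     (AE \<omega> in M. continuous_on {0..} (\<lambda>t. W t \<omega>)) \<and>
     (\<forall>s t. 0 \<le> s \<and> s < t \<longrightarrow>
        distributed M lborel (\<lambda>\<omega>. W t \<omega> - W s \<omega>) (normal_density 0 (sqrt (t - s))) \<and>
        indep_set (sets (F s))
          {(\<lambda>\<omega>. W t \<omega> - W s \<omega>) -` B \<inter> space M | B. B \<in> sets borel})"

definition simple_point_process :: "(real \<Rightarrow> 'a \<Rightarrow> nat) \<Rightarrow> bool" where
  "simple_point_process N \<longleftrightarrow> adapted (\<lambda>t \<omega>. real (N t \<omega>)) \<and>
     (\<forall>\<omega>\<in>space M. counting_path (\<lambda>t. N t \<omega>))"

definition has_intensity :: "(real \<Rightarrow> 'a \<Rightarrow> nat) \<Rightarrow> (real \<Rightarrow> 'a \<Rightarrow> real) \<Rightarrow> bool" where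
  "has_intensity N l \<longleftrightarrow> predictable l \<and> (\<forall>t\<ge>0. \<forall>\<omega>\<in>space M. 0 \<le> l t \<omega>) \<and>
     (AE \<omega> in M. \<forall>t\<ge>0. set_integrable lborel {0..t} (\<lambda>s. l s \<omega>)) \<and>
     local_martingale (\<lambda>t \<omega>. real (N t \<omega>) - (LBINT s:{0..t}. l s \<omega>))"

text \<open>A simple integrand on \<open>(0, T]\<close> is \<open>\<Sum>i<n. \<xi>\<^sub>i 1\<^bsub>(p\<^sub>i, p\<^sub>i\<^sub>+\<^sub>1]\<^esub>\<close> with \<open>\<xi>\<^sub>i\<close> bounded and
  \<open>F (p\<^sub>i)\<close>-measurable.\<close>

definition simple_integrand ::
    "real \<Rightarrow> nat \<Rightarrow> (nat \<Rightarrow> real) \<Rightarrow> (nat \<Rightarrow> 'a \<Rightarrow> real) \<Rightarrow> bool" where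
  "simple_integrand T n p \<xi> \<longleftrightarrow> 0 \<le> p 0 \<and> mono_on {..n} p \<and> p n \<le> T \<and>
     (\<forall>i<n. \<xi> i \<in> borel_measurable (F (p i)) \<and> (\<exists>C. \<forall>\<omega>\<in>space M. \<bar>\<xi> i \<omega>\<bar> \<le> C))"

definition simple_process ::
    "nat \<Rightarrow> (nat \<Rightarrow> real) \<Rightarrow> (nat \<Rightarrow> 'a \<Rightarrow> real) \<Rightarrow> real \<Rightarrow> 'a \<Rightarrow> real" where
  "simple_process n p \<xi> s \<omega> = (\<Sum>i<n. \<xi> i \<omega> * indicator {p i<..p (Suc i)} s)"

definition simple_integral ::
    "(real \<Rightarrow> 'a \<Rightarrow> real) \<Rightarrow> nat \<Rightarrow> (nat \<Rightarrow> real) \<Rightarrow> (nat \<Rightarrow> 'a \<Rightarrow> real) \<Rightarrow> 'a \<Rightarrow> real" where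
  "simple_integral W n p \<xi> \<omega> = (\<Sum>i<n. \<xi> i \<omega> * (W (p (Suc i)) \<omega> - W (p i) \<omega>))"

text \<open>\<open>Z\<close> is (a continuous version of) the Ito integral process \<open>Z t = \<integral>\<^sub>0\<^sup>t H dW\<close>, for progressive
  \<open>H\<close> with \<open>\<integral>\<^sub>0\<^sup>t H\<^sup>2 ds < \<infinity>\<close> almost surely: \<open>Z T\<close> is the limit in probability of the integrals of
  simple processes \<open>S k\<close> such that \<open>\<integral>\<^sub>0\<^sup>T (H - S k)\<^sup>2 ds \<rightarrow> 0\<close> in probability. This determines
  \<open>Z\<close> up to indistinguishability.\<close>

definition ito_integral ::
    "(real \<Rightarrow> 'a \<Rightarrow> real) \<Rightarrow> (real \<Rightarrow> 'a \<Rightarrow> real) \<Rightarrow> (real \<Rightarrow> 'a \<Rightarrow> real) \<Rightarrow> bool" where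
  "ito_integral W H Z \<longleftrightarrow> progressive H \<and>
     (AE \<omega> in M. \<forall>t\<ge>0. set_integrable lborel {0..t} (\<lambda>s. (H s \<omega>)\<^sup>2)) \<and>
     (AE \<omega> in M. continuous_on {0..} (\<lambda>t. Z t \<omega>)) \<and>
     (\<forall>T\<ge>0. \<exists>n p \<xi>. (\<forall>k :: nat. simple_integrand T (n k) (p k) (\<xi> k)) \<and>
        tendsto_prob
          (\<lambda>k \<omega>. LBINT s:{0..T}. (H s \<omega> - simple_process (n k) (p k) (\<xi> k) s \<omega>)\<^sup>2) (\<lambda>_. 0) \<and>
        tendsto_prob (\<lambda>k. simple_integral W (n k) (p k) (\<xi> k)) (Z T))"

end

locale cir_hawkes = filtered_prob_space M F
  for M :: "'a measure" and F :: "real \<Rightarrow> 'a measure" +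
  fixes a b c \<alpha> \<beta> \<sigma> :: real
    and W :: "real \<Rightarrow> 'a \<Rightarrow> real"
    and N :: "real \<Rightarrow> 'a \<Rightarrow> nat"
    and R :: "real \<Rightarrow> 'a \<Rightarrow> real"
  assumes W_brownian: "brownian_motion W"
    and N_point_process: "simple_point_process N"
    and R_adapted: "adapted R"
    and R_cadlag: "\<omega> \<in> space M \<Longrightarrow> cadlag (\<lambda>t. R t \<omega>)"
    and R_nonneg: "\<omega> \<in> space M \<Longrightarrow> 0 \<le> t \<Longrightarrow> 0 \<le> R t \<omega>"
    and N_intensity: "has_intensity N (\<lambda>t \<omega>. \<alpha> + \<beta> * left_lim (\<lambda>s. R s \<omega>) t)"
    and SDE: "\<exists>Z. ito_integral W (\<lambda>s \<omega>. sqrt (R s \<omega>)) Z \<and>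
      (AE \<omega> in M. \<forall>t\<ge>0.
         R t \<omega> = R 0 \<omega> + (LBINT s:{0..t}. b * (c - R s \<omega>)) + a * real (N t \<omega>) + \<sigma> * Z t \<omega>)"

end

theory Submission
  imports Defs
begin

text \<open>
  Write \<open>I t = \<integral>\<^sub>0\<^sup>t R s ds\<close>, \<open>\<kappa> = b - a \<beta> > 0\<close> and \<open>\<mu> = (b c + a \<alpha>) / \<kappa>\<close>. Inserting the compensator
  \<open>\<alpha> t + \<beta> I t\<close> of \<open>N\<close> into the equation for \<open>R\<close> turns it into the linear equation
  \<open>R t - \<mu> + \<kappa> (I t - \<mu> t) = r - \<mu> + m t\<close> with the noise
  \<open>m t = a (N t - \<alpha> t - \<beta> I t) + \<sigma> Z t\<close>, where \<open>Z\<close> is the Ito integral of \<open>\<surd>R\<close>.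
  Since \<open>R\<close> is the derivative of \<open>I\<close> and \<open>\<kappa> > 0\<close>, the centred integral \<open>I t - \<mu> t\<close> is an exponentially
  weighted average of the right-hand side, so its second moment is at most of the order of that of
  the noise (\<open>ode_energy_bound\<close>). If \<open>E (m t)\<^sup>2 = O(t)\<close>, then \<open>I t / t - \<mu>\<close> has second moment \<open>O(1/t)\<close>,
  and so does \<open>N t / t - \<alpha> - \<beta> \<mu>\<close>, because \<open>N t - \<alpha> t - \<beta> I t\<close> is itself part of the noise.

  It remains to bound the noise, which is a local martingale whose integrability is not given.
  Everything is reduced to \<open>E (I t)\<close>. The truncation at \<open>{I t \<le> C}\<close> gives, with constants that do not
  depend on \<open>C\<close>, bounds for the Ito integral (\<open>ito_second_moment\<close>) and for the counting process
  (\<open>N_truncated_mean\<close>) in terms of \<open>u t = E (min (I t) C)\<close>. At almost every time, the derivative of \<open>min (I t) C\<close> is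
  \<open>R t\<close> on \<open>{I t \<le> C}\<close> and zero elsewhere, so that the equation for \<open>R\<close> turns these bounds into
  a linear integral inequality for \<open>u\<close>. Gronwall's inequality bounds \<open>u\<close> uniformly in \<open>C\<close>, hence
  \<open>E (I t)\<close> is finite (\<open>I_mean_finite\<close>). Taking expectations in the equation without truncation and using
  \<open>R \<ge> 0\<close> and \<open>a \<beta> < b\<close> improves this to \<open>E (I t) = O(t)\<close> (\<open>linear_moment_growth\<close>).
  Now \<open>E (Z t)\<^sup>2\<close> is bounded by a multiple of \<open>1 + E (I t)\<close>, and the compensated counting process is a
  true martingale whose jumps have size one; summing its squared increments over fine grids bounds
  its second moment by a multiple of \<open>E (N t) + \<alpha> t + \<beta> E (I t)\<close> (\<open>compensated_second_moment\<close>).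

  Throughout, stochastic integrals enter through the simple integrals that approximate them at a
  fixed time, and martingales through sums over grids.
\<close>

section \<open>Auxiliary facts on nonnegative integrals\<close>

lemma liminf_eventually_const:
  fixes f :: "nat \<Rightarrow> ennreal"
  assumes "\<forall>\<^sub>F n in sequentially. f n = k"
  shows "liminf f = k"
  using tendsto_eventually[OF assms] by (intro lim_imp_Liminf) simp_all

lemma integrable_of_nn_integral_le:
  fixes f :: "'a \<Rightarrow> real"
  assumes f: "f \<in> borel_measurable M" "\<And>x. 0 \<le> f x" and K: "0 \<le> K"
    and le: "(\<integral>\<^sup>+x. ennreal (f x) \<partial>M) \<le> ennreal K"
  shows "integrable M f" "(\<integral>x. f x \<partial>M) \<le> K"
proof -
  show i: "integrable M f"
    using f by (intro integrableI_nonneg) (auto intro: le_less_trans[OF le ennreal_less_top])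
  have "(\<integral>\<^sup>+x. ennreal (f x) \<partial>M) = ennreal (\<integral>x. f x \<partial>M)"
    using i f by (intro nn_integral_eq_integral) auto
  then show "(\<integral>x. f x \<partial>M) \<le> K" using le K by simp
qed

section \<open>Simple integrals with respect to Brownian motion\<close>

context filtered_prob_space begin

lemma F_borel: "f \<in> borel_measurable (F t) \<Longrightarrow> f \<in> borel_measurable M"
  using subalgebra_F[of t] by (rule measurable_from_subalg)

lemma F_borel_mono: "s \<le> t \<Longrightarrow> f \<in> borel_measurable (F s) \<Longrightarrow> f \<in> borel_measurable (F t)"
  using sets_F_mono[of s t] space_F by (auto simp: measurable_def)

text \<open>An event of \<open>F s\<close> is independent of the events generated by the increment; this passes to
  variables because both families are stable under intersection.\<close>

lemma brownian_increment_indep: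
  assumes W: "brownian_motion W" and s: "0 \<le> s" "s < t" and Y: "Y \<in> borel_measurable (F s)"
  shows "indep_var borel Y borel (\<lambda>\<omega>. W t \<omega> - W s \<omega>)"
proof -
  let ?D = "\<lambda>\<omega>. W t \<omega> - W s \<omega>"
  have ind: "indep_set (sets (F s)) {?D -` B \<inter> space M | B. B \<in> sets borel}"
    using W s unfolding brownian_motion_def by blast
  have m: "W t \<in> borel_measurable M" "W s \<in> borel_measurable M"
    using W s F_borel[of "W t" t] F_borel[of "W s" s] unfolding brownian_motion_def adapted_def by auto
  have sub1: "sigma_sets (space M) {Y -` A \<inter> space M | A. A \<in> sets borel} \<subseteq> sets (F s)"
    using measurable_sets[OF Y] sets.sigma_sets_subset[of "{Y -` A \<inter> space M | A. A \<in> sets borel}" "F s"]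
    by (auto simp: space_F)
  have "Int_stable {?D -` B \<inter> space M | B. B \<in> sets borel}"
  proof (rule Int_stableI, safe)
    fix B C :: "real set" assume "B \<in> sets borel" "C \<in> sets borel"
    then show "\<exists>D. ?D -` B \<inter> space M \<inter> (?D -` C \<inter> space M) = ?D -` D \<inter> space M \<and> D \<in> sets borel"
      by (intro exI[of _ "B \<inter> C"]) auto
  qed
  then have "indep_set (sigma_sets (space M) (sets (F s)))
      (sigma_sets (space M) {?D -` B \<inter> space M | B. B \<in> sets borel})"
    using ind by (intro indep_set_sigma_sets) (auto simp: Int_stable_def)
  then have ind2: "indep_set (sets (F s))
      (sigma_sets (space M) {?D -` B \<inter> space M | B. B \<in> sets borel})"
    using sets.sigma_sets_eq[of "F s"] by (simp add: space_F)
  show ?thesis unfolding indep_var_eq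
  proof (intro conjI)
    show "indep_set (sigma_sets (space M) {Y -` A \<inter> space M | A. A \<in> sets borel})
       (sigma_sets (space M) {?D -` B \<inter> space M | B. B \<in> sets borel})"
      using ind2 sub1 unfolding indep_set_def
      by (elim indep_sets_mono_sets) (auto split: bool.split)
  qed (use m F_borel[OF Y] in auto)
qed

text \<open>The case \<open>s = t\<close> is included, since the grid of a simple integrand may repeat points.\<close>

lemma brownian_increment_moments:
  assumes W: "brownian_motion W" and s: "0 \<le> s" "s \<le> t" and Y: "Y \<in> borel_measurable (F s)"
    and iY: "integrable M Y"
  shows "integrable M (\<lambda>\<omega>. Y \<omega> * (W t \<omega> - W s \<omega>))"
    "(\<integral>\<omega>. Y \<omega> * (W t \<omega> - W s \<omega>) \<partial>M) = 0"
    "integrable M (\<lambda>\<omega>. Y \<omega> * (W t \<omega> - W s \<omega>)\<^sup>2)"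
    "(\<integral>\<omega>. Y \<omega> * (W t \<omega> - W s \<omega>)\<^sup>2 \<partial>M) = (t - s) * (\<integral>\<omega>. Y \<omega> \<partial>M)"
proof -
  let ?D = "\<lambda>\<omega>. W t \<omega> - W s \<omega>"
  have "integrable M (\<lambda>\<omega>. Y \<omega> * ?D \<omega>) \<and> (\<integral>\<omega>. Y \<omega> * ?D \<omega> \<partial>M) = 0 \<and>
     integrable M (\<lambda>\<omega>. Y \<omega> * (?D \<omega>)\<^sup>2) \<and> (\<integral>\<omega>. Y \<omega> * (?D \<omega>)\<^sup>2 \<partial>M) = (t - s) * (\<integral>\<omega>. Y \<omega> \<partial>M)"
  proof (cases "s = t")
    case False
    then have st: "s < t" using s by simp
    then have pos: "sqrt (t - s) > 0" by simp
    have d: "distributed M lborel ?D (normal_density 0 (sqrt (t - s)))"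
      using W s st unfolding brownian_motion_def by blast
    have nn: "\<And>x. 0 \<le> normal_density 0 (sqrt (t - s)) x" by simp
    have i1: "integrable M ?D"
      using distributed_integrable[OF d, of "\<lambda>x. x"] integrable_normal_moment_nz_1[OF pos, of 0] nn
      by simp
    have e1: "(\<integral>\<omega>. ?D \<omega> \<partial>M) = 0"
      using distributed_integral[OF d, of "\<lambda>x. x"] integral_normal_moment_nz_1[OF pos, of 0] nn
      by simp
    have i2: "integrable M (\<lambda>\<omega>. (?D \<omega>)\<^sup>2)"
      using distributed_integrable[OF d, of "\<lambda>x. x\<^sup>2"] integrable_normal_moment[OF pos, of 0 2] nn
      by simp
    have e2: "(\<integral>\<omega>. (?D \<omega>)\<^sup>2 \<partial>M) = t - s"
      using distributed_integral[OF d, of "\<lambda>x. x\<^sup>2"] integral_normal_moment_even[OF pos, of 0 1] nn st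
      by (simp add: fact_numeral)
    have ind: "indep_var borel Y borel ?D"
      by (rule brownian_increment_indep[OF W s(1) st Y])
    have ind2: "indep_var borel Y borel (\<lambda>\<omega>. (?D \<omega>)\<^sup>2)"
      using indep_var_compose[OF ind, of "\<lambda>x. x" borel "\<lambda>x. x\<^sup>2" borel] by (simp add: comp_def)
    show ?thesis
      using indep_var_lebesgue_integral[OF ind iY i1] indep_var_integrable[OF ind iY i1]
        indep_var_lebesgue_integral[OF ind2 iY i2] indep_var_integrable[OF ind2 iY i2] e1 e2
      by simp
  qed simp
  then show "integrable M (\<lambda>\<omega>. Y \<omega> * ?D \<omega>)" "(\<integral>\<omega>. Y \<omega> * ?D \<omega> \<partial>M) = 0"
    "integrable M (\<lambda>\<omega>. Y \<omega> * (?D \<omega>)\<^sup>2)"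
    "(\<integral>\<omega>. Y \<omega> * (?D \<omega>)\<^sup>2 \<partial>M) = (t - s) * (\<integral>\<omega>. Y \<omega> \<partial>M)" by auto
qed

text \<open>Ito's isometry. Adding one interval to the sum produces a cross term that vanishes, because the new
  increment is independent of the past and centred.\<close>

lemma simple_isometry:
  assumes W: "brownian_motion W" and p0: "0 \<le> p 0" and p: "mono_on {..n} p"
    and \<eta>: "\<And>i. i < n \<Longrightarrow> \<eta> i \<in> borel_measurable (F (p i))"
    and bd: "\<And>i. i < n \<Longrightarrow> \<exists>C. \<forall>\<omega>\<in>space M. \<bar>\<eta> i \<omega>\<bar> \<le> C"
  shows "integrable M (\<lambda>\<omega>. (simple_integral W n p \<eta> \<omega>)\<^sup>2)"
    "(\<integral>\<omega>. (simple_integral W n p \<eta> \<omega>)\<^sup>2 \<partial>M) = (\<integral>\<omega>. (\<Sum>i<n. (\<eta> i \<omega>)\<^sup>2 * (p (Suc i) - p i)) \<partial>M)"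
proof -
  have pm: "p i \<le> p j" if "i \<le> j" "j \<le> n" for i j
    using p that by (auto simp: mono_on_def)
  have p_nonneg: "0 \<le> p i" if "i \<le> n" for i using p0 pm[of 0 i] that by simp
  define J where "J m = simple_integral W m p \<eta>" for m
  have Wm: "W (p i) \<in> borel_measurable (F (p i))" if "i \<le> n" for i
    using W p_nonneg[OF that] unfolding brownian_motion_def adapted_def by auto
  have Jm: "J m \<in> borel_measurable (F (p m))" if "m \<le> n" for m
    unfolding J_def simple_integral_def
  proof (intro borel_measurable_sum borel_measurable_times borel_measurable_diff)
    fix i assume "i \<in> {..<m}"
    then have i: "i < m" "i < n" "Suc i \<le> m" "Suc i \<le> n" using that by auto
    show "\<eta> i \<in> borel_measurable (F (p m))"
      by (rule F_borel_mono[OF pm \<eta>]) (use i that in auto)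
    show "W (p i) \<in> borel_measurable (F (p m))"
      by (rule F_borel_mono[OF pm Wm]) (use i that in auto)
    show "W (p (Suc i)) \<in> borel_measurable (F (p m))"
      by (rule F_borel_mono[OF pm Wm]) (use i that in auto)
  qed
  have sq: "integrable M (\<lambda>\<omega>. (\<eta> i \<omega>)\<^sup>2)" if "i < n" for i
  proof -
    obtain C where C: "\<forall>\<omega>\<in>space M. \<bar>\<eta> i \<omega>\<bar> \<le> C" using bd[OF \<open>i < n\<close>] by blast
    have [measurable]: "\<eta> i \<in> borel_measurable M" using F_borel \<eta>[OF that] by blast
    show ?thesis
    proof (rule integrable_const_bound[of _ "C\<^sup>2"])
      show "AE x in M. norm ((\<eta> i x)\<^sup>2) \<le> C\<^sup>2"
        using C by (intro AE_I2) (auto intro: power_mono[of "\<bar>_\<bar>" C 2, simplified])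
    qed simp
  qed
  have "integrable M (\<lambda>\<omega>. (J m \<omega>)\<^sup>2) \<and>
    (\<integral>\<omega>. (J m \<omega>)\<^sup>2 \<partial>M) = (\<Sum>i<m. (p (Suc i) - p i) * (\<integral>\<omega>. (\<eta> i \<omega>)\<^sup>2 \<partial>M))" if "m \<le> n" for m
    using that
  proof (induction m)
    case 0 then show ?case by (simp add: J_def simple_integral_def)
  next
    case (Suc m)
    then have m: "m < n" "m \<le> n" "Suc m \<le> n" by auto
    have IH: "integrable M (\<lambda>\<omega>. (J m \<omega>)\<^sup>2)"
      "(\<integral>\<omega>. (J m \<omega>)\<^sup>2 \<partial>M) = (\<Sum>i<m. (p (Suc i) - p i) * (\<integral>\<omega>. (\<eta> i \<omega>)\<^sup>2 \<partial>M))"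
      using Suc.IH m by auto
    define D where "D \<omega> = W (p (Suc m)) \<omega> - W (p m) \<omega>" for \<omega>
    have [measurable]: "J m \<in> borel_measurable M" "\<eta> m \<in> borel_measurable M"
      using F_borel Jm[OF m(2)] \<eta>[OF m(1)] by auto
    have iJ: "integrable M (J m)"
      by (rule square_integrable_imp_integrable[OF _ IH(1)]) simp
    obtain C where C: "\<forall>\<omega>\<in>space M. \<bar>\<eta> m \<omega>\<bar> \<le> C" using bd[OF m(1)] by blast
    have iJe: "integrable M (\<lambda>\<omega>. \<eta> m \<omega> * J m \<omega>)"
    proof (rule Bochner_Integration.integrable_bound[OF integrable_mult_right[OF integrable_abs[OF iJ], of C]])
      show "AE x in M. norm (\<eta> m x * J m x) \<le> norm (C * \<bar>J m x\<bar>)"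
        using C by (intro AE_I2) (force simp: abs_mult intro!: mult_right_mono)
    qed simp
    have me: "(\<lambda>\<omega>. \<eta> m \<omega> * J m \<omega>) \<in> borel_measurable (F (p m))"
      "(\<lambda>\<omega>. (\<eta> m \<omega>)\<^sup>2) \<in> borel_measurable (F (p m))"
      using Jm[OF m(2)] \<eta>[OF m(1)] by measurable
    note c = brownian_increment_moments[OF W p_nonneg[OF m(2)] pm[OF _ m(3), of m] me(1) iJe, folded D_def]
    note s = brownian_increment_moments[OF W p_nonneg[OF m(2)] pm[OF _ m(3), of m] me(2) sq[OF m(1)], folded D_def]
    have eq: "(J (Suc m) \<omega>)\<^sup>2 = (J m \<omega>)\<^sup>2 + 2 * (\<eta> m \<omega> * J m \<omega> * D \<omega>) + (\<eta> m \<omega>)\<^sup>2 * (D \<omega>)\<^sup>2" for \<omega>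
      unfolding J_def simple_integral_def D_def by (simp add: power2_eq_square algebra_simps)
    show ?case unfolding eq using c s IH by simp
  qed
  from this[of n] show "integrable M (\<lambda>\<omega>. (simple_integral W n p \<eta> \<omega>)\<^sup>2)"
    "(\<integral>\<omega>. (simple_integral W n p \<eta> \<omega>)\<^sup>2 \<partial>M) = (\<integral>\<omega>. (\<Sum>i<n. (\<eta> i \<omega>)\<^sup>2 * (p (Suc i) - p i)) \<partial>M)"
    by (auto simp: J_def Bochner_Integration.integral_sum sq mult.commute)
qed


section \<open>Convergence in probability and path integrals of progressive processes\<close>

lemma tendsto_prob_imp_L1:
  assumes "tendsto_prob X Y"
  shows "(\<lambda>k. \<integral>\<omega>. min 1 \<bar>X k \<omega> - Y \<omega>\<bar> \<partial>M) \<longlonglongrightarrow> 0"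
proof (rule LIMSEQ_I)
  fix r :: real assume r: "0 < r"
  have [measurable]: "X k \<in> borel_measurable M" "Y \<in> borel_measurable M" for k
    using assms by (auto simp: tendsto_prob_def)
  have "(\<lambda>k. prob {\<omega> \<in> space M. r/2 \<le> \<bar>X k \<omega> - Y \<omega>\<bar>}) \<longlonglongrightarrow> 0"
    using assms[unfolded tendsto_prob_def, THEN conjunct2, THEN conjunct2, rule_format, of "r/2"] r by simp
  then have "\<forall>\<^sub>F k in sequentially. prob {\<omega> \<in> space M. r/2 \<le> \<bar>X k \<omega> - Y \<omega>\<bar>} < r/2"
    using r by (intro order_tendstoD(2)) auto
  then obtain k0 where k0: "\<And>k. k \<ge> k0 \<Longrightarrow> prob {\<omega> \<in> space M. r/2 \<le> \<bar>X k \<omega> - Y \<omega>\<bar>} < r/2"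
    by (auto simp: eventually_sequentially)
  show "\<exists>no. \<forall>n\<ge>no. norm ((\<integral>\<omega>. min 1 \<bar>X n \<omega> - Y \<omega>\<bar> \<partial>M) - 0) < r"
  proof (intro exI allI impI)
    fix k assume "k0 \<le> k"
    let ?A = "{\<omega> \<in> space M. r/2 \<le> \<bar>X k \<omega> - Y \<omega>\<bar>}"
    have "(\<integral>\<omega>. min 1 \<bar>X k \<omega> - Y \<omega>\<bar> \<partial>M) \<le> (\<integral>\<omega>. r/2 + indicator ?A \<omega> \<partial>M)"
    proof (rule integral_mono)
      show "integrable M (\<lambda>\<omega>. min 1 \<bar>X k \<omega> - Y \<omega>\<bar>)"
        by (rule integrable_const_bound[of _ 1]) auto
      show "integrable M (\<lambda>\<omega>. r/2 + indicator ?A \<omega>)"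
        by (intro Bochner_Integration.integrable_add integrable_const integrable_real_indicator)
          (auto simp: emeasure_eq_measure)
    qed (use r in \<open>auto simp: indicator_def min_def\<close>)
    also have "\<dots> = r/2 + prob ?A"
      by (subst Bochner_Integration.integral_add) (auto simp: prob_space emeasure_eq_measure)
    also have "\<dots> < r" using k0[OF \<open>k0 \<le> k\<close>] by simp
    finally have "(\<integral>\<omega>. min 1 \<bar>X k \<omega> - Y \<omega>\<bar> \<partial>M) < r" .
    moreover have "0 \<le> (\<integral>\<omega>. min 1 \<bar>X k \<omega> - Y \<omega>\<bar> \<partial>M)" by (rule integral_nonneg_AE) auto
    ultimately show "norm ((\<integral>\<omega>. min 1 \<bar>X k \<omega> - Y \<omega>\<bar> \<partial>M) - 0) < r" by simp
  qed
qed

text \<open>Two sequences that converge in probability converge almost surely along a common subsequence: apply the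
  \<open>L\<^sup>1\<close> statement to the sum of the two truncated distances.\<close>

lemma tendsto_prob_AE_subseq2:
  assumes "tendsto_prob X Y" "tendsto_prob X' Y'"
  obtains r :: "nat \<Rightarrow> nat" where "strict_mono r"
    "AE \<omega> in M. (\<lambda>k. X (r k) \<omega>) \<longlonglongrightarrow> Y \<omega>" "AE \<omega> in M. (\<lambda>k. X' (r k) \<omega>) \<longlonglongrightarrow> Y' \<omega>"
proof -
  have [measurable]: "X k \<in> borel_measurable M" "Y \<in> borel_measurable M"
    "X' k \<in> borel_measurable M" "Y' \<in> borel_measurable M" for k
    using assms by (auto simp: tendsto_prob_def)
  define d where "d k \<omega> = min 1 \<bar>X k \<omega> - Y \<omega>\<bar> + min 1 \<bar>X' k \<omega> - Y' \<omega>\<bar>" for k \<omega>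
  have i: "integrable M (\<lambda>\<omega>. min 1 \<bar>X k \<omega> - Y \<omega>\<bar>)" "integrable M (\<lambda>\<omega>. min 1 \<bar>X' k \<omega> - Y' \<omega>\<bar>)" for k
    by (auto intro!: integrable_const_bound[of _ 1])
  have id: "integrable M (d k)" for k unfolding d_def using i by auto
  have "(\<integral>\<omega>. norm (d k \<omega>) \<partial>M) = (\<integral>\<omega>. min 1 \<bar>X k \<omega> - Y \<omega>\<bar> \<partial>M) + (\<integral>\<omega>. min 1 \<bar>X' k \<omega> - Y' \<omega>\<bar> \<partial>M)" for k
    using i[of k] by (simp add: d_def abs_of_nonneg)
  then have "(\<lambda>k. \<integral>\<omega>. norm (d k \<omega>) \<partial>M) \<longlonglongrightarrow> 0"
    using tendsto_add[OF tendsto_prob_imp_L1[OF assms(1)] tendsto_prob_imp_L1[OF assms(2)]] by simp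
  from tendsto_L1_AE_subseq[OF id this] obtain r :: "nat \<Rightarrow> nat" where r: "strict_mono r"
    "AE \<omega> in M. (\<lambda>k. d (r k) \<omega>) \<longlonglongrightarrow> 0" by (elim exE conjE)
  have conv: "x \<longlonglongrightarrow> y" if "(\<lambda>k. min 1 \<bar>x k - y\<bar>) \<longlonglongrightarrow> 0" for x :: "nat \<Rightarrow> real" and y
  proof -
    have "\<forall>\<^sub>F k in sequentially. min 1 \<bar>x k - y\<bar> < 1"
      using that by (rule order_tendstoD) simp
    then have "\<forall>\<^sub>F k in sequentially. min 1 \<bar>x k - y\<bar> = \<bar>x k - y\<bar>" by eventually_elim auto
    from Lim_transform_eventually[OF that this] have "(\<lambda>k. \<bar>x k - y\<bar>) \<longlonglongrightarrow> 0" .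
    then have "(\<lambda>k. x k - y) \<longlonglongrightarrow> 0" by (simp only: tendsto_rabs_zero_iff)
    then show ?thesis by (rule LIM_zero_cancel)
  qed
  show thesis
  proof (rule that[OF r(1)])
    show "AE \<omega> in M. (\<lambda>k. X (r k) \<omega>) \<longlonglongrightarrow> Y \<omega>" using r(2)
    proof eventually_elim
      case d: (elim \<omega>)
      have "(\<lambda>k. min 1 \<bar>X (r k) \<omega> - Y \<omega>\<bar>) \<longlonglongrightarrow> 0"
        by (rule tendsto_sandwich[OF _ _ tendsto_const d]) (auto simp: d_def)
      then show ?case by (rule conv)
    qed
    show "AE \<omega> in M. (\<lambda>k. X' (r k) \<omega>) \<longlonglongrightarrow> Y' \<omega>" using r(2)
    proof eventually_elim
      case d: (elim \<omega>)
      have "(\<lambda>k. min 1 \<bar>X' (r k) \<omega> - Y' \<omega>\<bar>) \<longlonglongrightarrow> 0"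
        by (rule tendsto_sandwich[OF _ _ tendsto_const d]) (auto simp: d_def)
      then show ?case by (rule conv)
    qed
  qed
qed

text \<open>Progressive measurability is what makes the integral up to \<open>t\<close> measurable for \<open>F t\<close>.\<close>

lemma progressive_integral_measurable:
  assumes "progressive H" "0 \<le> t" and g[measurable]: "g \<in> borel_measurable borel"
  shows "(\<lambda>\<omega>. LBINT s:{0..t}. (g (H s \<omega>) :: real)) \<in> borel_measurable (F t)"
proof -
  interpret L: sigma_finite_measure "restrict_space lborel {0..t}"
    by (rule sigma_finite_measure_restrict_space) (auto intro: sigma_finite_lborel)
  have e: "sets (restrict_space borel {0..t} \<Otimes>\<^sub>M F t) = sets (restrict_space lborel {0..t} \<Otimes>\<^sub>M F t)"
    by (intro sets_pair_measure_cong sets_restrict_space_cong) auto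
  have "(\<lambda>(s, \<omega>). H s \<omega>) \<in> borel_measurable (restrict_space borel {0..t} \<Otimes>\<^sub>M F t)"
    using assms unfolding progressive_def by auto
  then have m: "(\<lambda>(s, \<omega>). H s \<omega>) \<in> borel_measurable (restrict_space lborel {0..t} \<Otimes>\<^sub>M F t)"
    by (simp add: measurable_cong_sets[OF e refl])
  have "(\<lambda>x. H (snd x) (fst x)) \<in> borel_measurable (F t \<Otimes>\<^sub>M restrict_space lborel {0..t})"
    using measurable_compose[OF measurable_pair_swap' m] by (simp add: split_beta)
  then have "(\<lambda>(\<omega>, s). g (H s \<omega>)) \<in> borel_measurable (F t \<Otimes>\<^sub>M restrict_space lborel {0..t})"
    by (simp add: split_beta)
  from L.borel_measurable_lebesgue_integral[OF this]
  have "(\<lambda>\<omega>. integral\<^sup>L (restrict_space lborel {0..t}) (\<lambda>s. g (H s \<omega>))) \<in> borel_measurable (F t)" .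
  then show ?thesis
    by (simp add: integral_restrict_space set_lebesgue_integral_def)
qed

lemma progressive_section_measurable:
  assumes "progressive H" "0 \<le> t" "\<omega> \<in> space M"
  shows "(\<lambda>s. H s \<omega>) \<in> borel_measurable (restrict_space borel {0..t})"
proof -
  have "(\<lambda>(s, \<omega>). H s \<omega>) \<in> borel_measurable (restrict_space borel {0..t} \<Otimes>\<^sub>M F t)"
    using assms unfolding progressive_def by auto
  moreover have "(\<lambda>s. (s, \<omega>)) \<in> restrict_space borel {0..t} \<rightarrow>\<^sub>M restrict_space borel {0..t} \<Otimes>\<^sub>M F t"
    using assms(3) by (intro measurable_Pair) (auto simp: space_F)
  ultimately show ?thesis
    using measurable_compose[of "\<lambda>s. (s, \<omega>)" _ _ "\<lambda>(s, \<omega>). H s \<omega>"] by simp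
qed

text \<open>The intervals of the grid are disjoint, so squaring a simple process squares its coefficients.\<close>

lemma simple_process_props:
  assumes p0: "0 \<le> p 0" and p: "mono_on {..n} p" and "m \<le> n"
  shows "p m < s \<Longrightarrow> simple_process m p \<xi> s \<omega> = 0"
    and "(simple_process m p \<xi> s \<omega>)\<^sup>2 = (\<Sum>i<m. (\<xi> i \<omega>)\<^sup>2 * indicator {p i<..p (Suc i)} s)"
proof -
  have pm: "p i \<le> p j" if "i \<le> j" "j \<le> n" for i j
    using p that by (auto simp: mono_on_def)
  have z: "simple_process m p \<xi> s \<omega> = 0" if "m \<le> n" "p m < s" for m
    unfolding simple_process_def
  proof (rule sum.neutral, safe)
    fix i assume "i < m"
    then have "p (Suc i) < s" using pm[of "Suc i" m] that by auto
    then show "\<xi> i \<omega> * indicator {p i<..p (Suc i)} s = 0" by simp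
  qed
  then show "p m < s \<Longrightarrow> simple_process m p \<xi> s \<omega> = 0" using assms by auto
  show "(simple_process m p \<xi> s \<omega>)\<^sup>2 = (\<Sum>i<m. (\<xi> i \<omega>)\<^sup>2 * indicator {p i<..p (Suc i)} s)"
    using \<open>m \<le> n\<close>
  proof (induction m)
    case 0 then show ?case by (simp add: simple_process_def)
  next
    case (Suc m)
    have "simple_process m p \<xi> s \<omega> * indicator {p m<..p (Suc m)} s = 0"
      using z[of m] Suc.prems by (auto simp: indicator_def)
    moreover have "simple_process (Suc m) p \<xi> s \<omega> = simple_process m p \<xi> s \<omega> + \<xi> m \<omega> * indicator {p m<..p (Suc m)} s"
      by (simp add: simple_process_def)
    moreover have "(u + v * j)\<^sup>2 = u\<^sup>2 + v\<^sup>2 * j" if "u * j = 0" "j * j = j" for u v j :: real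
    proof -
      have "(u + v * j)\<^sup>2 = u\<^sup>2 + 2 * v * (u * j) + v\<^sup>2 * (j * j)" by (simp add: power2_eq_square algebra_simps)
      then show ?thesis using that by simp
    qed
    ultimately show ?case using Suc by (simp add: indicator_def)
  qed
qed

lemma simple_process_square_integral:
  assumes S: "simple_integrand T n p \<xi>"
  shows "set_integrable lborel {0..T} (\<lambda>s. (simple_process n p \<xi> s \<omega>)\<^sup>2)"
    and "(LBINT s:{0..T}. (simple_process n p \<xi> s \<omega>)\<^sup>2) = (\<Sum>i<n. (\<xi> i \<omega>)\<^sup>2 * (p (Suc i) - p i))"
proof -
  have p: "0 \<le> p 0" "mono_on {..n} p" "p n \<le> T" using S by (auto simp: simple_integrand_def)
  have pm: "p i \<le> p j" if "i \<le> j" "j \<le> n" for i j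
    using p that by (auto simp: mono_on_def)
  have eq: "indicator {0..T} s *\<^sub>R (simple_process n p \<xi> s \<omega>)\<^sup>2
      = (\<Sum>i<n. (\<xi> i \<omega>)\<^sup>2 * indicator {p i<..p (Suc i)} s)" for s
  proof (cases "s \<in> {0..T}")
    case True then show ?thesis using simple_process_props(2)[OF p(1,2) order_refl] by simp
  next
    case False
    have "(\<Sum>i<n. (\<xi> i \<omega>)\<^sup>2 * indicator {p i<..p (Suc i)} s) = 0"
    proof (rule sum.neutral, safe)
      fix i assume "i < n"
      then have "0 \<le> p i" "p (Suc i) \<le> T" using pm[of 0 i] pm[of "Suc i" n] p by auto
      then show "(\<xi> i \<omega>)\<^sup>2 * indicator {p i<..p (Suc i)} s = 0" using False by (auto simp: indicator_def)
    qed
    then show ?thesis using False by simp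
  qed
  show "set_integrable lborel {0..T} (\<lambda>s. (simple_process n p \<xi> s \<omega>)\<^sup>2)"
    unfolding set_integrable_def eq
    by (intro Bochner_Integration.integrable_sum integrable_mult_right integrable_real_indicator)
       (use pm in \<open>auto simp: emeasure_lborel_Ioc\<close>)
  have "(LBINT s:{0..T}. (simple_process n p \<xi> s \<omega>)\<^sup>2)
     = (\<Sum>i<n. (\<integral>s. (\<xi> i \<omega>)\<^sup>2 * indicator {p i<..p (Suc i)} s \<partial>lborel))"
    unfolding set_lebesgue_integral_def eq
    by (intro Bochner_Integration.integral_sum integrable_mult_right integrable_real_indicator)
       (use pm in \<open>auto simp: emeasure_lborel_Ioc\<close>)
  also have "\<dots> = (\<Sum>i<n. (\<xi> i \<omega>)\<^sup>2 * (p (Suc i) - p i))"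
    using pm by (intro sum.cong) auto
  finally show "(LBINT s:{0..T}. (simple_process n p \<xi> s \<omega>)\<^sup>2) = (\<Sum>i<n. (\<xi> i \<omega>)\<^sup>2 * (p (Suc i) - p i))" .
qed


section \<open>The second moment of an Ito integral\<close>

text \<open>Term \<open>i\<close> is kept only while the partial sum including it is at most \<open>K\<close>. After the first failure
  everything is dropped, because partial sums of nonnegative terms increase.\<close>

lemma truncated_sum_le:
  fixes x :: "nat \<Rightarrow> real"
  assumes "\<And>i. i < n \<Longrightarrow> 0 \<le> x i" "0 \<le> K"
  shows "(\<Sum>i<n. if (\<Sum>j<Suc i. x j) \<le> K then x i else 0) \<le> min (\<Sum>i<n. x i) K"
  using assms(1)
proof (induction n)
  case (Suc n)
  let ?s = "\<lambda>n. \<Sum>i<n. if (\<Sum>j<Suc i. x j) \<le> K then x i else 0"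
  have IH: "?s n \<le> min (\<Sum>i<n. x i) K" using Suc by simp
  show ?case
  proof (cases "(\<Sum>j<Suc n. x j) \<le> K")
    case True then show ?thesis using IH by simp
  next
    case False then show ?thesis using IH Suc.prems[of n] by simp
  qed
qed (use assms in simp)

text \<open>Stops a simple integrand before its quadratic variation exceeds \<open>K\<close>. The quadratic variation up to the
  end of an interval is known at the start of that interval, so the truncated coefficients are still
  admissible and the isometry applies to them.\<close>

lemma truncated_simple_integral:
  assumes W: "brownian_motion W" and S: "simple_integrand T n p \<xi>" and K: "0 \<le> K"
  obtains U where "U \<in> borel_measurable M"
    "(\<integral>\<^sup>+\<omega>. ennreal ((U \<omega>)\<^sup>2) \<partial>M)
       \<le> (\<integral>\<^sup>+\<omega>. ennreal (min (LBINT s:{0..T}. (simple_process n p \<xi> s \<omega>)\<^sup>2) K) \<partial>M)"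
    "\<And>\<omega>. (LBINT s:{0..T}. (simple_process n p \<xi> s \<omega>)\<^sup>2) \<le> K \<Longrightarrow> U \<omega> = simple_integral W n p \<xi> \<omega>"
proof -
  have p: "0 \<le> p 0" "mono_on {..n} p" "p n \<le> T" using S by (auto simp: simple_integrand_def)
  have pm: "p i \<le> p j" if "i \<le> j" "j \<le> n" for i j
    using p that by (auto simp: mono_on_def)
  have p_nonneg: "0 \<le> p i" if "i \<le> n" for i using p pm[of 0 i] that by simp
  have \<xi>m: "\<xi> i \<in> borel_measurable (F (p i))" and \<xi>b: "\<exists>C. \<forall>\<omega>\<in>space M. \<bar>\<xi> i \<omega>\<bar> \<le> C" if "i < n" for i
    using S that by (auto simp: simple_integrand_def)
  define x where "x i \<omega> = (\<xi> i \<omega>)\<^sup>2 * (p (Suc i) - p i)" for i \<omega>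
  define \<eta> where "\<eta> i \<omega> = (if (\<Sum>j<Suc i. x j \<omega>) \<le> K then \<xi> i \<omega> else 0)" for i \<omega>
  have x0: "0 \<le> x i \<omega>" if "i < n" for i \<omega> using pm[of i "Suc i"] that by (simp add: x_def)
  have \<eta>m: "\<eta> i \<in> borel_measurable (F (p i))" if "i < n" for i
  proof -
    have [measurable]: "\<xi> j \<in> borel_measurable (F (p i))" if "j \<le> i" for j
      by (rule F_borel_mono[OF pm \<xi>m]) (use that \<open>i < n\<close> in auto)
    have "(\<lambda>\<omega>. \<Sum>j<Suc i. x j \<omega>) \<in> borel_measurable (F (p i))"
      unfolding x_def by (intro borel_measurable_sum borel_measurable_times borel_measurable_power) auto
    then show ?thesis unfolding \<eta>_def by measurable
  qed
  have \<eta>b: "\<exists>C. \<forall>\<omega>\<in>space M. \<bar>\<eta> i \<omega>\<bar> \<le> C" if i: "i < n" for i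
  proof -
    obtain C where C: "\<forall>\<omega>\<in>space M. \<bar>\<xi> i \<omega>\<bar> \<le> C" using \<xi>b[OF i] by blast
    then have "\<forall>\<omega>\<in>space M. \<bar>\<eta> i \<omega>\<bar> \<le> max C 0" by (auto simp: \<eta>_def max_def)
    then show ?thesis by blast
  qed
  note iso = simple_isometry[OF W p(1,2) \<eta>m \<eta>b]
  have Q: "(LBINT s:{0..T}. (simple_process n p \<xi> s \<omega>)\<^sup>2) = (\<Sum>i<n. x i \<omega>)" for \<omega>
    by (simp add: simple_process_square_integral(2)[OF S] x_def)
  have \<eta>x: "(\<Sum>i<n. (\<eta> i \<omega>)\<^sup>2 * (p (Suc i) - p i)) = (\<Sum>i<n. if (\<Sum>j<Suc i. x j \<omega>) \<le> K then x i \<omega> else 0)" for \<omega>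
    by (intro sum.cong) (auto simp: \<eta>_def x_def)
  have Um: "simple_integral W n p \<eta> \<in> borel_measurable M"
    unfolding simple_integral_def
  proof (intro borel_measurable_sum borel_measurable_times borel_measurable_diff)
    fix i assume i: "i \<in> {..<n}"
    show "\<eta> i \<in> borel_measurable M" using F_borel[OF \<eta>m] i by auto
    have Wm: "W s \<in> borel_measurable M" if "0 \<le> s" for s
      using W F_borel[of "W s" s] that unfolding brownian_motion_def adapted_def by auto
    show "W (p i) \<in> borel_measurable M" "W (p (Suc i)) \<in> borel_measurable M"
      using i by (auto intro!: Wm p_nonneg)
  qed
  show thesis
  proof (rule that[of "simple_integral W n p \<eta>"])
    let ?g = "\<lambda>\<omega>. \<Sum>i<n. (\<eta> i \<omega>)\<^sup>2 * (p (Suc i) - p i)"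
    have g0: "0 \<le> ?g \<omega>" for \<omega> using pm by (auto intro!: sum_nonneg)
    have gm: "?g \<in> borel_measurable M"
      by (intro borel_measurable_sum borel_measurable_times borel_measurable_power F_borel[OF \<eta>m]) auto
    have gK: "?g \<omega> \<le> min (\<Sum>i<n. x i \<omega>) K" for \<omega>
      unfolding \<eta>x by (rule truncated_sum_le) (use x0 K in auto)
    have gi: "integrable M ?g"
      by (rule integrable_const_bound[OF _ gm, of K]) (use g0 gK in auto)
    have "(\<integral>\<^sup>+\<omega>. ennreal ((simple_integral W n p \<eta> \<omega>)\<^sup>2) \<partial>M) = ennreal (\<integral>\<omega>. ?g \<omega> \<partial>M)"
      using iso by (subst nn_integral_eq_integral) auto
    also have "\<dots> = (\<integral>\<^sup>+\<omega>. ennreal (?g \<omega>) \<partial>M)"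
      using gi g0 by (subst nn_integral_eq_integral) auto
    also have "\<dots> \<le> (\<integral>\<^sup>+\<omega>. ennreal (min (\<Sum>i<n. x i \<omega>) K) \<partial>M)"
      using gK by (intro nn_integral_mono ennreal_leI)
    finally show "(\<integral>\<^sup>+\<omega>. ennreal ((simple_integral W n p \<eta> \<omega>)\<^sup>2) \<partial>M)
      \<le> (\<integral>\<^sup>+\<omega>. ennreal (min (LBINT s:{0..T}. (simple_process n p \<xi> s \<omega>)\<^sup>2) K) \<partial>M)"
      by (simp only: Q)
    fix \<omega> assume "(LBINT s:{0..T}. (simple_process n p \<xi> s \<omega>)\<^sup>2) \<le> K"
    then have le: "(\<Sum>i<n. x i \<omega>) \<le> K" by (simp only: Q)
    have "\<eta> i \<omega> = \<xi> i \<omega>" if "i < n" for i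
    proof -
      have "(\<Sum>j<Suc i. x j \<omega>) \<le> (\<Sum>i<n. x i \<omega>)"
        using that x0 by (intro sum_mono2) auto
      then show ?thesis using le by (simp add: \<eta>_def)
    qed
    then show "simple_integral W n p \<eta> \<omega> = simple_integral W n p \<xi> \<omega>"
      by (simp add: simple_integral_def)
  qed (rule Um)
qed

lemma simple_process_borel: "(\<lambda>s. simple_process n p \<xi> s \<omega>) \<in> borel_measurable borel"
  unfolding simple_process_def by measurable

text \<open>The definition of the Ito integral gives only convergence in probability, and the expectation of
  \<open>I = \<integral>\<^sub>0\<^sup>T H\<^sup>2\<close> may be infinite; hence the truncation at \<open>I \<le> C\<close>. The approximating simple
  integrals, stopped at level \<open>K\<close>, have second moments bounded by \<open>E (min Q K)\<close> with \<open>Q\<close> their quadratic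
  variation, and on \<open>{I \<le> C}\<close> the stopping is eventually not felt. Fatou's lemma along an almost surely convergent
  subsequence does the rest. The constants \<open>2\<close> and \<open>1\<close> come from the elementary estimate
  \<open>Q \<le> 2 I + 2 V\<close>, where \<open>V\<close> is the squared distance of the integrands.\<close>

lemma ito_second_moment:
  assumes W: "brownian_motion W" and ito: "ito_integral W H Z" and T: "0 \<le> T" and C: "0 \<le> C"
  defines "I \<equiv> \<lambda>\<omega>. LBINT s:{0..T}. (H s \<omega>)\<^sup>2"
  shows "(\<integral>\<^sup>+\<omega>. ennreal ((Z T \<omega>)\<^sup>2) * indicator {\<omega>. I \<omega> \<le> C} \<omega> \<partial>M)
     \<le> (\<integral>\<^sup>+\<omega>. ennreal (2 * min (I \<omega>) C + 1) \<partial>M)"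
    and "Z T \<in> borel_measurable M"
proof -
  have prog: "progressive H" using ito by (simp add: ito_integral_def)
  have Hint: "AE \<omega> in M. \<forall>t\<ge>0. set_integrable lborel {0..t} (\<lambda>s. (H s \<omega>)\<^sup>2)"
    using ito by (simp add: ito_integral_def)
  from ito T have "\<exists>n p \<xi>. (\<forall>k :: nat. simple_integrand T (n k) (p k) (\<xi> k)) \<and>
        tendsto_prob
          (\<lambda>k \<omega>. LBINT s:{0..T}. (H s \<omega> - simple_process (n k) (p k) (\<xi> k) s \<omega>)\<^sup>2) (\<lambda>_. 0) \<and>
        tendsto_prob (\<lambda>k. simple_integral W (n k) (p k) (\<xi> k)) (Z T)"
    by (simp add: ito_integral_def)
  then obtain n p \<xi> where S: "\<And>k :: nat. simple_integrand T (n k) (p k) (\<xi> k)"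
    and V0: "tendsto_prob
          (\<lambda>k \<omega>. LBINT s:{0..T}. (H s \<omega> - simple_process (n k) (p k) (\<xi> k) s \<omega>)\<^sup>2) (\<lambda>_. 0)"
    and X0: "tendsto_prob (\<lambda>k. simple_integral W (n k) (p k) (\<xi> k)) (Z T)"
    by (elim exE conjE) blast
  define V where "V k \<omega> = (LBINT s:{0..T}. (H s \<omega> - simple_process (n k) (p k) (\<xi> k) s \<omega>)\<^sup>2)" for k \<omega>
  define Q where "Q k \<omega> = (LBINT s:{0..T}. (simple_process (n k) (p k) (\<xi> k) s \<omega>)\<^sup>2)" for k \<omega>
  define X where "X k = simple_integral W (n k) (p k) (\<xi> k)" for k
  \<comment> \<open>The level leaves room for \<open>2 V < 1\<close>, so that \<open>I \<le> C\<close> eventually implies \<open>Q \<le> K\<close>.\<close>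
  define K where "K = 2 * C + 1"
  have K: "0 \<le> K" using C by (simp add: K_def)
  show ZM [measurable]: "Z T \<in> borel_measurable M" using X0 by (simp add: tendsto_prob_def)
  have VM [measurable]: "V k \<in> borel_measurable M" for k
    using V0 by (simp add: tendsto_prob_def V_def[abs_def])
  have IM [measurable]: "I \<in> borel_measurable M"
    using F_borel[OF progressive_integral_measurable[OF prog T, of "\<lambda>x. x\<^sup>2"]] by (simp add: I_def)
  obtain r :: "nat \<Rightarrow> nat" where r: "strict_mono r"
    "AE \<omega> in M. (\<lambda>k. V (r k) \<omega>) \<longlonglongrightarrow> 0" "AE \<omega> in M. (\<lambda>k. X (r k) \<omega>) \<longlonglongrightarrow> Z T \<omega>"
    using tendsto_prob_AE_subseq2[OF V0 X0] unfolding V_def X_def by blast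
  have "\<exists>U. \<forall>k. U k \<in> borel_measurable M \<and>
      (\<integral>\<^sup>+\<omega>. ennreal ((U k \<omega>)\<^sup>2) \<partial>M) \<le> (\<integral>\<^sup>+\<omega>. ennreal (min (Q k \<omega>) K) \<partial>M) \<and>
      (\<forall>\<omega>. Q k \<omega> \<le> K \<longrightarrow> U k \<omega> = X k \<omega>)"
    using truncated_simple_integral[OF W S K] unfolding Q_def X_def by (intro choice allI) metis
  then obtain U where UM [measurable]: "\<And>k. U k \<in> borel_measurable M"
    and U2: "\<And>k. (\<integral>\<^sup>+\<omega>. ennreal ((U k \<omega>)\<^sup>2) \<partial>M) \<le> (\<integral>\<^sup>+\<omega>. ennreal (min (Q k \<omega>) K) \<partial>M)"
    and UX: "\<And>k \<omega>. Q k \<omega> \<le> K \<Longrightarrow> U k \<omega> = X k \<omega>"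
    by blast
  have V_nonneg: "0 \<le> V k \<omega>" for k \<omega> unfolding V_def set_lebesgue_integral_def
    by (intro Bochner_Integration.integral_nonneg) auto
  have I_nonneg: "0 \<le> I \<omega>" for \<omega> unfolding I_def set_lebesgue_integral_def
    by (intro Bochner_Integration.integral_nonneg) auto
  have QV: "AE \<omega> in M. \<forall>k. Q k \<omega> \<le> 2 * I \<omega> + 2 * V k \<omega>"
    using Hint AE_space
  proof eventually_elim
    fix \<omega> assume Hi: "\<forall>t\<ge>0. set_integrable lborel {0..t} (\<lambda>s. (H s \<omega>)\<^sup>2)" and \<omega>: "\<omega> \<in> space M"
    show "\<forall>k. Q k \<omega> \<le> 2 * I \<omega> + 2 * V k \<omega>"
    proof
      fix k
      let ?S = "\<lambda>s. simple_process (n k) (p k) (\<xi> k) s \<omega>"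
      have Sm [measurable]: "?S \<in> borel_measurable borel" by (rule simple_process_borel)
      have "(\<lambda>s. H s \<omega>) \<in> borel_measurable (restrict_space borel {0..T})"
        by (rule progressive_section_measurable[OF prog T \<omega>])
      then have Hm [measurable]: "(\<lambda>s. indicator {0..T} s *\<^sub>R H s \<omega>) \<in> borel_measurable borel"
        by (simp add: borel_measurable_restrict_space_iff)
      have i1: "set_integrable lborel {0..T} (\<lambda>s. (H s \<omega>)\<^sup>2)" using Hi T by blast
      have i2: "set_integrable lborel {0..T} (\<lambda>s. (?S s)\<^sup>2)"
        by (rule simple_process_square_integral(1)[OF S])
      have i3: "set_integrable lborel {0..T} (\<lambda>s. (H s \<omega> - ?S s)\<^sup>2)"
      proof (rule set_integrable_bound)
        show "set_integrable lborel {0..T} (\<lambda>s. 2 * (H s \<omega>)\<^sup>2 + 2 * (?S s)\<^sup>2)"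
          using i1 i2 by (intro set_integral_add(1) set_integrable_mult_right)
        have "(\<lambda>s. indicator {0..T} s *\<^sub>R (indicator {0..T} s *\<^sub>R H s \<omega> - ?S s)\<^sup>2) \<in> borel_measurable lborel"
          by measurable
        also have "(\<lambda>s. indicator {0..T} s *\<^sub>R (indicator {0..T} s *\<^sub>R H s \<omega> - ?S s)\<^sup>2)
           = (\<lambda>s. indicator {0..T} s *\<^sub>R (H s \<omega> - ?S s)\<^sup>2)" by (auto simp: indicator_def)
        finally show "set_borel_measurable lborel {0..T} (\<lambda>s. (H s \<omega> - ?S s)\<^sup>2)"
          by (simp add: set_borel_measurable_def)
        have "(x - y)\<^sup>2 \<le> 2 * x\<^sup>2 + 2 * y\<^sup>2" for x y :: real
          using zero_le_power2[of "x + y"] by (simp add: power2_eq_square algebra_simps)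
        then show "AE s in lborel. s \<in> {0..T} \<longrightarrow> norm ((H s \<omega> - ?S s)\<^sup>2) \<le> norm (2 * (H s \<omega>)\<^sup>2 + 2 * (?S s)\<^sup>2)"
          by (intro AE_I2) simp
      qed
      have "y\<^sup>2 \<le> 2 * x\<^sup>2 + 2 * (x - y)\<^sup>2" for x y :: real
        using zero_le_power2[of "2 * x - y"] by (simp add: power2_eq_square algebra_simps)
      then have "Q k \<omega> \<le> (LBINT s:{0..T}. 2 * (H s \<omega>)\<^sup>2 + 2 * (H s \<omega> - ?S s)\<^sup>2)"
        unfolding Q_def using i1 i2 i3
        by (intro set_integral_mono set_integral_add(1) set_integrable_mult_right)
      also have "\<dots> = 2 * I \<omega> + 2 * V k \<omega>"
        unfolding I_def V_def using i1 i3 by (subst set_integral_add(2)) auto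
      finally show "Q k \<omega> \<le> 2 * I \<omega> + 2 * V k \<omega>" .
    qed
  qed
  have "(\<integral>\<^sup>+\<omega>. ennreal ((Z T \<omega>)\<^sup>2) * indicator {\<omega>. I \<omega> \<le> C} \<omega> \<partial>M)
     \<le> (\<integral>\<^sup>+\<omega>. liminf (\<lambda>k. ennreal ((U (r k) \<omega>)\<^sup>2)) \<partial>M)"
  proof (rule nn_integral_mono_AE)
    show "AE \<omega> in M. ennreal ((Z T \<omega>)\<^sup>2) * indicator {\<omega>. I \<omega> \<le> C} \<omega> \<le> liminf (\<lambda>k. ennreal ((U (r k) \<omega>)\<^sup>2))"
      using r(2,3) QV
    proof eventually_elim
      case (elim \<omega>)
      note v = elim(1) and x = elim(2) and q = elim(3)
      show ?case
      proof (cases "I \<omega> \<le> C")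
        case True
        have "\<forall>\<^sub>F k in sequentially. V (r k) \<omega> < 1/2" using v by (rule order_tendstoD) simp
        then have e: "\<forall>\<^sub>F k in sequentially. ennreal ((X (r k) \<omega>)\<^sup>2) = ennreal ((U (r k) \<omega>)\<^sup>2)"
        proof eventually_elim
          fix k assume "V (r k) \<omega> < 1/2"
          then have "Q (r k) \<omega> \<le> K" using q[rule_format, of "r k"] True by (simp add: K_def)
          then show "ennreal ((X (r k) \<omega>)\<^sup>2) = ennreal ((U (r k) \<omega>)\<^sup>2)" using UX by simp
        qed
        have "(\<lambda>k. ennreal ((X (r k) \<omega>)\<^sup>2)) \<longlonglongrightarrow> ennreal ((Z T \<omega>)\<^sup>2)"
          using x by (intro tendsto_ennrealI tendsto_power)
        from Lim_transform_eventually[OF this e]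
        have "liminf (\<lambda>k. ennreal ((U (r k) \<omega>)\<^sup>2)) = ennreal ((Z T \<omega>)\<^sup>2)"
          by (intro lim_imp_Liminf) simp_all
        then show ?thesis using True by simp
      qed simp
    qed
  qed
  also have "\<dots> \<le> liminf (\<lambda>k. \<integral>\<^sup>+\<omega>. ennreal ((U (r k) \<omega>)\<^sup>2) \<partial>M)"
    by (rule nn_integral_liminf) measurable
  also have "\<dots> \<le> liminf (\<lambda>k. ennreal (\<integral>\<omega>. min (2 * I \<omega> + 2 * V (r k) \<omega>) K \<partial>M))"
  proof (intro Liminf_mono always_eventually allI)
    fix k
    have "(\<integral>\<^sup>+\<omega>. ennreal ((U (r k) \<omega>)\<^sup>2) \<partial>M) \<le> (\<integral>\<^sup>+\<omega>. ennreal (min (Q (r k) \<omega>) K) \<partial>M)" by (rule U2)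
    also have "\<dots> \<le> (\<integral>\<^sup>+\<omega>. ennreal (min (2 * I \<omega> + 2 * V (r k) \<omega>) K) \<partial>M)"
      using QV by (intro nn_integral_mono_AE) (auto intro!: ennreal_leI simp: min_le_iff_disj elim!: eventually_mono)
    also have "\<dots> = ennreal (\<integral>\<omega>. min (2 * I \<omega> + 2 * V (r k) \<omega>) K \<partial>M)"
      using V_nonneg I_nonneg K
      by (intro nn_integral_eq_integral integrable_const_bound[of _ K]) auto
    finally show "(\<integral>\<^sup>+\<omega>. ennreal ((U (r k) \<omega>)\<^sup>2) \<partial>M) \<le> ennreal (\<integral>\<omega>. min (2 * I \<omega> + 2 * V (r k) \<omega>) K \<partial>M)" .
  qed
  also have "\<dots> = ennreal (\<integral>\<omega>. min (2 * I \<omega>) K \<partial>M)"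
  proof (intro lim_imp_Liminf tendsto_ennrealI)
    show "(\<lambda>k. \<integral>\<omega>. min (2 * I \<omega> + 2 * V (r k) \<omega>) K \<partial>M) \<longlonglongrightarrow> (\<integral>\<omega>. min (2 * I \<omega>) K \<partial>M)"
    proof (rule integral_dominated_convergence[where w="\<lambda>_. K"])
      show "AE \<omega> in M. (\<lambda>k. min (2 * I \<omega> + 2 * V (r k) \<omega>) K) \<longlonglongrightarrow> min (2 * I \<omega>) K"
        using r(2)
      proof eventually_elim
        case (elim \<omega>)
        then have "(\<lambda>k. min (2 * I \<omega> + 2 * V (r k) \<omega>) K) \<longlonglongrightarrow> min (2 * I \<omega> + 2 * 0) K"
          by (intro tendsto_intros)
        then show ?case by simp
      qed
    qed (use V_nonneg I_nonneg K in auto)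
  qed simp
  also have "\<dots> = (\<integral>\<^sup>+\<omega>. ennreal (min (2 * I \<omega>) K) \<partial>M)"
    using I_nonneg K by (intro nn_integral_eq_integral[symmetric] integrable_const_bound[of _ K]) auto
  also have "\<dots> \<le> (\<integral>\<^sup>+\<omega>. ennreal (2 * min (I \<omega>) C + 1) \<partial>M)"
    by (intro nn_integral_mono ennreal_leI) (auto simp: K_def min_def)
  finally show "(\<integral>\<^sup>+\<omega>. ennreal ((Z T \<omega>)\<^sup>2) * indicator {\<omega>. I \<omega> \<le> C} \<omega> \<partial>M)
     \<le> (\<integral>\<^sup>+\<omega>. ennreal (2 * min (I \<omega>) C + 1) \<partial>M)" .
qed
end

section \<open>Regularity of paths\<close>

text \<open>Values are integers and one-sided limits exist, so near any point the path is constant on either side.\<close>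

lemma counting_path_local:
  assumes f: "counting_path f" and x: "0 \<le> x"
  obtains e v where "0 < e" "\<And>s. x \<le> s \<Longrightarrow> s < x + e \<Longrightarrow> f s = f x"
    "\<And>s. 0 \<le> s \<Longrightarrow> x - e < s \<Longrightarrow> s < x \<Longrightarrow> f s = v" "f x \<le> v + 1"
proof -
  have cad: "cadlag (\<lambda>t. real (f t))"
    and jump: "\<And>t. t > 0 \<Longrightarrow> real (f t) - left_lim (\<lambda>s. real (f s)) t \<in> {0, 1}"
    using f by (auto simp: counting_path_def)
  have "((\<lambda>t. real (f t)) \<longlongrightarrow> real (f x)) (at_right x)" using cad x by (auto simp: cadlag_def)
  then have "\<forall>\<^sub>F s in at_right x. dist (real (f s)) (real (f x)) < 1" by (rule tendstoD) simp
  then have "\<exists>b>x. \<forall>s>x. s < b \<longrightarrow> dist (real (f s)) (real (f x)) < 1"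
    by (simp only: eventually_at_right_field)
  then obtain b where b: "b > x" "\<forall>s>x. s < b \<longrightarrow> dist (real (f s)) (real (f x)) < 1" by (elim exE conjE)
  have right: "f s = f x" if "x \<le> s" "s < b" for s
  proof (cases "s = x")
    case False
    then have "\<bar>real (f s) - real (f x)\<bar> < 1" using b(2) that by (simp add: dist_real_def)
    then have "real (f s) < real (f x + 1)" "real (f x) < real (f s + 1)" by auto
    then have "f s < f x + 1" "f x < f s + 1" by (simp_all only: of_nat_less_iff)
    then show ?thesis by simp
  qed simp
  show thesis
  proof (cases "x = 0")
    case True
    show thesis
    proof (rule that[of "b - x" "f x"])
      show "f s = f x" if "x \<le> s" "s < x + (b - x)" for s using that by (intro right) auto
    qed (use b(1) True in auto)
  next
    case False
    then have x0: "0 < x" using x by simp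
    then obtain l where l: "((\<lambda>t. real (f t)) \<longlongrightarrow> l) (at_left x)" using cad by (auto simp: cadlag_def)
    have "left_lim (\<lambda>s. real (f s)) x = l"
      using x0 tendsto_Lim[OF _ l] by (simp add: left_lim_def trivial_limit_at_left_real)
    then have lj: "real (f x) - l = 0 \<or> real (f x) - l = 1" using jump[OF x0] by auto
    have "\<forall>\<^sub>F s in at_left x. dist (real (f s)) l < 1" using l by (rule tendstoD) simp
    then have "\<exists>d<x. \<forall>s>d. s < x \<longrightarrow> dist (real (f s)) l < 1"
      by (simp only: eventually_at_left_field)
    then obtain d where d: "d < x" "\<forall>s>d. s < x \<longrightarrow> dist (real (f s)) l < 1" by (elim exE conjE)
    have left: "real (f s) = l" if "d < s" "s < x" for s
    proof -
      have "\<bar>real (f s) - l\<bar> < 1" using d(2) that by (simp add: dist_real_def)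
      from lj show ?thesis
      proof
        assume l: "real (f x) - l = 0"
        then have "real (f s) < real (f x + 1)" "real (f x) < real (f s + 1)"
          using \<open>\<bar>real (f s) - l\<bar> < 1\<close> by auto
        then have "f s < f x + 1" "f x < f s + 1" by (simp_all only: of_nat_less_iff)
        then show ?thesis using l by simp
      next
        assume l: "real (f x) - l = 1"
        then have "real (f s) < real (f x)" "real (f x) < real (f s + 2)"
          using \<open>\<bar>real (f s) - l\<bar> < 1\<close> by auto
        then have "f s < f x" "f x < f s + 2" by (simp_all only: of_nat_less_iff)
        then have "f x = f s + 1" by simp
        then show ?thesis using l by simp
      qed
    qed
    define v where "v = f ((d + x) / 2)"
    have lv: "l = real v" using left[of "(d + x) / 2"] d(1) by (simp add: v_def)
    show thesis
    proof (rule that[of "min (b - x) (x - d)" v])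
      show "f s = v" if "0 \<le> s" "x - min (b - x) (x - d) < s" "s < x" for s
        using left[of s] that lv by auto
      show "f s = f x" if "x \<le> s" "s < x + min (b - x) (x - d)" for s using that by (intro right) auto
      show "f x \<le> v + 1" using lj lv by auto
    qed (use b(1) d(1) in auto)
  qed
qed

text \<open>By compactness of \<open>[0, t]\<close>, the local picture holds at a uniform scale: a short interval contains at
  most one jump.\<close>

lemma counting_path_small_increments:
  assumes f: "counting_path f" and t: "0 \<le> t"
  obtains e where "0 < e" "\<And>s u. 0 \<le> s \<Longrightarrow> s \<le> u \<Longrightarrow> u \<le> t \<Longrightarrow> u < s + e \<Longrightarrow> f u \<le> f s + 1"
proof -
  have mono: "f s \<le> f u" if "0 \<le> s" "s \<le> u" for s u
    using f that by (auto simp: counting_path_def mono_on_def)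
  have "\<forall>x\<in>{0..t}. \<exists>e>0. \<forall>s u. 0 \<le> s \<longrightarrow> s \<le> u \<longrightarrow> s \<in> ball x e \<longrightarrow> u \<in> ball x e \<longrightarrow> f u \<le> f s + 1"
  proof
    fix x assume "x \<in> {0..t}"
    then have "0 \<le> x" by simp
    then obtain e v where e: "0 < e" "\<And>s. x \<le> s \<Longrightarrow> s < x + e \<Longrightarrow> f s = f x"
      "\<And>s. 0 \<le> s \<Longrightarrow> x - e < s \<Longrightarrow> s < x \<Longrightarrow> f s = v" "f x \<le> v + 1"
      using counting_path_local[OF f] by blast
    show "\<exists>e>0. \<forall>s u. 0 \<le> s \<longrightarrow> s \<le> u \<longrightarrow> s \<in> ball x e \<longrightarrow> u \<in> ball x e \<longrightarrow> f u \<le> f s + 1"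
    proof (intro exI[of _ e] conjI allI impI)
      fix s u assume *: "0 \<le> s" "s \<le> u" "s \<in> ball x e" "u \<in> ball x e"
      then have r: "x - e < s" "s < x + e" "x - e < u" "u < x + e" by (auto simp: dist_real_def)
      show "f u \<le> f s + 1"
      proof (cases "u < x")
        case True
        have "f s = v" by (rule e(3)) (use True * r in linarith)+
        moreover have "f u = v" by (rule e(3)) (use True * r in linarith)+
        ultimately show ?thesis by simp
      next
        case False
        have fu: "f u = f x" by (rule e(2)) (use False r in linarith)+
        show ?thesis
        proof (cases "s < x")
          case True
          have "f s = v" by (rule e(3)) (use True * r in linarith)+
          then show ?thesis using fu e(4) by simp
        next
          case False
          have "f s = f x" by (rule e(2)) (use False r in linarith)+
          then show ?thesis using fu by simp
        qed
      qed
    qed (rule e(1))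
  qed
  then obtain e where e: "\<And>x. x \<in> {0..t} \<Longrightarrow> 0 < e x"
    "\<And>x s u. x \<in> {0..t} \<Longrightarrow> 0 \<le> s \<Longrightarrow> s \<le> u \<Longrightarrow> s \<in> ball x (e x) \<Longrightarrow> u \<in> ball x (e x) \<Longrightarrow> f u \<le> f s + 1"
    by metis
  have cov: "{0..t} \<subseteq> \<Union> ((\<lambda>x. ball x (e x)) ` {0..t})"
  proof
    fix x assume x: "x \<in> {0..t}"
    then have "x \<in> ball x (e x)" using e(1)[OF x] by simp
    then show "x \<in> \<Union> ((\<lambda>x. ball x (e x)) ` {0..t})" using x by blast
  qed
  obtain \<epsilon> where \<epsilon>: "0 < \<epsilon>" "\<And>x. x \<in> {0..t} \<Longrightarrow> \<exists>G \<in> (\<lambda>x. ball x (e x)) ` {0..t}. ball x \<epsilon> \<subseteq> G"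
    by (rule Heine_Borel_lemma[OF compact_Icc cov]) auto
  show thesis
  proof (rule that[OF \<epsilon>(1)])
    fix s u assume *: "0 \<le> s" "s \<le> u" "u \<le> t" "u < s + \<epsilon>"
    then obtain y where y: "y \<in> {0..t}" "ball s \<epsilon> \<subseteq> ball y (e y)" using \<epsilon>(2)[of s] by auto
    have "s \<in> ball s \<epsilon>" "u \<in> ball s \<epsilon>" using * \<epsilon>(1) by (auto simp: dist_real_def)
    then have "s \<in> ball y (e y)" "u \<in> ball y (e y)" using y(2) by blast+
    then show "f u \<le> f s + 1" by (rule e(2)[OF y(1) *(1,2)])
  qed
qed

text \<open>Each point has a neighbourhood whose only possible discontinuity is its centre; finitely many of these
  cover \<open>[0, t]\<close>.\<close>

lemma counting_path_finite_jumps: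
  assumes f: "counting_path f"
  shows "finite {s \<in> {0<..t}. \<not> isCont (\<lambda>u. real (f u)) s}"
proof -
  have "\<forall>x\<in>{0..t}. \<exists>e>0. \<forall>s. 0 < s \<longrightarrow> s \<in> ball x e \<longrightarrow> s \<noteq> x \<longrightarrow> isCont (\<lambda>u. real (f u)) s"
  proof
    fix x assume "x \<in> {0..t}"
    then have "0 \<le> x" by simp
    then obtain e v where e: "0 < e" "\<And>s. x \<le> s \<Longrightarrow> s < x + e \<Longrightarrow> f s = f x"
      "\<And>s. 0 \<le> s \<Longrightarrow> x - e < s \<Longrightarrow> s < x \<Longrightarrow> f s = v" "f x \<le> v + 1"
      using counting_path_local[OF f] by blast
    show "\<exists>e>0. \<forall>s. 0 < s \<longrightarrow> s \<in> ball x e \<longrightarrow> s \<noteq> x \<longrightarrow> isCont (\<lambda>u. real (f u)) s"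
    proof (intro exI[of _ e] conjI allI impI)
      fix s assume *: "0 < s" "s \<in> ball x e" "s \<noteq> x"
      define G where "G = (if s < x then {max 0 (x - e)<..<x} else {x<..<x + e})"
      have G: "open G" "s \<in> G" using * by (auto simp: G_def dist_real_def)
      have r: "x - e < s" "s < x + e" using * by (auto simp: dist_real_def)
      have "f u = f s" if u: "u \<in> G" for u
      proof (cases "s < x")
        case True
        then have "max 0 (x - e) < u" "u < x" using u by (auto simp: G_def)
        then have "f u = v" by (intro e(3)) auto
        moreover have "f s = v" by (rule e(3)) (use True * r in linarith)+
        ultimately show ?thesis by simp
      next
        case False
        then have "x < u" "u < x + e" using u by (auto simp: G_def)
        then have "f u = f x" by (intro e(2)) auto
        moreover have "f s = f x" by (rule e(2)) (use False * r in linarith)+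
        ultimately show ?thesis by simp
      qed
      then have "continuous_on G (\<lambda>u. real (f u)) \<longleftrightarrow> continuous_on G (\<lambda>u. real (f s))"
        by (intro continuous_on_cong) auto
      then show "isCont (\<lambda>u. real (f u)) s"
        using G by (simp add: continuous_on_eq_continuous_at)
    qed (rule e(1))
  qed
  then obtain e where e: "\<And>x. x \<in> {0..t} \<Longrightarrow> 0 < e x"
    "\<And>x s. x \<in> {0..t} \<Longrightarrow> 0 < s \<Longrightarrow> s \<in> ball x (e x) \<Longrightarrow> s \<noteq> x \<Longrightarrow> isCont (\<lambda>u. real (f u)) s"
    by metis
  have cov: "{0..t} \<subseteq> (\<Union>x\<in>{0..t}. ball x (e x))"
  proof
    fix x assume x: "x \<in> {0..t}"
    then have "x \<in> ball x (e x)" using e(1)[OF x] by simp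
    then show "x \<in> (\<Union>x\<in>{0..t}. ball x (e x))" using x by blast
  qed
  obtain C where C: "C \<subseteq> {0..t}" "finite C" "{0..t} \<subseteq> (\<Union>x\<in>C. ball x (e x))"
    by (rule compactE_image[OF compact_Icc _ cov]) auto
  have "{s \<in> {0<..t}. \<not> isCont (\<lambda>u. real (f u)) s} \<subseteq> C"
  proof
    fix s assume s: "s \<in> {s \<in> {0<..t}. \<not> isCont (\<lambda>u. real (f u)) s}"
    then have "s \<in> (\<Union>x\<in>C. ball x (e x))" using s by (intro subsetD[OF C(3)]) auto
    then obtain x where x: "x \<in> C" "s \<in> ball x (e x)" by blast
    then have "s = x" using e(2)[of x s] subsetD[OF C(1) x(1)] s by auto
    then show "s \<in> C" using x by simp
  qed
  then show ?thesis using C(2) finite_subset by blast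
qed

lemma indefinite_integral_props:
  fixes \<rho> :: "real \<Rightarrow> real"
  assumes int: "\<forall>t\<ge>0. set_integrable lborel {0..t} \<rho>"
  defines "I \<equiv> \<lambda>t. LBINT s:{0..t}. \<rho> s"
  shows "continuous_on {0..t} I"
    and "0 < s \<Longrightarrow> isCont \<rho> s \<Longrightarrow> (I has_vector_derivative \<rho> s) (at s)"
    and "\<forall>s\<ge>0. 0 \<le> \<rho> s \<Longrightarrow> 0 \<le> s \<Longrightarrow> s \<le> u \<Longrightarrow> I s \<le> I u"
    and "I 0 = 0"
proof -
  have eq: "I t = integral {0..t} \<rho>" if "0 \<le> t" for t
    unfolding I_def using set_borel_integral_eq_integral(2)[OF int[rule_format, OF that]] by simp
  have hk: "\<rho> integrable_on {0..t}" if "0 \<le> t" for t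
    using set_borel_integral_eq_integral(1)[OF int[rule_format, OF that]] by simp
  show "continuous_on {0..t} I"
  proof (cases "0 \<le> t")
    case True
    have "continuous_on {0..t} (\<lambda>x. integral {0..x} \<rho>)"
      using indefinite_integral_continuous_1[OF hk[OF True]] by simp
    then show ?thesis using eq by (subst continuous_on_cong[OF refl]) auto
  qed simp
  show "I 0 = 0" using eq[of 0] by simp
  show "(I has_vector_derivative \<rho> s) (at s)" if s: "0 < s" "isCont \<rho> s"
  proof -
    have "((\<lambda>u. integral {0..u} \<rho>) has_vector_derivative \<rho> s) (at s within ({0..s+1} - {}))"
      using s by (intro integral_has_vector_derivative_continuous_at hk) (auto simp: continuous_at_imp_continuous_at_within)
    then have "((\<lambda>u. integral {0..u} \<rho>) has_vector_derivative \<rho> s) (at s within {0<..<s+1})"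
      by (rule has_vector_derivative_within_subset) auto
    then have "((\<lambda>u. integral {0..u} \<rho>) has_vector_derivative \<rho> s) (at s)"
      using s by (simp add: at_within_open[of s "{0<..<s+1}"])
    then show ?thesis
      by (rule has_vector_derivative_transform_within_open[of _ _ _ "{0<..<s+1}"]) (use s eq in auto)
  qed
  show "I s \<le> I u" if "\<forall>s\<ge>0. 0 \<le> \<rho> s" "0 \<le> s" "s \<le> u"
    using that eq[of s] eq[of u] hk[of s] hk[of u] integral_subset_le[of "{0..s}" "{0..u}" \<rho>] by auto
qed

text \<open>Choose a time \<open>\<tau> \<le> t\<close> at which the integral has the value \<open>min (I t) C\<close>. By monotonicity all earlier values are
  at most \<open>C\<close>, so the integrand restricted to \<open>{I \<le> C}\<close> already collects \<open>min (I t) C\<close> up to \<open>\<tau>\<close>.\<close>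

lemma min_integral_le_integral_stopped:
  fixes \<rho> :: "real \<Rightarrow> real"
  assumes int: "\<forall>t\<ge>0. set_integrable lborel {0..t} \<rho>" and nn: "\<forall>s\<ge>0. 0 \<le> \<rho> s"
    and t: "0 \<le> t" and C: "0 \<le> C"
  defines "I \<equiv> \<lambda>t. LBINT s:{0..t}. \<rho> s"
  shows "ennreal (min (I t) C) \<le> (\<integral>\<^sup>+s. ennreal (\<rho> s) * indicator {s. I s \<le> C} s * indicator {0..t} s \<partial>lborel)"
proof -
  have I_eq: "I t = (LBINT s:{0..t}. \<rho> s)" for t by (simp add: I_def)
  note I = indefinite_integral_props[OF int, folded I_eq]
  have "I 0 \<le> min (I t) C" using I(3)[OF nn order_refl t] I(4) C by simp
  then obtain \<tau> where \<tau>: "0 \<le> \<tau>" "\<tau> \<le> t" "I \<tau> = min (I t) C"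
    using IVT'[of I 0 "min (I t) C" t] I(1)[of t] t by (metis min.cobounded1)
  have le: "I s \<le> C" if "0 \<le> s" "s \<le> \<tau>" for s using I(3)[OF nn that] \<tau>(3) by simp
  have "ennreal (min (I t) C) = ennreal (\<integral>s. indicator {0..\<tau>} s *\<^sub>R \<rho> s \<partial>lborel)"
    using \<tau>(3) by (simp add: I_def set_lebesgue_integral_def)
  also have "\<dots> = (\<integral>\<^sup>+s. ennreal (indicator {0..\<tau>} s *\<^sub>R \<rho> s) \<partial>lborel)"
    using int[rule_format, OF \<tau>(1)] nn unfolding set_integrable_def
    by (intro nn_integral_eq_integral[symmetric]) (auto simp: indicator_def)
  also have "\<dots> \<le> (\<integral>\<^sup>+s. ennreal (\<rho> s) * indicator {s. I s \<le> C} s * indicator {0..t} s \<partial>lborel)"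
    using le \<tau> by (intro nn_integral_mono) (auto simp: indicator_def)
  finally show ?thesis .
qed

lemma continuous_small_increments:
  fixes I :: "real \<Rightarrow> real"
  assumes "continuous_on {0..t} I" "0 < d"
  obtains e where "0 < e" "\<And>s u. 0 \<le> s \<Longrightarrow> s \<le> u \<Longrightarrow> u \<le> t \<Longrightarrow> u < s + e \<Longrightarrow> I u - I s < d"
proof -
  have "uniformly_continuous_on {0..t} I" using assms by (intro compact_uniformly_continuous) auto
  then obtain e where e: "0 < e" "\<And>x y. x \<in> {0..t} \<Longrightarrow> y \<in> {0..t} \<Longrightarrow> dist y x < e \<Longrightarrow> dist (I y) (I x) < d"
    unfolding uniformly_continuous_on_def using assms(2) by blast
  show thesis
  proof (rule that[OF e(1)])
    fix s u assume "0 \<le> s" "s \<le> u" "u \<le> t" "u < s + e"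
    then show "I u - I s < d" using e(2)[of s u] by (auto simp: dist_real_def)
  qed
qed

text \<open>With \<open>D' = \<rho> - \<mu>\<close> and \<open>q = \<rho> - \<mu> + \<kappa> D\<close>, the function \<open>\<kappa> exp (\<kappa> s) D\<^sup>2\<close> has derivative
  \<open>exp (\<kappa> s) (q\<^sup>2 - (\<rho> - \<mu>)\<^sup>2) \<le> exp (\<kappa> s) q\<^sup>2\<close>. This bounds a solution of \<open>D' + \<kappa> D = q\<close> by its right-hand side
  in mean square, without an explicit solution formula. The derivative may fail to exist at
  finitely many points, which are the jumps of \<open>\<rho>\<close> in the application.\<close>

lemma ode_energy_bound:
  fixes \<rho> :: "real \<Rightarrow> real" and \<mu> \<kappa> :: real
  assumes int: "\<forall>t\<ge>0. set_integrable lborel {0..t} \<rho>"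
    and fin: "finite {s \<in> {0<..<t}. \<not> isCont \<rho> s}" and t: "0 \<le> t" and \<kappa>: "0 < \<kappa>"
  defines "D \<equiv> \<lambda>t. (LBINT s:{0..t}. \<rho> s) - \<mu> * t"
  shows "ennreal (\<kappa> * exp (\<kappa> * t) * (D t)\<^sup>2)
    \<le> (\<integral>\<^sup>+s. ennreal (exp (\<kappa> * s) * (\<rho> s - \<mu> + \<kappa> * D s)\<^sup>2) * indicator {0..t} s \<partial>lborel)"
proof -
  define I where "I t = (LBINT s:{0..t}. \<rho> s)" for t
  note I = indefinite_integral_props[OF int, folded I_def]
  have D_def': "D t = I t - \<mu> * t" for t by (simp add: D_def I_def)
  have Dc: "continuous_on {0..t} D" unfolding D_def'[abs_def] by (intro continuous_intros I(1))
  let ?g = "\<lambda>s. exp (\<kappa> * s) * (\<rho> s - \<mu> + \<kappa> * D s)\<^sup>2"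
  let ?h = "\<lambda>s. \<kappa> * (exp (\<kappa> * s) * \<kappa> * (D s)\<^sup>2 + exp (\<kappa> * s) * (2 * D s * (\<rho> s - \<mu>)))"
  let ?G = "\<lambda>s. \<kappa> * (exp (\<kappa> * s) * (D s)\<^sup>2)"
  have deriv: "(?G has_vector_derivative ?h s) (at s)" if "0 < s" "isCont \<rho> s" for s
  proof -
    have "(I has_real_derivative \<rho> s) (at s)"
      using I(2)[OF that] by (simp add: has_real_derivative_iff_has_vector_derivative)
    then have "(?G has_real_derivative ?h s) (at s)"
      unfolding D_def'
      by (auto intro!: derivative_eq_intros simp: algebra_simps power2_eq_square)
    then show ?thesis by (simp add: has_real_derivative_iff_has_vector_derivative)
  qed
  have "(?h has_integral (?G t - ?G 0)) {0..t}"
  proof (rule fundamental_theorem_of_calculus_interior_strong[OF fin t])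
    show "continuous_on {0..t} ?G" by (intro continuous_intros Dc)
  qed (use deriv in auto)
  moreover have "D 0 = 0" using I(4) by (simp add: D_def')
  ultimately have hi: "(?h has_integral \<kappa> * exp (\<kappa> * t) * (D t)\<^sup>2) {0..t}" by (simp add: mult.assoc)
  have hg: "?h s \<le> ?g s" for s
  proof -
    have "?g s - ?h s = exp (\<kappa> * s) * (\<rho> s - \<mu>)\<^sup>2"
      by (simp add: power2_eq_square algebra_simps)
    moreover have "0 \<le> exp (\<kappa> * s) * (\<rho> s - \<mu>)\<^sup>2" by simp
    ultimately show ?thesis by linarith
  qed
  have m: "(\<lambda>s. indicator {0..t} s *\<^sub>R ?g s) \<in> borel_measurable lborel"
  proof -
    have [measurable]: "(\<lambda>s. indicator {0..t} s *\<^sub>R \<rho> s) \<in> borel_measurable borel"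
      using int[rule_format, OF t] unfolding set_integrable_def by auto
    have [measurable]: "(\<lambda>s. indicator {0..t} s *\<^sub>R D s) \<in> borel_measurable borel"
      using Dc by (intro borel_measurable_continuous_on_indicator) auto
    have "(\<lambda>s. indicator {0..t} s *\<^sub>R (exp (\<kappa> * s) *
      (indicator {0..t} s *\<^sub>R \<rho> s - \<mu> + \<kappa> * (indicator {0..t} s *\<^sub>R D s))\<^sup>2)) \<in> borel_measurable lborel"
      by measurable
    also have "(\<lambda>s. indicator {0..t} s *\<^sub>R (exp (\<kappa> * s) *
      (indicator {0..t} s *\<^sub>R \<rho> s - \<mu> + \<kappa> * (indicator {0..t} s *\<^sub>R D s))\<^sup>2)) = (\<lambda>s. indicator {0..t} s *\<^sub>R ?g s)"
      by (auto simp: indicator_def)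
    finally show ?thesis .
  qed
  have nn: "(\<integral>\<^sup>+s. ennreal (?g s) * indicator {0..t} s \<partial>lborel) = (\<integral>\<^sup>+s. ennreal (indicator {0..t} s *\<^sub>R ?g s) \<partial>lborel)"
    by (intro nn_integral_cong) (auto simp: indicator_def)
  show ?thesis
  proof (cases "(\<integral>\<^sup>+s. ennreal (indicator {0..t} s *\<^sub>R ?g s) \<partial>lborel) < \<infinity>")
    case True
    then have gi: "set_integrable lborel {0..t} ?g"
      unfolding set_integrable_def using m by (intro integrableI_nonneg) auto
    have "(?g has_integral (LBINT s:{0..t}. ?g s)) {0..t}"
      using set_borel_integral_eq_integral[OF gi] by (simp add: has_integral_integral)
    then have "\<kappa> * exp (\<kappa> * t) * (D t)\<^sup>2 \<le> (LBINT s:{0..t}. ?g s)"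
      using has_integral_le[OF hi] hg by blast
    then have "ennreal (\<kappa> * exp (\<kappa> * t) * (D t)\<^sup>2) \<le> ennreal (LBINT s:{0..t}. ?g s)" by (rule ennreal_leI)
    also have "\<dots> = (\<integral>\<^sup>+s. ennreal (indicator {0..t} s *\<^sub>R ?g s) \<partial>lborel)"
      using gi unfolding set_integrable_def set_lebesgue_integral_def
      by (intro nn_integral_eq_integral[symmetric]) auto
    finally show ?thesis using nn by simp
  next
    case False then show ?thesis using nn by (simp add: not_less top_unique)
  qed
qed

definition uniform_grid :: "real \<Rightarrow> nat \<Rightarrow> nat \<Rightarrow> real" where
  "uniform_grid t n i = real i * t / real (Suc n)"

lemma uniform_grid_props:
  assumes t: "0 \<le> t"
  shows "0 \<le> uniform_grid t n i" "uniform_grid t n i \<le> uniform_grid t n (Suc i)"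
    "i \<le> Suc n \<Longrightarrow> uniform_grid t n i \<le> t"
    "uniform_grid t n (Suc n) = t" "uniform_grid t n 0 = 0"
    "uniform_grid t n (Suc i) = uniform_grid t n i + t / real (Suc n)"
proof -
  show "0 \<le> uniform_grid t n i" using t by (simp add: uniform_grid_def)
  show "uniform_grid t n i \<le> uniform_grid t n (Suc i)"
    using t by (simp add: uniform_grid_def divide_right_mono mult_right_mono)
  show "uniform_grid t n i \<le> t" if "i \<le> Suc n"
  proof -
    have "real i * t \<le> real (Suc n) * t" using that t by (intro mult_right_mono) auto
    then show ?thesis unfolding uniform_grid_def by (simp add: divide_le_eq mult.commute)
  qed
  show "uniform_grid t n (Suc n) = t" "uniform_grid t n 0 = 0" by (auto simp: uniform_grid_def)
  show "uniform_grid t n (Suc i) = uniform_grid t n i + t / real (Suc n)"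
    by (simp add: uniform_grid_def add_divide_distrib[symmetric] distrib_right add.commute)
qed

lemma uniform_grid_fine:
  assumes "0 < e"
  shows "\<forall>\<^sub>F n in sequentially. t / real (Suc n) < e"
proof -
  have "(\<lambda>n. t / real (Suc n)) \<longlonglongrightarrow> 0"
    using tendsto_mult[OF tendsto_const[of t] LIMSEQ_inverse_real_of_nat] by (simp add: divide_inverse)
  then show ?thesis using assms by (rule order_tendstoD)
qed

text \<open>A nondecreasing sequence crosses the level \<open>C\<close> at most once.\<close>

lemma exceedance_sum:
  fixes x :: "nat \<Rightarrow> real"
  assumes "\<And>i. i < n \<Longrightarrow> x i \<le> x (Suc i)"
  shows "(\<Sum>i<n. of_bool (x i \<le> C \<and> C < x (Suc i))) = of_bool (C < x n) - (of_bool (C < x 0) :: real)"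
  using assms
proof (induction n)
  case (Suc n)
  have "x n \<le> x (Suc n)" using Suc.prems[of n] by simp
  then have "of_bool (x n \<le> C \<and> C < x (Suc n)) = of_bool (C < x (Suc n)) - (of_bool (C < x n) :: real)"
    by (simp add: of_bool_def)
  moreover have "(\<Sum>i<n. of_bool (x i \<le> C \<and> C < x (Suc i))) = of_bool (C < x n) - (of_bool (C < x 0) :: real)"
    by (rule Suc.IH) (simp add: Suc.prems)
  ultimately show ?case unfolding sum.lessThan_Suc by linarith
qed simp

section \<open>Martingales and the integrated process\<close>

text \<open>The form in which the martingale property is used: a bounded factor known at time \<open>s\<close> does not see
  the difference between times \<open>s\<close> and \<open>t\<close>.\<close>

lemma (in filtered_prob_space) martingale_orthogonal:
  assumes X: "is_martingale X" and st: "0 \<le> s" "s \<le> t"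
    and Y: "Y \<in> borel_measurable (F s)" and bd: "\<And>\<omega>. \<omega> \<in> space M \<Longrightarrow> \<bar>Y \<omega>\<bar> \<le> c"
  shows "integrable M (\<lambda>\<omega>. Y \<omega> * X t \<omega>)" "integrable M (\<lambda>\<omega>. Y \<omega> * X s \<omega>)"
    "(\<integral>\<omega>. Y \<omega> * X t \<omega> \<partial>M) = (\<integral>\<omega>. Y \<omega> * X s \<omega> \<partial>M)"
proof -
  interpret S: finite_measure_subalgebra M "F s"
    by unfold_locales (rule subalgebra_F)
  have Xi: "integrable M (X u)" if "0 \<le> u" for u using X that by (auto simp: is_martingale_def)
  have i: "integrable M (\<lambda>\<omega>. Y \<omega> * X u \<omega>)" if "0 \<le> u" for u
  proof (rule Bochner_Integration.integrable_bound[OF integrable_mult_right[OF integrable_abs[OF Xi[OF that]], of c]])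
    show "(\<lambda>\<omega>. Y \<omega> * X u \<omega>) \<in> borel_measurable M"
      using F_borel[OF Y] borel_measurable_integrable[OF Xi[OF that]] by measurable
    show "AE x in M. norm (Y x * X u x) \<le> norm (c * \<bar>X u x\<bar>)"
    proof (rule AE_I2)
      fix x assume "x \<in> space M"
      then have "\<bar>Y x\<bar> \<le> \<bar>c\<bar>" using bd[of x] by simp
      then show "norm (Y x * X u x) \<le> norm (c * \<bar>X u x\<bar>)" by (simp add: abs_mult mult_right_mono)
    qed
  qed
  have "(\<integral>\<omega>. Y \<omega> * X t \<omega> \<partial>M) = (\<integral>\<omega>. Y \<omega> * real_cond_exp M (F s) (X t) \<omega> \<partial>M)"
    using S.real_cond_exp_intg(2)[OF i[of t] Y borel_measurable_integrable[OF Xi[of t]]] st by simp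
  also have "\<dots> = (\<integral>\<omega>. Y \<omega> * X s \<omega> \<partial>M)"
  proof (rule integral_cong_AE)
    show "(\<lambda>\<omega>. Y \<omega> * real_cond_exp M (F s) (X t) \<omega>) \<in> borel_measurable M"
      using F_borel[OF Y] by measurable
    show "(\<lambda>\<omega>. Y \<omega> * X s \<omega>) \<in> borel_measurable M" using i st by auto
    have "AE \<omega> in M. real_cond_exp M (F s) (X t) \<omega> = X s \<omega>" using X st by (auto simp: is_martingale_def)
    then show "AE \<omega> in M. Y \<omega> * real_cond_exp M (F s) (X t) \<omega> = Y \<omega> * X s \<omega>" by eventually_elim simp
  qed
  finally show "(\<integral>\<omega>. Y \<omega> * X t \<omega> \<partial>M) = (\<integral>\<omega>. Y \<omega> * X s \<omega> \<partial>M)" .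
  show "integrable M (\<lambda>\<omega>. Y \<omega> * X t \<omega>)" "integrable M (\<lambda>\<omega>. Y \<omega> * X s \<omega>)" using i st by auto
qed

text \<open>The equation for \<open>R\<close> only asserts that a stochastic integral exists; a version \<open>Z\<close> is fixed here so
  that its moments can be stated. The condition \<open>a \<beta> < b\<close> gives mean reversion also after compensating the jumps.\<close>

locale stable_cir_hawkes = cir_hawkes M F a b c \<alpha> \<beta> \<sigma> W N R
  for M :: "'a measure" and F :: "real \<Rightarrow> 'a measure"
    and a b c \<alpha> \<beta> \<sigma> :: real and W N R +
  fixes Z :: "real \<Rightarrow> 'a \<Rightarrow> real" and r :: real
  assumes pos: "0 < a" "0 < b" "0 < c" "0 < \<alpha>" "0 < \<beta>" "0 < \<sigma>" and stable: "a * \<beta> < b"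
    and ito: "ito_integral W (\<lambda>s \<omega>. sqrt (R s \<omega>)) Z"
    and sde: "AE \<omega> in M. \<forall>t\<ge>0.
         R t \<omega> = R 0 \<omega> + (LBINT s:{0..t}. b * (c - R s \<omega>)) + a * real (N t \<omega>) + \<sigma> * Z t \<omega>"
    and r0: "0 \<le> r" and R0: "AE \<omega> in M. R 0 \<omega> = r"
begin

definition I :: "real \<Rightarrow> 'a \<Rightarrow> real" where "I t \<omega> = (LBINT s:{0..t}. R s \<omega>)"

definition \<Lambda> :: "real \<Rightarrow> 'a \<Rightarrow> real" where
  "\<Lambda> t \<omega> = (LBINT s:{0..t}. \<alpha> + \<beta> * left_lim (\<lambda>s. R s \<omega>) s)"

lemma R_progressive: "progressive R"
  unfolding progressive_def
proof (intro allI impI)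
  fix t :: real assume t: "0 \<le> t"
  have "(\<lambda>(s, \<omega>). sqrt (R s \<omega>)) \<in> borel_measurable (restrict_space borel {0..t} \<Otimes>\<^sub>M F t)"
    using ito t by (auto simp: ito_integral_def progressive_def)
  then have "(\<lambda>x. (case x of (s, \<omega>) \<Rightarrow> sqrt (R s \<omega>))\<^sup>2) \<in> borel_measurable (restrict_space borel {0..t} \<Otimes>\<^sub>M F t)"
    by (rule borel_measurable_power)
  then show "(\<lambda>(s, \<omega>). R s \<omega>) \<in> borel_measurable (restrict_space borel {0..t} \<Otimes>\<^sub>M F t)"
    by (rule measurable_cong[THEN iffD1, rotated])
      (auto simp: space_pair_measure space_restrict_space space_F R_nonneg)
qed

lemma I_measurable: "0 \<le> t \<Longrightarrow> I t \<in> borel_measurable (F t)"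
  using progressive_integral_measurable[OF R_progressive, of t "\<lambda>x. x"] by (simp add: I_def[abs_def])

lemma I_borel: "0 \<le> t \<Longrightarrow> I t \<in> borel_measurable M"
  by (rule F_borel[OF I_measurable])

lemma N_adapted: "0 \<le> t \<Longrightarrow> (\<lambda>\<omega>. real (N t \<omega>)) \<in> borel_measurable (F t)"
  using N_point_process by (auto simp: simple_point_process_def adapted_def)

lemma N_borel: "0 \<le> t \<Longrightarrow> (\<lambda>\<omega>. real (N t \<omega>)) \<in> borel_measurable M"
  using N_point_process F_borel[of "\<lambda>\<omega>. real (N t \<omega>)" t]
  by (auto simp: simple_point_process_def adapted_def)

lemma N_path: "\<omega> \<in> space M \<Longrightarrow> counting_path (\<lambda>t. N t \<omega>)"
  using N_point_process by (auto simp: simple_point_process_def)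

text \<open>The almost sure properties of a path, collected so that later arguments are deterministic. As
  \<open>Z\<close> is continuous, the discontinuities of \<open>R\<close> are jumps of \<open>N\<close>, so there are finitely many up to any time.\<close>

definition regular_path :: "'a \<Rightarrow> bool" where
  "regular_path \<omega> \<longleftrightarrow> \<omega> \<in> space M \<and>
     (\<forall>t\<ge>0. set_integrable lborel {0..t} (\<lambda>s. R s \<omega>)) \<and>
     (\<forall>t\<ge>0. R t \<omega> = r + b * c * t - b * I t \<omega> + a * real (N t \<omega>) + \<sigma> * Z t \<omega>) \<and>
     (\<forall>t. finite {s \<in> {0<..<t}. \<not> isCont (\<lambda>s. R s \<omega>) s}) \<and>
     (\<forall>t\<ge>0. \<Lambda> t \<omega> = \<alpha> * t + \<beta> * I t \<omega>)"

text \<open>Since \<open>R\<close> is discontinuous at finitely many times only, its left limits agree with it almost everywhere,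
  and the integrated intensity is \<open>\<alpha> t + \<beta> I t\<close>.\<close>

lemma AE_regular_path: "AE \<omega> in M. regular_path \<omega>"
proof -
  have 1: "AE \<omega> in M. \<forall>t\<ge>0. set_integrable lborel {0..t} (\<lambda>s. (sqrt (R s \<omega>))\<^sup>2)"
    using ito unfolding ito_integral_def by (elim conjE)
  have 2: "AE \<omega> in M. continuous_on {0..} (\<lambda>t. Z t \<omega>)"
    using ito unfolding ito_integral_def by (elim conjE)
  have 3: "AE \<omega> in M. \<forall>t\<ge>0. set_integrable lborel {0..t} (\<lambda>s. \<alpha> + \<beta> * left_lim (\<lambda>s. R s \<omega>) s)"
    by (rule N_intensity[unfolded has_intensity_def, THEN conjunct2, THEN conjunct2, THEN conjunct1])
  have key: "regular_path \<omega>" if sq: "\<forall>t\<ge>0. set_integrable lborel {0..t} (\<lambda>s. (sqrt (R s \<omega>))\<^sup>2)"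
      and Zc: "continuous_on {0..} (\<lambda>t. Z t \<omega>)"
      and ll: "\<forall>t\<ge>0. set_integrable lborel {0..t} (\<lambda>s. \<alpha> + \<beta> * left_lim (\<lambda>s. R s \<omega>) s)"
      and e: "\<forall>t\<ge>0. R t \<omega> = R 0 \<omega> + (LBINT s:{0..t}. b * (c - R s \<omega>)) + a * real (N t \<omega>) + \<sigma> * Z t \<omega>"
      and r: "R 0 \<omega> = r" and \<omega>: "\<omega> \<in> space M" for \<omega>
  proof -
    have int: "\<forall>t\<ge>0. set_integrable lborel {0..t} (\<lambda>s. R s \<omega>)"
    proof (intro allI impI)
      fix t :: real assume t: "0 \<le> t"
      have eq: "indicator {0..t} s *\<^sub>R (sqrt (R s \<omega>))\<^sup>2 = indicator {0..t} s *\<^sub>R R s \<omega>" for s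
      proof (cases "s \<in> {0..t}")
        case True
        then have "0 \<le> R s \<omega>" by (intro R_nonneg \<omega>) simp
        then show ?thesis by (simp only: real_sqrt_pow2)
      qed simp
      have "set_integrable lborel {0..t} (\<lambda>s. (sqrt (R s \<omega>))\<^sup>2)" by (rule sq[rule_format, OF t])
      then show "set_integrable lborel {0..t} (\<lambda>s. R s \<omega>)"
        unfolding set_integrable_def eq .
    qed
    have cst: "set_integrable lborel {0..t} (\<lambda>s. k)" "(LBINT s:{0..t}. k) = k * t" if "0 \<le> t" for t k :: real
      using that by (auto simp: set_integrable_def set_lebesgue_integral_def)
    have e': "R t \<omega> = r + b * c * t - b * I t \<omega> + a * real (N t \<omega>) + \<sigma> * Z t \<omega>" if t: "0 \<le> t" for t
    proof -
      have "(LBINT s:{0..t}. b * (c - R s \<omega>)) = b * (LBINT s:{0..t}. c - R s \<omega>)" by simp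
      also have "(LBINT s:{0..t}. c - R s \<omega>) = c * t - I t \<omega>"
        using cst[OF t, of c] int t by (simp add: set_integral_diff I_def)
      finally show ?thesis using e t r by (simp add: algebra_simps)
    qed
    have cont: "isCont (\<lambda>s. R s \<omega>) s" if s: "0 < s" "isCont (\<lambda>u. real (N u \<omega>)) s" for s
    proof -
      have "continuous_on {0..s+1} (\<lambda>t. I t \<omega>)"
        using indefinite_integral_props(1)[OF int, of "s+1"] by (simp add: I_def)
      then have Ic: "isCont (\<lambda>t. I t \<omega>) s"
        using s by (intro continuous_on_interior[of "{0..s+1}"]) auto
      have Zc': "isCont (\<lambda>t. Z t \<omega>) s"
        using Zc s by (intro continuous_on_interior[of "{0..}"]) auto
      have "isCont (\<lambda>t. r + b * c * t - b * I t \<omega> + a * real (N t \<omega>) + \<sigma> * Z t \<omega>) s"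
        by (intro continuous_intros Ic Zc' s(2))
      moreover have "\<forall>\<^sub>F t in nhds s. R t \<omega> = r + b * c * t - b * I t \<omega> + a * real (N t \<omega>) + \<sigma> * Z t \<omega>"
        using eventually_nhds_in_open[of "{0<..}" s] s e' by (auto elim!: eventually_mono)
      ultimately show ?thesis by (subst isCont_cong) auto
    qed
    have fin: "finite {s \<in> {0<..<t}. \<not> isCont (\<lambda>s. R s \<omega>) s}" for t
      by (rule finite_subset[OF _ counting_path_finite_jumps[OF N_path[OF \<omega>], of t]]) (use cont in auto)
    have lam: "\<Lambda> t \<omega> = \<alpha> * t + \<beta> * I t \<omega>" if t: "0 \<le> t" for t
    proof -
      have "(LBINT s:{0..t}. \<alpha> + \<beta> * left_lim (\<lambda>s. R s \<omega>) s) = (LBINT s:{0..t}. \<alpha> + \<beta> * R s \<omega>)"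
        unfolding set_lebesgue_integral_def
      proof (rule integral_cong_AE)
        show "(\<lambda>s. indicator {0..t} s *\<^sub>R (\<alpha> + \<beta> * left_lim (\<lambda>s. R s \<omega>) s)) \<in> borel_measurable lborel"
          using ll t unfolding set_integrable_def by auto
        have "set_integrable lborel {0..t} (\<lambda>s. \<alpha> + \<beta> * R s \<omega>)"
          using int t cst[OF t] by (intro set_integral_add(1) set_integrable_mult_right) auto
        then show "(\<lambda>s. indicator {0..t} s *\<^sub>R (\<alpha> + \<beta> * R s \<omega>)) \<in> borel_measurable lborel"
          unfolding set_integrable_def by auto
        let ?E = "insert 0 {s \<in> {0<..<t+1}. \<not> isCont (\<lambda>s. R s \<omega>) s}"
        have "?E \<in> null_sets lborel" using fin by (intro finite_imp_null_set_lborel) auto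
        then have "AE s in lborel. s \<notin> ?E" by (rule AE_not_in)
        then show "AE s in lborel. indicator {0..t} s *\<^sub>R (\<alpha> + \<beta> * left_lim (\<lambda>s. R s \<omega>) s)
          = indicator {0..t} s *\<^sub>R (\<alpha> + \<beta> * R s \<omega>)"
        proof eventually_elim
          case s: (elim s)
          show ?case
          proof (cases "s \<in> {0..t}")
            case True
            then have s': "0 < s" "isCont (\<lambda>s. R s \<omega>) s" using s by auto
            have "((\<lambda>s. R s \<omega>) \<longlongrightarrow> R s \<omega>) (at_left s)"
              by (rule tendsto_within_subset[OF s'(2)[unfolded isCont_def]]) simp
            then have "Lim (at_left s) (\<lambda>s. R s \<omega>) = R s \<omega>"
              by (intro tendsto_Lim) (auto simp: trivial_limit_at_left_real)
            then show ?thesis using s' by (simp add: left_lim_def)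
          qed simp
        qed
      qed
      also have "\<dots> = \<alpha> * t + \<beta> * I t \<omega>"
        using cst[OF t, of \<alpha>] int t by (simp add: set_integral_add I_def)
      finally show ?thesis by (simp add: \<Lambda>_def)
    qed
    show "regular_path \<omega>" unfolding regular_path_def using \<omega> int e' fin lam by blast
  qed
  have "AE \<omega> in M. (\<forall>t\<ge>0. set_integrable lborel {0..t} (\<lambda>s. (sqrt (R s \<omega>))\<^sup>2)) \<and>
      continuous_on {0..} (\<lambda>t. Z t \<omega>) \<and>
      (\<forall>t\<ge>0. set_integrable lborel {0..t} (\<lambda>s. \<alpha> + \<beta> * left_lim (\<lambda>s. R s \<omega>) s)) \<and>
      (\<forall>t\<ge>0. R t \<omega> = R 0 \<omega> + (LBINT s:{0..t}. b * (c - R s \<omega>)) + a * real (N t \<omega>) + \<sigma> * Z t \<omega>) \<and>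
      R 0 \<omega> = r"
    by (intro AE_conjI 1 2 3 sde R0)
  then show ?thesis
  proof (rule AE_mp, intro AE_I2 impI)
    fix \<omega> assume \<omega>: "\<omega> \<in> space M" and "(\<forall>t\<ge>0. set_integrable lborel {0..t} (\<lambda>s. (sqrt (R s \<omega>))\<^sup>2)) \<and>
      continuous_on {0..} (\<lambda>t. Z t \<omega>) \<and>
      (\<forall>t\<ge>0. set_integrable lborel {0..t} (\<lambda>s. \<alpha> + \<beta> * left_lim (\<lambda>s. R s \<omega>) s)) \<and>
      (\<forall>t\<ge>0. R t \<omega> = R 0 \<omega> + (LBINT s:{0..t}. b * (c - R s \<omega>)) + a * real (N t \<omega>) + \<sigma> * Z t \<omega>) \<and>
      R 0 \<omega> = r"
    then show "regular_path \<omega>" by (elim conjE) (rule key[OF _ _ _ _ _ \<omega>])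
  qed
qed

lemma regular_path_props:
  assumes "regular_path \<omega>"
  shows "\<omega> \<in> space M" "continuous_on {0..t} (\<lambda>t. I t \<omega>)" "I 0 \<omega> = 0"
    "0 \<le> s \<Longrightarrow> s \<le> u \<Longrightarrow> I s \<omega> \<le> I u \<omega>" "0 \<le> s \<Longrightarrow> 0 \<le> I s \<omega>"
    "0 \<le> s \<Longrightarrow> \<Lambda> s \<omega> = \<alpha> * s + \<beta> * I s \<omega>"
    "0 \<le> s \<Longrightarrow> R s \<omega> = r + b * c * s - b * I s \<omega> + a * real (N s \<omega>) + \<sigma> * Z s \<omega>"
proof -
  show \<omega>: "\<omega> \<in> space M" using assms by (simp add: regular_path_def)
  have int: "\<forall>t\<ge>0. set_integrable lborel {0..t} (\<lambda>s. R s \<omega>)" using assms by (simp add: regular_path_def)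
  have nn: "\<forall>s\<ge>0. 0 \<le> R s \<omega>" using R_nonneg[OF \<omega>] by blast
  note P = indefinite_integral_props[OF int, folded I_def]
  show "continuous_on {0..t} (\<lambda>t. I t \<omega>)" "I 0 \<omega> = 0" by (rule P(1), rule P(4))
  show mono: "I s \<omega> \<le> I u \<omega>" if "0 \<le> s" "s \<le> u" for s u by (rule P(3)[OF nn that])
  show "0 \<le> I s \<omega>" if "0 \<le> s" using mono[OF order_refl that] P(4) by simp
  show "0 \<le> s \<Longrightarrow> \<Lambda> s \<omega> = \<alpha> * s + \<beta> * I s \<omega>"
    "0 \<le> s \<Longrightarrow> R s \<omega> = r + b * c * s - b * I s \<omega> + a * real (N s \<omega>) + \<sigma> * Z s \<omega>"
    using assms unfolding regular_path_def by blast+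
qed



section \<open>The truncated mean of the counting process\<close>

text \<open>Optional stopping at the first time \<open>I\<close> exceeds \<open>C\<close>, carried out on a grid. If the crossing happens in
  the interval \<open>(p i, p (i+1)]\<close>, the value at time \<open>t\<close> may be replaced under the expectation by the value at \<open>p (i+1)\<close>, where the
  lower bound on \<open>X\<close> applies. An overshoot of \<open>I\<close> within one grid interval by more than \<open>1\<close> would spoil the bound;
  such paths are left out, and they disappear as the grid is refined, because \<open>I\<close> is continuous and
  \<open>X t\<close> is integrable. As \<open>X\<close> has mean zero, a lower bound off \<open>{I t \<le> C}\<close> is an upper bound on it.\<close>

lemma stopped_martingale_truncated:
  assumes X: "is_martingale X" and X0: "AE \<omega> in M. X 0 \<omega> = 0"
    and t: "0 < t" and C: "0 \<le> C"
    and lower: "AE \<omega> in M. \<forall>u\<in>{0..t}. - (\<alpha> * u + \<beta> * I u \<omega>) \<le> X u \<omega>"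
  shows "(\<integral>\<omega>. X t \<omega> * of_bool (I t \<omega> \<le> C) \<partial>M) \<le> (\<alpha> * t + \<beta> * (C + 1)) * (\<integral>\<omega>. of_bool (C < I t \<omega>) \<partial>M)"
proof -
  define K where "K = \<alpha> * t + \<beta> * (C + 1)"
  have K0: "0 \<le> K" using pos t C by (simp add: K_def)
  have t0: "0 \<le> t" using t by simp
  define p where "p = uniform_grid t"
  note grid = uniform_grid_props[OF t0, folded p_def]
  note p0 = grid(1) and pS = grid(2) and pt = grid(3) and pe = grid(4,5) and pd = grid(6)
  define Y where "Y n i \<omega> = (of_bool (I (p n i) \<omega> \<le> C \<and> C < I (p n (Suc i)) \<omega> \<and> I (p n (Suc i)) \<omega> \<le> C + 1) :: real)"
    for n i \<omega>
  define G where "G n \<omega> = (\<Sum>i<Suc n. Y n i \<omega>)" for n \<omega>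
  have Xi: "integrable M (X u)" if "0 \<le> u" for u using X that by (auto simp: is_martingale_def)
  have [measurable]: "X t \<in> borel_measurable M" using Xi[of t] t by auto
  have [measurable]: "I t \<in> borel_measurable M" using I_borel[of t] t by simp
  have YF: "Y n i \<in> borel_measurable (F (p n (Suc i)))" for n i
  proof -
    have [measurable]: "I (p n (Suc i)) \<in> borel_measurable (F (p n (Suc i)))" by (rule I_measurable[OF p0])
    have [measurable]: "I (p n i) \<in> borel_measurable (F (p n (Suc i)))"
      by (rule F_borel_mono[OF pS I_measurable[OF p0]])
    show ?thesis unfolding Y_def by measurable
  qed
  have YM [measurable]: "Y n i \<in> borel_measurable M" for n i by (rule F_borel[OF YF])
  have Y01: "0 \<le> Y n i \<omega>" "Y n i \<omega> \<le> 1" for n i \<omega> by (auto simp: Y_def)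
  have Yi: "integrable M (Y n i)" for n i
    by (rule integrable_const_bound[of _ 1]) (use Y01 in auto)
  have Gi: "integrable M (G n)" for n unfolding G_def using Yi by auto
  have GM [measurable]: "G n \<in> borel_measurable M" for n using Gi by auto
  have G_le: "AE \<omega> in M. \<forall>n. 0 \<le> G n \<omega> \<and> G n \<omega> \<le> of_bool (C < I t \<omega>)"
    using AE_regular_path
  proof eventually_elim
    case g: (elim \<omega>)
    show ?case
    proof
      fix n
      have "G n \<omega> \<le> (\<Sum>i<Suc n. of_bool (I (p n i) \<omega> \<le> C \<and> C < I (p n (Suc i)) \<omega>))"
        unfolding G_def by (intro sum_mono) (auto simp: Y_def)
      also have "\<dots> = of_bool (C < I (p n (Suc n)) \<omega>) - of_bool (C < I (p n 0) \<omega>)"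
        by (rule exceedance_sum) (rule regular_path_props(4)[OF g p0 pS])
      also have "\<dots> \<le> of_bool (C < I t \<omega>)" by (simp add: pe)
      finally show "0 \<le> G n \<omega> \<and> G n \<omega> \<le> of_bool (C < I t \<omega>)"
        unfolding G_def by (intro conjI sum_nonneg Y01(1))
    qed
  qed
  have G_lim: "AE \<omega> in M. (\<lambda>n. X t \<omega> * (of_bool (C < I t \<omega>) - G n \<omega>)) \<longlonglongrightarrow> 0"
    using AE_regular_path
  proof eventually_elim
    case g: (elim \<omega>)
    obtain e where e: "0 < e" "\<And>s u. 0 \<le> s \<Longrightarrow> s \<le> u \<Longrightarrow> u \<le> t \<Longrightarrow> u < s + e \<Longrightarrow> I u \<omega> - I s \<omega> < 1"
      using continuous_small_increments[OF regular_path_props(2)[OF g, of t] zero_less_one] by metis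
    have "\<forall>\<^sub>F n in sequentially. X t \<omega> * (of_bool (C < I t \<omega>) - G n \<omega>) = 0"
      using uniform_grid_fine[OF e(1), of t]
    proof eventually_elim
      fix n assume n: "t / real (Suc n) < e"
      have "Y n i \<omega> = of_bool (I (p n i) \<omega> \<le> C \<and> C < I (p n (Suc i)) \<omega>)" if "i < Suc n" for i
      proof -
        have "I (p n (Suc i)) \<omega> - I (p n i) \<omega> < 1"
          by (rule e(2)[OF p0 pS pt]) (use that n pd in auto)
        then show ?thesis by (auto simp: Y_def)
      qed
      then have "G n \<omega> = (\<Sum>i<Suc n. of_bool (I (p n i) \<omega> \<le> C \<and> C < I (p n (Suc i)) \<omega>))"
        unfolding G_def by (intro sum.cong) auto
      also have "\<dots> = of_bool (C < I (p n (Suc n)) \<omega>) - of_bool (C < I (p n 0) \<omega>)"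
        by (rule exceedance_sum) (rule regular_path_props(4)[OF g p0 pS])
      also have "\<dots> = of_bool (C < I t \<omega>)"
        using C by (simp add: pe regular_path_props(3)[OF g])
      finally show "X t \<omega> * (of_bool (C < I t \<omega>) - G n \<omega>) = 0" by simp
    qed
    then show ?case
      by (rule tendsto_eventually)
  qed
  have XYi: "integrable M (\<lambda>\<omega>. Y n i \<omega> * X t \<omega>)" and
    XYe: "- K * (\<integral>\<omega>. Y n i \<omega> \<partial>M) \<le> (\<integral>\<omega>. Y n i \<omega> * X t \<omega> \<partial>M)" if i: "i < Suc n" for n i
  proof -
    have iS: "Suc i \<le> Suc n" and b: "\<And>\<omega>. \<omega> \<in> space M \<Longrightarrow> \<bar>Y n i \<omega>\<bar> \<le> 1" using i Y01[of n i] by (auto simp: abs_le_iff intro: order_trans)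
    note m = martingale_orthogonal[OF X p0 pt[OF iS] YF b]
    show "integrable M (\<lambda>\<omega>. Y n i \<omega> * X t \<omega>)" by (rule m(1))
    have "- K * (\<integral>\<omega>. Y n i \<omega> \<partial>M) = (\<integral>\<omega>. Y n i \<omega> * (- K) \<partial>M)" by simp
    also have "\<dots> \<le> (\<integral>\<omega>. Y n i \<omega> * X (p n (Suc i)) \<omega> \<partial>M)"
    proof (rule integral_mono_AE[OF _ m(2)])
      show "integrable M (\<lambda>\<omega>. Y n i \<omega> * (- K))" using Yi by (rule integrable_mult_left)
      show "AE \<omega> in M. Y n i \<omega> * (- K) \<le> Y n i \<omega> * X (p n (Suc i)) \<omega>"
        using lower
      proof eventually_elim
        case l: (elim \<omega>)
        show ?case
        proof (cases "I (p n (Suc i)) \<omega> \<le> C + 1")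
          case True
          have "\<alpha> * p n (Suc i) \<le> \<alpha> * t" "\<beta> * I (p n (Suc i)) \<omega> \<le> \<beta> * (C + 1)"
            using pt[OF iS] True pos by (auto intro!: mult_left_mono)
          then have "- K \<le> X (p n (Suc i)) \<omega>"
            using l[rule_format, of "p n (Suc i)"] p0[of n "Suc i"] pt[OF iS] by (simp add: K_def)
          then show ?thesis using Y01 by (intro mult_left_mono)
        qed (simp add: Y_def)
      qed
    qed
    also have "\<dots> = (\<integral>\<omega>. Y n i \<omega> * X t \<omega> \<partial>M)" by (rule m(3)[symmetric])
    finally show "- K * (\<integral>\<omega>. Y n i \<omega> \<partial>M) \<le> (\<integral>\<omega>. Y n i \<omega> * X t \<omega> \<partial>M)" .
  qed
  have i1: "integrable M (\<lambda>\<omega>. X t \<omega> * of_bool (I t \<omega> \<le> C))" "integrable M (\<lambda>\<omega>. X t \<omega> * of_bool (C < I t \<omega>))"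
    using t by (auto intro!: Bochner_Integration.integrable_bound[OF Xi[of t]] AE_I2)
  have i2: "integrable M (\<lambda>\<omega>. of_bool (C < I t \<omega>) :: real)"
    by (rule integrable_const_bound[of _ 1]) auto
  have XG: "integrable M (\<lambda>\<omega>. X t \<omega> * G n \<omega>)"
    "- K * (\<integral>\<omega>. of_bool (C < I t \<omega>) \<partial>M) \<le> (\<integral>\<omega>. X t \<omega> * G n \<omega> \<partial>M)" for n
  proof -
    have eq: "X t \<omega> * G n \<omega> = (\<Sum>i<Suc n. Y n i \<omega> * X t \<omega>)" for \<omega>
      unfolding G_def by (simp add: sum_distrib_left mult.commute del: sum.lessThan_Suc)
    show "integrable M (\<lambda>\<omega>. X t \<omega> * G n \<omega>)"
      unfolding eq by (intro Bochner_Integration.integrable_sum XYi) simp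
    have "(\<integral>\<omega>. G n \<omega> \<partial>M) \<le> (\<integral>\<omega>. of_bool (C < I t \<omega>) \<partial>M)"
      by (rule integral_mono_AE[OF Gi i2]) (use G_le in \<open>auto elim!: eventually_mono\<close>)
    then have "- K * (\<integral>\<omega>. of_bool (C < I t \<omega>) \<partial>M) \<le> - K * (\<integral>\<omega>. G n \<omega> \<partial>M)"
      using K0 by (intro mult_left_mono_neg) auto
    also have "\<dots> = (\<Sum>i<Suc n. - K * (\<integral>\<omega>. Y n i \<omega> \<partial>M))"
      unfolding G_def sum_distrib_left[symmetric] by (subst Bochner_Integration.integral_sum) (auto simp: Yi)
    also have "\<dots> \<le> (\<Sum>i<Suc n. (\<integral>\<omega>. Y n i \<omega> * X t \<omega> \<partial>M))"
      by (intro sum_mono XYe) simp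
    also have "\<dots> = (\<integral>\<omega>. X t \<omega> * G n \<omega> \<partial>M)"
      unfolding eq by (intro Bochner_Integration.integral_sum[symmetric] XYi) simp
    finally show "- K * (\<integral>\<omega>. of_bool (C < I t \<omega>) \<partial>M) \<le> (\<integral>\<omega>. X t \<omega> * G n \<omega> \<partial>M)" .
  qed
  have "(\<lambda>n. \<integral>\<omega>. X t \<omega> * (of_bool (C < I t \<omega>) - G n \<omega>) \<partial>M) \<longlonglongrightarrow> (\<integral>\<omega>. 0 \<partial>M)"
  proof (rule integral_dominated_convergence[where w="\<lambda>\<omega>. \<bar>X t \<omega>\<bar>"])
    show "integrable M (\<lambda>\<omega>. \<bar>X t \<omega>\<bar>)" using Xi t by simp
    show "AE \<omega> in M. norm (X t \<omega> * (of_bool (C < I t \<omega>) - G n \<omega>)) \<le> \<bar>X t \<omega>\<bar>" for n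
      using G_le
    proof eventually_elim
      case (elim \<omega>)
      then have "0 \<le> G n \<omega>" "G n \<omega> \<le> of_bool (C < I t \<omega>)" by auto
      moreover have "(of_bool (C < I t \<omega>) :: real) \<le> 1" by simp
      ultimately have "\<bar>of_bool (C < I t \<omega>) - G n \<omega>\<bar> \<le> 1" by linarith
      from mult_left_mono[OF this abs_ge_zero[of "X t \<omega>"]]
      show ?case by (simp add: abs_mult)
    qed
  qed (use G_lim in auto)
  moreover have "(\<integral>\<omega>. X t \<omega> * (of_bool (C < I t \<omega>) - G n \<omega>) \<partial>M)
     = (\<integral>\<omega>. X t \<omega> * of_bool (C < I t \<omega>) \<partial>M) - (\<integral>\<omega>. X t \<omega> * G n \<omega> \<partial>M)" for n
    using i1(2) XG(1) by (simp add: right_diff_distrib)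
  ultimately have "(\<lambda>n. (\<integral>\<omega>. X t \<omega> * of_bool (C < I t \<omega>) \<partial>M) - (\<integral>\<omega>. X t \<omega> * G n \<omega> \<partial>M)) \<longlonglongrightarrow> 0"
    by simp
  then have "0 \<le> (\<integral>\<omega>. X t \<omega> * of_bool (C < I t \<omega>) \<partial>M) + K * (\<integral>\<omega>. of_bool (C < I t \<omega>) \<partial>M)"
  proof (rule LIMSEQ_le_const2, intro exI allI impI)
    fix n
    show "(\<integral>\<omega>. X t \<omega> * of_bool (C < I t \<omega>) \<partial>M) - (\<integral>\<omega>. X t \<omega> * G n \<omega> \<partial>M)
      \<le> (\<integral>\<omega>. X t \<omega> * of_bool (C < I t \<omega>) \<partial>M) + K * (\<integral>\<omega>. of_bool (C < I t \<omega>) \<partial>M)"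
      using XG(2)[of n] by simp
  qed
  moreover have "(\<integral>\<omega>. X t \<omega> * of_bool (I t \<omega> \<le> C) \<partial>M) + (\<integral>\<omega>. X t \<omega> * of_bool (C < I t \<omega>) \<partial>M) = 0"
  proof -
    have "(\<integral>\<omega>. X t \<omega> * of_bool (I t \<omega> \<le> C) \<partial>M) + (\<integral>\<omega>. X t \<omega> * of_bool (C < I t \<omega>) \<partial>M) = (\<integral>\<omega>. X t \<omega> \<partial>M)"
    proof -
      have "(\<integral>\<omega>. X t \<omega> \<partial>M) = (\<integral>\<omega>. X t \<omega> * of_bool (I t \<omega> \<le> C) + X t \<omega> * of_bool (C < I t \<omega>) \<partial>M)"
        by (intro Bochner_Integration.integral_cong refl) (simp add: of_bool_def)
      then show ?thesis using i1 by simp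
    qed
    also have "\<dots> = (\<integral>\<omega>. X 0 \<omega> \<partial>M)"
      using martingale_orthogonal(3)[OF X order_refl, of t "\<lambda>_. 1" 1] t by simp
    also have "\<dots> = (\<integral>\<omega>. 0 \<partial>M)"
      using X0 Xi[of 0] by (intro integral_cong_AE) auto
    finally show ?thesis by simp
  qed
  ultimately show ?thesis by (simp add: K_def)
qed


lemma compensated_local_martingale:
  obtains \<tau> :: "nat \<Rightarrow> 'a \<Rightarrow> real" where
    "\<And>n \<omega>. \<omega> \<in> space M \<Longrightarrow> 0 \<le> \<tau> n \<omega>"
    "AE \<omega> in M. filterlim (\<lambda>n. \<tau> n \<omega>) at_top sequentially"
    "\<And>n. is_martingale (\<lambda>t \<omega>. real (N (min t (\<tau> n \<omega>)) \<omega>) - \<Lambda> (min t (\<tau> n \<omega>)) \<omega>)"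
proof -
  have "local_martingale (\<lambda>t \<omega>. real (N t \<omega>) - \<Lambda> t \<omega>)"
    using N_intensity unfolding has_intensity_def \<Lambda>_def by (elim conjE)
  then obtain \<tau> :: "nat \<Rightarrow> 'a \<Rightarrow> real" where
    1: "\<forall>n. stopping_time F (\<tau> n) \<and> (\<forall>\<omega>\<in>space M. 0 \<le> \<tau> n \<omega>)"
    and 2: "AE \<omega> in M. incseq (\<lambda>n. \<tau> n \<omega>) \<and> filterlim (\<lambda>n. \<tau> n \<omega>) at_top sequentially"
    and 3: "\<forall>n. is_martingale (\<lambda>t \<omega>. real (N (min t (\<tau> n \<omega>)) \<omega>) - \<Lambda> (min t (\<tau> n \<omega>)) \<omega>)"
    unfolding local_martingale_def by blast
  show thesis
    by (rule that[of \<tau>]) (use 1 2 3 in \<open>auto elim!: eventually_mono\<close>)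
qed

text \<open>\<open>stopped_martingale_truncated\<close> is applied to the localized martingales \<open>N - \<Lambda>\<close>, which are bounded below by minus the
  compensator; Fatou's lemma removes the localization.\<close>

lemma N_truncated_mean:
  assumes t: "0 < t" and C: "0 \<le> C"
  shows "(\<integral>\<^sup>+\<omega>. ennreal (real (N t \<omega>)) * indicator {\<omega>. I t \<omega> \<le> C} \<omega> \<partial>M)
    \<le> (\<integral>\<^sup>+\<omega>. ennreal (\<alpha> * t + \<beta> * (min (I t \<omega>) C + 1)) \<partial>M)"
proof -
  obtain \<tau> :: "nat \<Rightarrow> 'a \<Rightarrow> real" where \<tau>0: "\<And>n \<omega>. \<omega> \<in> space M \<Longrightarrow> 0 \<le> \<tau> n \<omega>"
    and \<tau>lim: "AE \<omega> in M. filterlim (\<lambda>n. \<tau> n \<omega>) at_top sequentially"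
    and mart: "\<And>n. is_martingale (\<lambda>t \<omega>. real (N (min t (\<tau> n \<omega>)) \<omega>) - \<Lambda> (min t (\<tau> n \<omega>)) \<omega>)"
    using compensated_local_martingale by blast
  define X where "X k u \<omega> = real (N (min u (\<tau> k \<omega>)) \<omega>) - \<Lambda> (min u (\<tau> k \<omega>)) \<omega>" for k u \<omega>
  have X: "is_martingale (X k)" for k using mart[of k] by (simp add: X_def[abs_def])
  have [measurable]: "I t \<in> borel_measurable M" using I_borel t by simp
  have Xi: "integrable M (X k t)" for k using X t by (auto simp: is_martingale_def)
  have [measurable]: "X k t \<in> borel_measurable M" for k using Xi by auto
  \<comment> \<open>Replaces the stopped \<open>N\<close>, up to the difference between the compensators at time \<open>t\<close> and at the stopping time;
  measurability is then evident.\<close>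
  define Y where "Y k \<omega> = (X k t \<omega> + (\<alpha> * t + \<beta> * I t \<omega>)) * of_bool (I t \<omega> \<le> C)" for k \<omega>
  have YM [measurable]: "Y k \<in> borel_measurable M" for k unfolding Y_def by measurable
  have low: "- (\<alpha> * u + \<beta> * I u \<omega>) \<le> X k u \<omega>" if g: "regular_path \<omega>" and u: "0 \<le> u" for k u \<omega>
  proof -
    note G = regular_path_props[OF g]
    have m: "0 \<le> min u (\<tau> k \<omega>)" using \<tau>0[OF G(1)] u by simp
    have "\<alpha> * min u (\<tau> k \<omega>) \<le> \<alpha> * u" "\<beta> * I (min u (\<tau> k \<omega>)) \<omega> \<le> \<beta> * I u \<omega>"
      using pos G(4)[OF m, of u] by (auto intro!: mult_left_mono)
    then show ?thesis unfolding X_def G(6)[OF m] by simp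
  qed
  have X0: "AE \<omega> in M. X k 0 \<omega> = 0" for k
    using AE_regular_path
  proof eventually_elim
    case g: (elim \<omega>)
    note G = regular_path_props[OF g]
    have "min 0 (\<tau> k \<omega>) = 0" using \<tau>0[OF G(1), of k] by simp
    moreover have "N 0 \<omega> = 0" using N_path[OF G(1)] by (simp add: counting_path_def)
    ultimately show ?case using G(6)[OF order_refl] G(3) by (simp add: X_def)
  qed
  have Yk: "(\<integral>\<^sup>+\<omega>. ennreal (Y k \<omega>) \<partial>M) \<le> (\<integral>\<^sup>+\<omega>. ennreal (\<alpha> * t + \<beta> * (min (I t \<omega>) C + 1)) \<partial>M)" for k
  proof -
    have i1: "integrable M (\<lambda>\<omega>. X k t \<omega> * of_bool (I t \<omega> \<le> C))"
      by (auto intro!: Bochner_Integration.integrable_bound[OF Xi[of k]] AE_I2)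
    have In: "AE \<omega> in M. 0 \<le> I t \<omega>" using AE_regular_path
      by eventually_elim (use regular_path_props(5) t in auto)
    have i2: "integrable M (\<lambda>\<omega>. (\<alpha> * t + \<beta> * I t \<omega>) * of_bool (I t \<omega> \<le> C))"
    proof (rule integrable_const_bound)
      show "AE \<omega> in M. norm ((\<alpha> * t + \<beta> * I t \<omega>) * of_bool (I t \<omega> \<le> C)) \<le> \<alpha> * t + \<beta> * C"
        using In
      proof eventually_elim
        case i: (elim \<omega>)
        then have "0 \<le> \<alpha> * t + \<beta> * I t \<omega>" using pos t by simp
        moreover have "\<beta> * I t \<omega> \<le> \<beta> * C" if "I t \<omega> \<le> C" using that pos by simp
        ultimately show ?case
          using pos t C by (cases "I t \<omega> \<le> C") auto
      qed
    qed simp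
    have i3: "integrable M (\<lambda>\<omega>. of_bool (C < I t \<omega>) :: real)"
      by (rule integrable_const_bound[of _ 1]) auto
    have i4: "integrable M (\<lambda>\<omega>. \<alpha> * t + \<beta> * (min (I t \<omega>) C + 1))"
      by (rule integrable_const_bound[of _ "\<alpha> * t + \<beta> * (C + 1)"])
        (use In pos t C in \<open>auto elim!: eventually_mono simp: abs_of_nonneg\<close>)
    have Yi: "integrable M (Y k)" unfolding Y_def distrib_right using i1 i2 by (simp add: distrib_right)
    have Y0: "AE \<omega> in M. 0 \<le> Y k \<omega>" using AE_regular_path
    proof eventually_elim
      case (elim \<omega>)
      then have "- (\<alpha> * t + \<beta> * I t \<omega>) \<le> X k t \<omega>" using low t by simp
      then show ?case by (simp add: Y_def)
    qed
    have "(\<integral>\<omega>. Y k \<omega> \<partial>M) = (\<integral>\<omega>. X k t \<omega> * of_bool (I t \<omega> \<le> C) \<partial>M) + (\<integral>\<omega>. (\<alpha> * t + \<beta> * I t \<omega>) * of_bool (I t \<omega> \<le> C) \<partial>M)"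
      unfolding Y_def distrib_right[of "X k t _"] using i1 i2 by (rule Bochner_Integration.integral_add)
    also have "\<dots> \<le> (\<alpha> * t + \<beta> * (C + 1)) * (\<integral>\<omega>. of_bool (C < I t \<omega>) \<partial>M) + (\<integral>\<omega>. (\<alpha> * t + \<beta> * I t \<omega>) * of_bool (I t \<omega> \<le> C) \<partial>M)"
      by (intro add_right_mono stopped_martingale_truncated X X0 t C)
        (use AE_regular_path in \<open>eventually_elim, use low in auto\<close>)
    also have "\<dots> = (\<integral>\<omega>. (\<alpha> * t + \<beta> * (C + 1)) * of_bool (C < I t \<omega>) + (\<alpha> * t + \<beta> * I t \<omega>) * of_bool (I t \<omega> \<le> C) \<partial>M)"
      using i2 i3 by simp
    also have "\<dots> \<le> (\<integral>\<omega>. \<alpha> * t + \<beta> * (min (I t \<omega>) C + 1) \<partial>M)"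
      using i2 i3 i4 pos by (intro integral_mono) (auto simp: min_def)
    finally have le: "(\<integral>\<omega>. Y k \<omega> \<partial>M) \<le> (\<integral>\<omega>. \<alpha> * t + \<beta> * (min (I t \<omega>) C + 1) \<partial>M)" .
    have "(\<integral>\<^sup>+\<omega>. ennreal (Y k \<omega>) \<partial>M) = ennreal (\<integral>\<omega>. Y k \<omega> \<partial>M)"
      by (rule nn_integral_eq_integral[OF Yi Y0])
    also have "\<dots> \<le> ennreal (\<integral>\<omega>. \<alpha> * t + \<beta> * (min (I t \<omega>) C + 1) \<partial>M)" using le by (rule ennreal_leI)
    also have "\<dots> = (\<integral>\<^sup>+\<omega>. ennreal (\<alpha> * t + \<beta> * (min (I t \<omega>) C + 1)) \<partial>M)"
      by (intro nn_integral_eq_integral[symmetric] i4) (use In pos t C in \<open>auto elim!: eventually_mono\<close>)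
    finally show ?thesis .
  qed
  have "(\<integral>\<^sup>+\<omega>. ennreal (real (N t \<omega>)) * indicator {\<omega>. I t \<omega> \<le> C} \<omega> \<partial>M)
     \<le> (\<integral>\<^sup>+\<omega>. liminf (\<lambda>k. ennreal (Y k \<omega>)) \<partial>M)"
  proof (rule nn_integral_mono_AE)
    show "AE \<omega> in M. ennreal (real (N t \<omega>)) * indicator {\<omega>. I t \<omega> \<le> C} \<omega> \<le> liminf (\<lambda>k. ennreal (Y k \<omega>))"
      using AE_regular_path \<tau>lim
    proof eventually_elim
      case (elim \<omega>)
      note g = elim(1) and l = elim(2)
      have "\<forall>\<^sub>F k in sequentially. t \<le> \<tau> k \<omega>" using l by (simp add: filterlim_at_top)
      then have "\<forall>\<^sub>F k in sequentially. ennreal (Y k \<omega>) = ennreal (real (N t \<omega>)) * indicator {\<omega>. I t \<omega> \<le> C} \<omega>"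
      proof eventually_elim
        fix k assume "t \<le> \<tau> k \<omega>"
        then have "X k t \<omega> = real (N t \<omega>) - (\<alpha> * t + \<beta> * I t \<omega>)"
          using regular_path_props(6)[OF g, of t] t by (simp add: X_def min_absorb1)
        then show "ennreal (Y k \<omega>) = ennreal (real (N t \<omega>)) * indicator {\<omega>. I t \<omega> \<le> C} \<omega>"
          by (simp add: Y_def)
      qed
      from liminf_eventually_const[OF this]
      show ?case by simp
    qed
  qed
  also have "\<dots> \<le> liminf (\<lambda>k. \<integral>\<^sup>+\<omega>. ennreal (Y k \<omega>) \<partial>M)" by (rule nn_integral_liminf) measurable
  also have "\<dots> \<le> liminf (\<lambda>k::nat. (\<integral>\<^sup>+\<omega>. ennreal (\<alpha> * t + \<beta> * (min (I t \<omega>) C + 1)) \<partial>M))"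
    by (intro Liminf_mono always_eventually allI Yk)
  also have "\<dots> = (\<integral>\<^sup>+\<omega>. ennreal (\<alpha> * t + \<beta> * (min (I t \<omega>) C + 1)) \<partial>M)"
    by (rule Liminf_const) simp
  finally show ?thesis .
qed

end

section \<open>Linear growth of the first moments\<close>

text \<open>The weight \<open>exp (- 2 B s)\<close> makes the integral operator a contraction with constant \<open>1/2\<close> on the finite
  supremum \<open>w\<close> of the weighted function. The a priori bound \<open>C\<close> makes \<open>w\<close> finite.\<close>

lemma integral_gronwall:
  fixes v :: "real \<Rightarrow> real"
  assumes T: "0 \<le> T" and A: "0 \<le> A" and B: "0 < B"
    and v: "\<And>s. s \<in> {0..T} \<Longrightarrow> 0 \<le> v s \<and> v s \<le> C"
    and le: "\<And>t. t \<in> {0..T} \<Longrightarrow> ennreal (v t) \<le> (\<integral>\<^sup>+s. ennreal (A + B * v s) * indicator {0..t} s \<partial>lborel)"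
  shows "v T \<le> 2 * A * T * exp (2 * B * T)"
proof -
  define w where "w = (SUP s\<in>{0..T}. exp (- 2 * B * s) * v s)"
  have bdd: "bdd_above ((\<lambda>s. exp (- 2 * B * s) * v s) ` {0..T})"
  proof (rule bdd_aboveI2)
    fix s assume s: "s \<in> {0..T}"
    have "exp (- 2 * B * s) * v s \<le> 1 * C" using v[OF s] s B by (intro mult_mono) auto
    then show "exp (- 2 * B * s) * v s \<le> C" by simp
  qed
  have up: "v s \<le> w * exp (2 * B * s)" if s: "s \<in> {0..T}" for s
  proof -
    have "exp (- 2 * B * s) * v s \<le> w" unfolding w_def by (rule cSUP_upper[OF s bdd])
    then have "exp (2 * B * s) * (exp (- 2 * B * s) * v s) \<le> exp (2 * B * s) * w" by (intro mult_left_mono) auto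
    also have "exp (2 * B * s) * (exp (- 2 * B * s) * v s) = v s" by (simp add: exp_minus)
    finally show ?thesis by (simp add: mult.commute)
  qed
  have w0: "0 \<le> w" using up[of 0] v[of 0] T by simp
  have "w \<le> A * T + w / 2" unfolding w_def[symmetric]
  proof (subst w_def, rule cSUP_least)
    fix t assume t: "t \<in> {0..T}"
    let ?F = "\<lambda>s. A * s + w / 2 * exp (2 * B * s)"
    have "ennreal (v t) \<le> (\<integral>\<^sup>+s. ennreal (A + B * v s) * indicator {0..t} s \<partial>lborel)" by (rule le[OF t])
    also have "\<dots> \<le> (\<integral>\<^sup>+s. ennreal (A + B * w * exp (2 * B * s)) * indicator {0..t} s \<partial>lborel)"
    proof (rule nn_integral_mono)
      fix s :: real
      show "ennreal (A + B * v s) * indicator {0..t} s \<le> ennreal (A + B * w * exp (2 * B * s)) * indicator {0..t} s"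
      proof (cases "s \<in> {0..t}")
        case True
        then have "B * v s \<le> B * (w * exp (2 * B * s))" using up[of s] t B by (intro mult_left_mono) auto
        then show ?thesis using True by (simp add: ennreal_leI mult.assoc)
      qed simp
    qed
    also have "\<dots> = ennreal (?F t - ?F 0)"
    proof (rule nn_integral_FTC_Icc)
      show "(?F has_real_derivative A + B * w * exp (2 * B * s)) (at s)" for s
        by (auto intro!: derivative_eq_intros simp: algebra_simps)
    qed (use t A B w0 in auto)
    finally have *: "ennreal (v t) \<le> ennreal (?F t - ?F 0)" .
    have "0 \<le> A * t" "w / 2 * 1 \<le> w / 2 * exp (2 * B * t)"
      using A t w0 B by (simp, intro mult_left_mono) auto
    then have "0 \<le> ?F t - ?F 0" by simp
    with * have "v t \<le> ?F t - ?F 0" by (simp only: ennreal_le_iff)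
    also have "\<dots> \<le> A * T + w / 2 * exp (2 * B * t)"
      using mult_left_mono[of t T A] A t w0 by simp
    finally have "exp (- 2 * B * t) * v t \<le> exp (- 2 * B * t) * (A * T + w / 2 * exp (2 * B * t))"
      by (intro mult_left_mono) auto
    also have "\<dots> = exp (- 2 * B * t) * (A * T) + w / 2" by (simp add: algebra_simps exp_minus)
    also have "\<dots> \<le> 1 * (A * T) + w / 2"
      using A B T t by (intro add_right_mono mult_right_mono) auto
    finally show "exp (- 2 * B * t) * v t \<le> A * T + w / 2" by simp
  qed (use T in auto)
  then have "w \<le> 2 * A * T" by simp
  then have "w * exp (2 * B * T) \<le> 2 * A * T * exp (2 * B * T)" by (intro mult_right_mono) auto
  moreover have "v T \<le> w * exp (2 * B * T)" using T by (intro up) simp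
  ultimately show ?thesis by (rule order_trans[rotated])
qed

context stable_cir_hawkes begin

lemma R_jointly_measurable:
  assumes t: "0 \<le> t"
  shows "(\<lambda>(s, \<omega>). R s \<omega>) \<in> borel_measurable (restrict_space lborel {0..t} \<Otimes>\<^sub>M M)"
proof -
  have m: "(\<lambda>(s, \<omega>). R s \<omega>) \<in> borel_measurable (restrict_space borel {0..t} \<Otimes>\<^sub>M F t)"
    using R_progressive t by (auto simp: progressive_def)
  have id: "(\<lambda>x. x) \<in> M \<rightarrow>\<^sub>M F t"
    using subalgebra_F[of t] by (auto simp: measurable_def subalgebra_def space_F)
  have rid: "(\<lambda>x. x) \<in> restrict_space lborel {0..t} \<rightarrow>\<^sub>M restrict_space borel {0..t}"
    using measurable_ident_sets[OF sets_restrict_space_cong[OF sets_lborel]] by simp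
  have "(\<lambda>x. (fst x, snd x)) \<in> restrict_space lborel {0..t} \<Otimes>\<^sub>M M \<rightarrow>\<^sub>M restrict_space borel {0..t} \<Otimes>\<^sub>M F t"
    by (intro measurable_Pair measurable_compose[OF measurable_fst rid] measurable_compose[OF measurable_snd id])
  from measurable_compose[OF this m] show ?thesis by (simp add: split_beta)
qed

text \<open>A parameter integral, with the running end point written as an indicator.\<close>

lemma I_jointly_measurable:
  assumes t: "0 \<le> t"
  shows "(\<lambda>(s, \<omega>). I s \<omega>) \<in> borel_measurable (restrict_space lborel {0..t} \<Otimes>\<^sub>M M)"
proof -
  let ?B = "restrict_space lborel {0..t}"
  interpret B: sigma_finite_measure ?B
    by (rule sigma_finite_measure_restrict_space) (auto intro: sigma_finite_lborel)
  have c: "(\<lambda>x. (snd x, snd (fst x))) \<in> (?B \<Otimes>\<^sub>M M) \<Otimes>\<^sub>M ?B \<rightarrow>\<^sub>M ?B \<Otimes>\<^sub>M M" by measurable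
  have Rm: "(\<lambda>x. R (snd x) (snd (fst x))) \<in> borel_measurable ((?B \<Otimes>\<^sub>M M) \<Otimes>\<^sub>M ?B)"
    using measurable_compose[OF c R_jointly_measurable[OF t]] by simp
  have idb: "(\<lambda>x. x) \<in> ?B \<rightarrow>\<^sub>M borel" by (rule measurable_restrict_space1) simp
  have m1: "(\<lambda>x. snd x) \<in> (?B \<Otimes>\<^sub>M M) \<Otimes>\<^sub>M ?B \<rightarrow>\<^sub>M borel"
    by (rule measurable_compose[OF measurable_snd idb])
  have m2: "(\<lambda>x. fst (fst x)) \<in> (?B \<Otimes>\<^sub>M M) \<Otimes>\<^sub>M ?B \<rightarrow>\<^sub>M borel"
    by (rule measurable_compose[OF measurable_compose[OF measurable_fst measurable_fst] idb])
  have "(\<lambda>x. R (snd x) (snd (fst x)) * of_bool (snd x \<le> fst (fst x))) \<in> borel_measurable ((?B \<Otimes>\<^sub>M M) \<Otimes>\<^sub>M ?B)"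
    using Rm m1 m2 by measurable
  then have "(\<lambda>(x, v). R v (snd x) * of_bool (v \<le> fst x)) \<in> borel_measurable ((?B \<Otimes>\<^sub>M M) \<Otimes>\<^sub>M ?B)"
    by (simp add: split_beta)
  from B.borel_measurable_lebesgue_integral[OF this]
  have m: "(\<lambda>x. \<integral>v. R v (snd x) * of_bool (v \<le> fst x) \<partial>?B) \<in> borel_measurable (?B \<Otimes>\<^sub>M M)" .
  have "(\<integral>v. R v (snd x) * of_bool (v \<le> fst x) \<partial>?B) = I (fst x) (snd x)"
    if "x \<in> space (?B \<Otimes>\<^sub>M M)" for x
  proof -
    have x: "fst x \<le> t" using that by (auto simp: space_pair_measure space_restrict_space)
    have "indicator {0..t} v *\<^sub>R (R v (snd x) * of_bool (v \<le> fst x)) = indicator {0..fst x} v *\<^sub>R R v (snd x)" for v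
      using x by (simp add: indicator_def)
    then have "(\<integral>v. indicator {0..t} v *\<^sub>R (R v (snd x) * of_bool (v \<le> fst x)) \<partial>lborel)
      = (\<integral>v. indicator {0..fst x} v *\<^sub>R R v (snd x) \<partial>lborel)"
      by (intro Bochner_Integration.integral_cong refl)
    then show ?thesis
      unfolding I_def set_lebesgue_integral_def by (subst integral_restrict_space) (auto simp del: real_scaleR_def)
  qed
  then show ?thesis using m by (subst measurable_cong[where g="\<lambda>x. \<integral>v. R v (snd x) * of_bool (v \<le> fst x) \<partial>?B"]) (auto simp: split_beta)
qed

lemma expectation_time_integral_swap:
  fixes g :: "real \<Rightarrow> 'a \<Rightarrow> real"
  assumes g: "(\<lambda>(s, \<omega>). g s \<omega>) \<in> borel_measurable (restrict_space lborel {0..t} \<Otimes>\<^sub>M M)"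
  shows "(\<integral>\<^sup>+\<omega>. (\<integral>\<^sup>+s. ennreal (g s \<omega>) * indicator {0..t} s \<partial>lborel) \<partial>M)
     = (\<integral>\<^sup>+s. (\<integral>\<^sup>+\<omega>. ennreal (g s \<omega>) \<partial>M) * indicator {0..t} s \<partial>lborel)"
proof -
  let ?B = "restrict_space lborel {0..t}"
  interpret B: sigma_finite_measure ?B
    by (rule sigma_finite_measure_restrict_space) (auto intro: sigma_finite_lborel)
  interpret BM: pair_sigma_finite ?B M by unfold_locales
  have "(\<lambda>x. ennreal (g (fst x) (snd x))) \<in> borel_measurable (?B \<Otimes>\<^sub>M M)"
    using g by (simp add: split_beta)
  from BM.Fubini[OF this] show ?thesis by (simp add: nn_integral_restrict_space)
qed

text \<open>Time \<open>0\<close> is a null set. It is left out because the moment bounds are stated for positive times.\<close>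

lemma expectation_time_integral_le:
  fixes g :: "real \<Rightarrow> 'a \<Rightarrow> real"
  assumes g: "(\<lambda>(s, \<omega>). g s \<omega>) \<in> borel_measurable (restrict_space lborel {0..t} \<Otimes>\<^sub>M M)"
    and le: "\<And>s. 0 < s \<Longrightarrow> s \<le> t \<Longrightarrow> (\<integral>\<^sup>+\<omega>. ennreal (g s \<omega>) \<partial>M) \<le> h s"
  shows "(\<integral>\<^sup>+\<omega>. (\<integral>\<^sup>+s. ennreal (g s \<omega>) * indicator {0..t} s \<partial>lborel) \<partial>M)
     \<le> (\<integral>\<^sup>+s. h s * indicator {0..t} s \<partial>lborel)"
  unfolding expectation_time_integral_swap[OF g]
proof (rule nn_integral_mono_AE)
  have "AE s in lborel. s \<noteq> (0::real)" by (rule AE_lborel_singleton)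
  then show "AE s in lborel. (\<integral>\<^sup>+\<omega>. ennreal (g s \<omega>) \<partial>M) * indicator {0..t} s \<le> h s * indicator {0..t} s"
  proof eventually_elim
    case s: (elim s)
    show ?case
      using le[of s] s by (cases "s \<in> {0..t}") auto
  qed
qed

lemma Z_truncated_second_moment:
  assumes t: "0 \<le> t" and C: "0 \<le> C"
  shows "(\<integral>\<^sup>+\<omega>. ennreal ((Z t \<omega>)\<^sup>2) * indicator {\<omega>. I t \<omega> \<le> C} \<omega> \<partial>M)
     \<le> (\<integral>\<^sup>+\<omega>. ennreal (2 * min (I t \<omega>) C + 1) \<partial>M)"
proof -
  have eq: "(LBINT s:{0..t}. (sqrt (R s \<omega>))\<^sup>2) = I t \<omega>" if \<omega>: "\<omega> \<in> space M" for \<omega>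
    unfolding I_def using R_nonneg[OF \<omega>] by (intro set_lebesgue_integral_cong) auto
  have "(\<integral>\<^sup>+\<omega>. ennreal ((Z t \<omega>)\<^sup>2) * indicator {\<omega>. I t \<omega> \<le> C} \<omega> \<partial>M)
     = (\<integral>\<^sup>+\<omega>. ennreal ((Z t \<omega>)\<^sup>2) * indicator {\<omega>. (LBINT s:{0..t}. (sqrt (R s \<omega>))\<^sup>2) \<le> C} \<omega> \<partial>M)"
    using eq by (intro nn_integral_cong) (simp add: indicator_def)
  also have "\<dots> \<le> (\<integral>\<^sup>+\<omega>. ennreal (2 * min (LBINT s:{0..t}. (sqrt (R s \<omega>))\<^sup>2) C + 1) \<partial>M)"
    by (rule ito_second_moment(1)[OF W_brownian ito t C])
  also have "\<dots> = (\<integral>\<^sup>+\<omega>. ennreal (2 * min (I t \<omega>) C + 1) \<partial>M)"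
    using eq by (intro nn_integral_cong) simp
  finally show ?thesis .
qed

lemma Z_borel: "0 \<le> t \<Longrightarrow> Z t \<in> borel_measurable M"
  by (rule ito_second_moment(2)[OF W_brownian ito _ order_refl])

lemma I_nonneg: "\<omega> \<in> space M \<Longrightarrow> 0 \<le> I t \<omega>"
  unfolding I_def set_lebesgue_integral_def
  by (rule Bochner_Integration.integral_nonneg) (auto simp: indicator_def intro: R_nonneg)

lemma min_I_integrable: "0 \<le> t \<Longrightarrow> 0 \<le> C \<Longrightarrow> integrable M (\<lambda>\<omega>. min (I t \<omega>) C)"
  by (rule integrable_const_bound[of _ C])
    (use I_borel I_nonneg in \<open>auto intro!: AE_I2\<close>)

lemma nn_min_I_affine:
  assumes "0 \<le> t" "0 \<le> C" "0 \<le> x" "0 \<le> y"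
  shows "(\<integral>\<^sup>+\<omega>. ennreal (x + y * min (I t \<omega>) C) \<partial>M) = ennreal (x + y * (\<integral>\<omega>. min (I t \<omega>) C \<partial>M))"
proof -
  have i: "integrable M (\<lambda>\<omega>. min (I t \<omega>) C)" using assms min_I_integrable by blast
  then have "(\<integral>\<^sup>+\<omega>. ennreal (x + y * min (I t \<omega>) C) \<partial>M) = ennreal (\<integral>\<omega>. x + y * min (I t \<omega>) C \<partial>M)"
    using assms I_nonneg by (intro nn_integral_eq_integral AE_I2) auto
  also have "(\<integral>\<omega>. x + y * min (I t \<omega>) C \<partial>M) = x + y * (\<integral>\<omega>. min (I t \<omega>) C \<partial>M)"
    using i by (simp add: prob_space)
  finally show ?thesis .
qed

text \<open>Take expectations in the equation for \<open>R\<close> on the event \<open>{I t \<le> C}\<close>; the drift \<open>- b I t\<close> has the good sign and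
  \<open>Z \<le> 1 + Z\<^sup>2\<close>.\<close>

lemma R_truncated_mean:
  assumes t: "0 < t" and C: "0 \<le> C"
  shows "(\<integral>\<^sup>+\<omega>. ennreal (R t \<omega> * of_bool (I t \<omega> \<le> C)) \<partial>M)
    \<le> ennreal ((r + b * c * t + 2 * \<sigma> + a * (\<alpha> * t + \<beta>)) + (a * \<beta> + 2 * \<sigma>) * (\<integral>\<omega>. min (I t \<omega>) C \<partial>M))"
proof -
  have t0: "0 \<le> t" using t by simp
  have [measurable]: "I t \<in> borel_measurable M" "Z t \<in> borel_measurable M" "(\<lambda>\<omega>. real (N t \<omega>)) \<in> borel_measurable M"
    using I_borel Z_borel N_borel t0 by auto
  let ?v = "\<integral>\<omega>. min (I t \<omega>) C \<partial>M"
  have v0: "0 \<le> ?v" using I_nonneg C by (intro Bochner_Integration.integral_nonneg) auto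
  have "(\<integral>\<^sup>+\<omega>. ennreal (R t \<omega> * of_bool (I t \<omega> \<le> C)) \<partial>M)
    \<le> (\<integral>\<^sup>+\<omega>. (ennreal (r + b * c * t + \<sigma>) + (ennreal a * (ennreal (real (N t \<omega>)) * indicator {\<omega>. I t \<omega> \<le> C} \<omega>)
        + ennreal \<sigma> * (ennreal ((Z t \<omega>)\<^sup>2) * indicator {\<omega>. I t \<omega> \<le> C} \<omega>))) \<partial>M)"
  proof (rule nn_integral_mono_AE)
    show "AE \<omega> in M. ennreal (R t \<omega> * of_bool (I t \<omega> \<le> C)) \<le> ennreal (r + b * c * t + \<sigma>)
        + (ennreal a * (ennreal (real (N t \<omega>)) * indicator {\<omega>. I t \<omega> \<le> C} \<omega>)
        + ennreal \<sigma> * (ennreal ((Z t \<omega>)\<^sup>2) * indicator {\<omega>. I t \<omega> \<le> C} \<omega>))"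
      using AE_regular_path
    proof eventually_elim
      case g: (elim \<omega>)
      note G = regular_path_props[OF g]
      show ?case
      proof (cases "I t \<omega> \<le> C")
        case True
        have "0 \<le> b * I t \<omega>" using pos I_nonneg[OF G(1)] by simp
        moreover have "z \<le> 1 + z\<^sup>2" for z :: real
          using zero_le_power2[of "z - 1/2"] by (simp add: power2_eq_square algebra_simps)
        then have "\<sigma> * Z t \<omega> \<le> \<sigma> * (1 + (Z t \<omega>)\<^sup>2)" using pos by (intro mult_left_mono) auto
        ultimately have "R t \<omega> \<le> (r + b * c * t + \<sigma>) + (a * real (N t \<omega>) + \<sigma> * (Z t \<omega>)\<^sup>2)"
          unfolding G(7)[OF t0] by (simp add: algebra_simps)
        then have "ennreal (R t \<omega>) \<le> ennreal ((r + b * c * t + \<sigma>) + (a * real (N t \<omega>) + \<sigma> * (Z t \<omega>)\<^sup>2))"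
          by (rule ennreal_leI)
        also have "\<dots> = ennreal (r + b * c * t + \<sigma>) + (ennreal a * ennreal (real (N t \<omega>)) + ennreal \<sigma> * ennreal ((Z t \<omega>)\<^sup>2))"
          using pos r0 t0 by (simp add: ennreal_plus ennreal_mult)
        finally show ?thesis using True by simp
      qed simp
    qed
  qed
  also have "\<dots> = ennreal (r + b * c * t + \<sigma>) + (ennreal a * (\<integral>\<^sup>+\<omega>. ennreal (real (N t \<omega>)) * indicator {\<omega>. I t \<omega> \<le> C} \<omega> \<partial>M)
        + ennreal \<sigma> * (\<integral>\<^sup>+\<omega>. ennreal ((Z t \<omega>)\<^sup>2) * indicator {\<omega>. I t \<omega> \<le> C} \<omega> \<partial>M))"
  proof -
    have [measurable]: "(\<lambda>\<omega>. indicator {\<omega>. I t \<omega> \<le> C} \<omega> :: ennreal) \<in> borel_measurable M"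
      unfolding indicator_def mem_Collect_eq by measurable
    show ?thesis
      by (subst nn_integral_add, (measurable)[2], subst nn_integral_add, (measurable)[2])
        (simp add: nn_integral_cmult emeasure_space_1)
  qed
  also have "\<dots> \<le> ennreal (r + b * c * t + \<sigma>) + (ennreal a * ennreal (\<alpha> * t + \<beta> + \<beta> * ?v) + ennreal \<sigma> * ennreal (1 + 2 * ?v))"
  proof (intro add_left_mono add_mono mult_left_mono)
    show "(\<integral>\<^sup>+\<omega>. ennreal (real (N t \<omega>)) * indicator {\<omega>. I t \<omega> \<le> C} \<omega> \<partial>M) \<le> ennreal (\<alpha> * t + \<beta> + \<beta> * ?v)"
      using N_truncated_mean[OF t C] nn_min_I_affine[OF t0 C, of "\<alpha> * t + \<beta>" \<beta>] pos t0
      by (simp add: algebra_simps)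
    show "(\<integral>\<^sup>+\<omega>. ennreal ((Z t \<omega>)\<^sup>2) * indicator {\<omega>. I t \<omega> \<le> C} \<omega> \<partial>M) \<le> ennreal (1 + 2 * ?v)"
      using Z_truncated_second_moment[OF t0 C] nn_min_I_affine[OF t0 C, of 1 2]
      by (simp add: algebra_simps)
  qed simp_all
  also have "\<dots> = ennreal ((r + b * c * t + 2 * \<sigma> + a * (\<alpha> * t + \<beta>)) + (a * \<beta> + 2 * \<sigma>) * ?v)"
    using pos r0 t0 v0 by (simp add: ennreal_mult[symmetric] ennreal_plus[symmetric] algebra_simps del: ennreal_plus)
  finally show ?thesis .
qed

text \<open>\<open>E (min (I t) C)\<close> is at most the time integral of \<open>E (R s)\<close> restricted to \<open>{I s \<le> C}\<close>, which \<open>R_truncated_mean\<close> bounds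
  linearly by \<open>E (min (I s) C)\<close>. The resulting Gronwall bound is the same for all \<open>C\<close>.\<close>

lemma I_mean_finite:
  assumes T: "0 \<le> T"
  obtains K where "0 \<le> K" "\<And>C. 0 \<le> C \<Longrightarrow> (\<integral>\<omega>. min (I T \<omega>) C \<partial>M) \<le> K"
proof -
  define A where "A = r + b * c * T + 2 * \<sigma> + a * (\<alpha> * T + \<beta>)"
  define B where "B = a * \<beta> + 2 * \<sigma>"
  have A0: "0 \<le> A" using pos r0 T by (simp add: A_def)
  have B0: "0 < B" using pos by (simp add: B_def add_pos_pos)
  show thesis
  proof (rule that[of "2 * A * T * exp (2 * B * T)"])
    show "0 \<le> 2 * A * T * exp (2 * B * T)" using A0 T by simp
    fix C :: real assume C: "0 \<le> C"
    define v where "v t = (\<integral>\<omega>. min (I t \<omega>) C \<partial>M)" for t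
    have v0: "0 \<le> v t" for t unfolding v_def using I_nonneg C by (intro Bochner_Integration.integral_nonneg) auto
    have vC: "v t \<le> C" if "0 \<le> t" for t
    proof -
      have "v t \<le> (\<integral>\<omega>. C \<partial>M)" unfolding v_def
        by (rule integral_mono[OF min_I_integrable[OF that C]]) auto
      then show ?thesis by (simp add: prob_space)
    qed
    have le: "ennreal (v t) \<le> (\<integral>\<^sup>+s. ennreal (A + B * v s) * indicator {0..t} s \<partial>lborel)" if t: "t \<in> {0..T}" for t
    proof -
      have t0: "0 \<le> t" using t by simp
      let ?g = "\<lambda>s \<omega>. R s \<omega> * of_bool (I s \<omega> \<le> C)"
      have gm: "(\<lambda>(s, \<omega>). ?g s \<omega>) \<in> borel_measurable (restrict_space lborel {0..t} \<Otimes>\<^sub>M M)"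
        using R_jointly_measurable[OF t0] I_jointly_measurable[OF t0] unfolding split_beta by measurable
      have "ennreal (v t) = (\<integral>\<^sup>+\<omega>. ennreal (min (I t \<omega>) C) \<partial>M)"
        using nn_min_I_affine[OF t0 C, of 0 1] by (simp add: v_def)
      also have "\<dots> \<le> (\<integral>\<^sup>+\<omega>. (\<integral>\<^sup>+s. ennreal (?g s \<omega>) * indicator {0..t} s \<partial>lborel) \<partial>M)"
      proof (rule nn_integral_mono_AE)
        show "AE \<omega> in M. ennreal (min (I t \<omega>) C) \<le> (\<integral>\<^sup>+s. ennreal (?g s \<omega>) * indicator {0..t} s \<partial>lborel)"
          using AE_regular_path
        proof eventually_elim
          case g: (elim \<omega>)
          then have int: "\<forall>t\<ge>0. set_integrable lborel {0..t} (\<lambda>s. R s \<omega>)" and \<omega>: "\<omega> \<in> space M"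
            by (auto simp: regular_path_def)
          have nn: "\<forall>s\<ge>0. 0 \<le> R s \<omega>" using R_nonneg[OF \<omega>] by blast
          have "ennreal (min (I t \<omega>) C) \<le> (\<integral>\<^sup>+s. ennreal (R s \<omega>) * indicator {s. I s \<omega> \<le> C} s * indicator {0..t} s \<partial>lborel)"
            using min_integral_le_integral_stopped[OF int nn t0 C] unfolding I_def .
          also have "\<dots> = (\<integral>\<^sup>+s. ennreal (?g s \<omega>) * indicator {0..t} s \<partial>lborel)"
            by (intro nn_integral_cong) (simp add: indicator_def)
          finally show ?case .
        qed
      qed
      also have "\<dots> \<le> (\<integral>\<^sup>+s. ennreal (A + B * v s) * indicator {0..t} s \<partial>lborel)"
      proof (rule expectation_time_integral_le[OF gm])
        fix s assume s: "0 < s" "s \<le> t"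
        then have "b * c * s \<le> b * c * T" "a * (\<alpha> * s + \<beta>) \<le> a * (\<alpha> * T + \<beta>)" using pos t by auto
        then have "(r + b * c * s + 2 * \<sigma> + a * (\<alpha> * s + \<beta>)) + (a * \<beta> + 2 * \<sigma>) * v s \<le> A + B * v s"
          by (simp add: A_def B_def)
        then show "(\<integral>\<^sup>+\<omega>. ennreal (?g s \<omega>) \<partial>M) \<le> ennreal (A + B * v s)"
          using order_trans[OF R_truncated_mean[OF s(1) C, folded v_def] ennreal_leI] by blast
      qed
      finally show ?thesis .
    qed
    show "(\<integral>\<omega>. min (I T \<omega>) C \<partial>M) \<le> 2 * A * T * exp (2 * B * T)"
      using integral_gronwall[OF T A0 B0, of v C] v0 vC le by (simp add: v_def)
  qed
qed


lemma nn_integral_le_of_truncations: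
  assumes f: "f \<in> borel_measurable M" and t: "0 \<le> t"
    and le: "\<And>n :: nat. (\<integral>\<^sup>+\<omega>. f \<omega> * indicator {\<omega>. I t \<omega> \<le> real n} \<omega> \<partial>M) \<le> K"
  shows "(\<integral>\<^sup>+\<omega>. f \<omega> \<partial>M) \<le> K"
proof -
  have [measurable]: "I t \<in> borel_measurable M" using I_borel t by simp
  note f[measurable]
  have "(\<integral>\<^sup>+\<omega>. f \<omega> \<partial>M) = (\<integral>\<^sup>+\<omega>. liminf (\<lambda>n. f \<omega> * indicator {\<omega>. I t \<omega> \<le> real n} \<omega>) \<partial>M)"
  proof (rule nn_integral_cong)
    fix \<omega>
    obtain m :: nat where m: "I t \<omega> \<le> real m" using real_arch_simple by blast
    have "\<forall>\<^sub>F n in sequentially. f \<omega> * indicator {\<omega>. I t \<omega> \<le> real n} \<omega> = f \<omega>"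
      using eventually_ge_at_top[of m] by eventually_elim (use m in auto)
    then show "f \<omega> = liminf (\<lambda>n. f \<omega> * indicator {\<omega>. I t \<omega> \<le> real n} \<omega>)"
      by (rule liminf_eventually_const[symmetric])
  qed
  also have "\<dots> \<le> liminf (\<lambda>n. \<integral>\<^sup>+\<omega>. f \<omega> * indicator {\<omega>. I t \<omega> \<le> real n} \<omega> \<partial>M)"
  proof (rule nn_integral_liminf)
    show "(\<lambda>\<omega>. f \<omega> * indicator {\<omega>. I t \<omega> \<le> real n} \<omega>) \<in> borel_measurable M" for n
      unfolding indicator_def mem_Collect_eq by measurable
  qed
  also have "\<dots> \<le> liminf (\<lambda>n::nat. K)" by (intro Liminf_mono always_eventually allI le)
  also have "\<dots> = K" by (rule Liminf_const) simp
  finally show ?thesis .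
qed

text \<open>Letting \<open>C \<rightarrow> \<infinity>\<close> in the truncated bounds, which is possible now that \<open>E (I t)\<close> is finite.\<close>

lemma first_moments:
  assumes t: "0 < t"
  defines "v \<equiv> \<integral>\<omega>. I t \<omega> \<partial>M"
  shows "integrable M (I t)"
    and "integrable M (\<lambda>\<omega>. real (N t \<omega>))" "(\<integral>\<omega>. real (N t \<omega>) \<partial>M) \<le> \<alpha> * t + \<beta> * (v + 1)"
    and "integrable M (\<lambda>\<omega>. (Z t \<omega>)\<^sup>2)" "(\<integral>\<omega>. (Z t \<omega>)\<^sup>2 \<partial>M) \<le> 2 * v + 1"
proof -
  have t0: "0 \<le> t" using t by simp
  have [measurable]: "I t \<in> borel_measurable M" "Z t \<in> borel_measurable M" "(\<lambda>\<omega>. real (N t \<omega>)) \<in> borel_measurable M"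
    using I_borel Z_borel N_borel t0 by auto
  obtain K where K: "0 \<le> K" "\<And>C. 0 \<le> C \<Longrightarrow> (\<integral>\<omega>. min (I t \<omega>) C \<partial>M) \<le> K"
    using I_mean_finite[OF t0] by blast
  have "(\<integral>\<^sup>+\<omega>. ennreal (I t \<omega>) \<partial>M) \<le> ennreal K"
  proof (rule nn_integral_le_of_truncations[OF _ t0])
    fix n :: nat
    have "(\<integral>\<^sup>+\<omega>. ennreal (I t \<omega>) * indicator {\<omega>. I t \<omega> \<le> real n} \<omega> \<partial>M) \<le> (\<integral>\<^sup>+\<omega>. ennreal (0 + 1 * min (I t \<omega>) (real n)) \<partial>M)"
      by (intro nn_integral_mono) (auto simp: indicator_def)
    also have "\<dots> = ennreal (\<integral>\<omega>. min (I t \<omega>) (real n) \<partial>M)"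
      using nn_min_I_affine[OF t0, of "real n" 0 1] by simp
    also have "\<dots> \<le> ennreal K" by (intro ennreal_leI K) simp
    finally show "(\<integral>\<^sup>+\<omega>. ennreal (I t \<omega>) * indicator {\<omega>. I t \<omega> \<le> real n} \<omega> \<partial>M) \<le> ennreal K" .
  qed simp
  then show Ii: "integrable M (I t)"
    using I_nonneg by (intro integrableI_nonneg) (auto simp: le_less_trans[OF _ ennreal_less_top])
  have v0: "0 \<le> v" unfolding v_def using I_nonneg by (intro Bochner_Integration.integral_nonneg) auto
  have aff: "(\<integral>\<^sup>+\<omega>. ennreal (x + y * (min (I t \<omega>) (real n))) \<partial>M) \<le> ennreal (x + y * v)"
    if xy: "0 \<le> x" "0 \<le> y" for x y n
  proof -
    have "(\<integral>\<omega>. min (I t \<omega>) (real n) \<partial>M) \<le> v"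
      unfolding v_def by (rule integral_mono[OF min_I_integrable[OF t0] Ii]) auto
    then have "x + y * (\<integral>\<omega>. min (I t \<omega>) (real n) \<partial>M) \<le> x + y * v" using xy by (intro add_left_mono mult_left_mono)
    then show ?thesis using nn_min_I_affine[OF t0, of "real n" x y] xy by (simp add: ennreal_leI)
  qed
  have "(\<integral>\<^sup>+\<omega>. ennreal (real (N t \<omega>)) \<partial>M) \<le> ennreal ((\<alpha> * t + \<beta>) + \<beta> * v)"
  proof (rule nn_integral_le_of_truncations[OF _ t0])
    fix n :: nat
    have "(\<integral>\<^sup>+\<omega>. ennreal (real (N t \<omega>)) * indicator {\<omega>. I t \<omega> \<le> real n} \<omega> \<partial>M)
      \<le> (\<integral>\<^sup>+\<omega>. ennreal ((\<alpha> * t + \<beta>) + \<beta> * min (I t \<omega>) (real n)) \<partial>M)"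
      using N_truncated_mean[OF t, of "real n"] by (simp add: algebra_simps)
    also have "\<dots> \<le> ennreal ((\<alpha> * t + \<beta>) + \<beta> * v)" using pos t0 by (intro aff) auto
    finally show "(\<integral>\<^sup>+\<omega>. ennreal (real (N t \<omega>)) * indicator {\<omega>. I t \<omega> \<le> real n} \<omega> \<partial>M) \<le> ennreal ((\<alpha> * t + \<beta>) + \<beta> * v)" .
  qed simp
  from integrable_of_nn_integral_le[OF _ _ _ this]
  show "integrable M (\<lambda>\<omega>. real (N t \<omega>))" "(\<integral>\<omega>. real (N t \<omega>) \<partial>M) \<le> \<alpha> * t + \<beta> * (v + 1)"
    using pos t0 v0 by (auto simp: algebra_simps)
  have "(\<integral>\<^sup>+\<omega>. ennreal ((Z t \<omega>)\<^sup>2) \<partial>M) \<le> ennreal (1 + 2 * v)"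
  proof (rule nn_integral_le_of_truncations[OF _ t0])
    fix n :: nat
    have "(\<integral>\<^sup>+\<omega>. ennreal ((Z t \<omega>)\<^sup>2) * indicator {\<omega>. I t \<omega> \<le> real n} \<omega> \<partial>M)
      \<le> (\<integral>\<^sup>+\<omega>. ennreal (1 + 2 * min (I t \<omega>) (real n)) \<partial>M)"
      using Z_truncated_second_moment[OF t0, of "real n"] by (simp add: algebra_simps)
    also have "\<dots> \<le> ennreal (1 + 2 * v)" by (intro aff) auto
    finally show "(\<integral>\<^sup>+\<omega>. ennreal ((Z t \<omega>)\<^sup>2) * indicator {\<omega>. I t \<omega> \<le> real n} \<omega> \<partial>M) \<le> ennreal (1 + 2 * v)" .
  qed simp
  from integrable_of_nn_integral_le[OF _ _ _ this]
  show "integrable M (\<lambda>\<omega>. (Z t \<omega>)\<^sup>2)" "(\<integral>\<omega>. (Z t \<omega>)\<^sup>2 \<partial>M) \<le> 2 * v + 1"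
    using v0 by (auto simp: algebra_simps)
qed

text \<open>From \<open>R t \<ge> 0\<close> one gets \<open>b E (I t) \<le> r + b c t + a E (N t) + \<sigma> E (Z t)\<close>. Here \<open>a E (N t)\<close> is at most \<open>a \<beta> E (I t)\<close> up to
  affine terms, and \<open>\<sigma> Z\<close> is absorbed by Young's inequality with a small multiple of \<open>Z\<^sup>2\<close>. By \<open>a \<beta> < b\<close> a
  positive multiple of \<open>E (I t)\<close> remains on the left.\<close>

lemma linear_moment_growth:
  obtains L where "0 \<le> L" "\<And>t. 0 < t \<Longrightarrow> (\<integral>\<omega>. I t \<omega> \<partial>M) \<le> L * (1 + t)"
    "\<And>t. 0 < t \<Longrightarrow> (\<integral>\<omega>. real (N t \<omega>) \<partial>M) \<le> L * (1 + t)"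
    "\<And>t. 0 < t \<Longrightarrow> (\<integral>\<omega>. (Z t \<omega>)\<^sup>2 \<partial>M) \<le> L * (1 + t)"
proof -
  define \<kappa> where "\<kappa> = b - a * \<beta>"
  have \<kappa>: "0 < \<kappa>" using stable by (simp add: \<kappa>_def)
  \<comment> \<open>Half of \<open>\<kappa> E (I t)\<close> is used up by Young's inequality, whence the factor \<open>2 / \<kappa>\<close>.\<close>
  define L0 where "L0 = 2 / \<kappa> * (r + a * \<beta> + \<kappa> / 4 + \<sigma>\<^sup>2 / \<kappa> + (b * c + a * \<alpha>))"
  have L0: "0 \<le> L0" unfolding L0_def using pos r0 \<kappa> by (intro mult_nonneg_nonneg add_nonneg_nonneg divide_nonneg_nonneg) auto
  define L where "L = L0 + (\<alpha> + \<beta> * (L0 + 1)) + (2 * L0 + 1)"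
  have I_le: "(\<integral>\<omega>. I t \<omega> \<partial>M) \<le> L0 * (1 + t)" if t: "0 < t" for t
  proof -
    define v where "v = (\<integral>\<omega>. I t \<omega> \<partial>M)"
    note fm = first_moments[OF t, folded v_def]
    have "AE \<omega> in M. b * I t \<omega> \<le> (r + b * c * t + \<sigma>\<^sup>2 / \<kappa>) + (a * real (N t \<omega>) + \<kappa> / 4 * (Z t \<omega>)\<^sup>2)"
      using AE_regular_path
    proof eventually_elim
      case g: (elim \<omega>)
      note G = regular_path_props[OF g]
      have "0 \<le> R t \<omega>" using R_nonneg[OF G(1)] t by simp
      moreover have "\<sigma> * z \<le> \<kappa> / 4 * z\<^sup>2 + \<sigma>\<^sup>2 / \<kappa>" for z
      proof -
        have "0 \<le> \<kappa> / 4 * (z - 2 * \<sigma> / \<kappa>)\<^sup>2" using \<kappa> by simp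
        also have "\<dots> = \<kappa> / 4 * z\<^sup>2 + \<sigma>\<^sup>2 / \<kappa> - \<sigma> * z" using \<kappa> by (simp add: power2_eq_square field_simps)
        finally show ?thesis by simp
      qed
      then have "\<sigma> * Z t \<omega> \<le> \<kappa> / 4 * (Z t \<omega>)\<^sup>2 + \<sigma>\<^sup>2 / \<kappa>" .
      ultimately show ?case
        using G(7)[of t] t by simp
    qed
    then have "(\<integral>\<omega>. b * I t \<omega> \<partial>M) \<le> (\<integral>\<omega>. (r + b * c * t + \<sigma>\<^sup>2 / \<kappa>) + (a * real (N t \<omega>) + \<kappa> / 4 * (Z t \<omega>)\<^sup>2) \<partial>M)"
      using fm by (intro integral_mono_AE) auto
    also have "\<dots> = (r + b * c * t + \<sigma>\<^sup>2 / \<kappa>) + (a * (\<integral>\<omega>. real (N t \<omega>) \<partial>M) + \<kappa> / 4 * (\<integral>\<omega>. (Z t \<omega>)\<^sup>2 \<partial>M))"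
      using fm by (simp add: prob_space)
    also have "\<dots> \<le> (r + b * c * t + \<sigma>\<^sup>2 / \<kappa>) + (a * (\<alpha> * t + \<beta> * (v + 1)) + \<kappa> / 4 * (2 * v + 1))"
      using fm pos \<kappa> by (intro add_left_mono add_mono mult_left_mono) auto
    finally have "b * v \<le> (r + b * c * t + \<sigma>\<^sup>2 / \<kappa>) + (a * (\<alpha> * t + \<beta> * (v + 1)) + \<kappa> / 4 * (2 * v + 1))"
      by (simp add: v_def)
    moreover have "b * v = \<kappa> * v + a * \<beta> * v" by (simp add: \<kappa>_def algebra_simps)
    ultimately have "\<kappa> * v / 2 \<le> (r + a * \<beta> + \<kappa> / 4 + \<sigma>\<^sup>2 / \<kappa>) + (b * c + a * \<alpha>) * t"
      by (simp add: algebra_simps)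
    also have "\<dots> \<le> (r + a * \<beta> + \<kappa> / 4 + \<sigma>\<^sup>2 / \<kappa>) * (1 + t) + (b * c + a * \<alpha>) * (1 + t)"
    proof (intro add_mono)
      have "0 \<le> r + a * \<beta> + \<kappa> / 4 + \<sigma>\<^sup>2 / \<kappa>" using pos r0 \<kappa> by simp
      from mult_left_mono[of 1 "1 + t", OF _ this]
      show "r + a * \<beta> + \<kappa> / 4 + \<sigma>\<^sup>2 / \<kappa> \<le> (r + a * \<beta> + \<kappa> / 4 + \<sigma>\<^sup>2 / \<kappa>) * (1 + t)" using t by simp
      show "(b * c + a * \<alpha>) * t \<le> (b * c + a * \<alpha>) * (1 + t)" using pos t by (intro mult_left_mono) auto
    qed
    also have "\<dots> = \<kappa> / 2 * (L0 * (1 + t))"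
    proof -
      have "\<kappa> / 2 * L0 = r + a * \<beta> + \<kappa> / 4 + \<sigma>\<^sup>2 / \<kappa> + (b * c + a * \<alpha>)" using \<kappa> by (simp add: L0_def)
      then show ?thesis by (metis distrib_right mult.assoc)
    qed
    finally have "\<kappa> / 2 * v \<le> \<kappa> / 2 * (L0 * (1 + t))" by simp
    then have "v \<le> L0 * (1 + t)" using \<kappa> by (simp only: mult_le_cancel_left_pos half_gt_zero_iff)
    then show ?thesis by (simp add: v_def)
  qed
  show thesis
  proof (rule that)
    show "0 \<le> L" unfolding L_def using L0 pos by simp
    fix t :: real assume t: "0 < t"
    note fm = first_moments[OF t] and le = I_le[OF t]
    let ?x = "L0 * (1 + t)" and ?y = "(\<alpha> + \<beta> * (L0 + 1)) * (1 + t)" and ?z = "(2 * L0 + 1) * (1 + t)"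
    have L: "L * (1 + t) = ?x + ?y + ?z" by (simp add: L_def algebra_simps)
    have nn: "0 \<le> ?x" "0 \<le> ?y" "0 \<le> ?z" using L0 pos t by auto
    show "(\<integral>\<omega>. I t \<omega> \<partial>M) \<le> L * (1 + t)" using le nn L by linarith
    have "\<beta> * (\<integral>\<omega>. I t \<omega> \<partial>M) \<le> \<beta> * ?x" using le pos by (intro mult_left_mono) auto
    moreover have "0 \<le> \<beta> * t" "0 \<le> \<alpha>" using pos t by auto
    ultimately have "(\<integral>\<omega>. real (N t \<omega>) \<partial>M) \<le> ?y" using fm(3) by (simp add: algebra_simps)
    then show "(\<integral>\<omega>. real (N t \<omega>) \<partial>M) \<le> L * (1 + t)" using nn L by linarith
    have "(\<integral>\<omega>. (Z t \<omega>)\<^sup>2 \<partial>M) \<le> ?z" using fm(5) le t by (simp add: algebra_simps)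
    then show "(\<integral>\<omega>. (Z t \<omega>)\<^sup>2 \<partial>M) \<le> L * (1 + t)" using nn L by linarith
  qed
qed

end

section \<open>The second moment of the compensated counting process\<close>

definition clip :: "real \<Rightarrow> real \<Rightarrow> real" where "clip L x = max (- L) (min x L)"

text \<open>Equal to \<open>x\<^sup>2\<close> for \<open>\<bar>x\<bar> \<le> L\<close> and continued by its tangents. It replaces the square for martingales that are not
  yet known to be square integrable: its derivative \<open>2 clip L\<close> is bounded.\<close>

definition huber :: "real \<Rightarrow> real \<Rightarrow> real" where "huber L x = 2 * clip L x * x - (clip L x)\<^sup>2"

lemma clip_bound: "0 \<le> L \<Longrightarrow> \<bar>clip L x\<bar> \<le> L"
  by (auto simp: clip_def)

lemma clip_contraction: "0 \<le> (clip L y - clip L x) * (y - x)" "(clip L y - clip L x) * (y - x) \<le> (y - x)\<^sup>2"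
proof -
  have *: "0 \<le> clip L v - clip L u \<and> clip L v - clip L u \<le> v - u" if "u \<le> v" for u v
    using that by (auto simp: clip_def)
  show "0 \<le> (clip L y - clip L x) * (y - x)"
    using *[of x y] *[of y x] by (cases "x \<le> y") (auto simp: zero_le_mult_iff)
  show "(clip L y - clip L x) * (y - x) \<le> (y - x)\<^sup>2"
  proof (cases "x \<le> y")
    case True
    then show ?thesis unfolding power2_eq_square using *[of x y] by (intro mult_right_mono) auto
  next
    case False
    then have "(clip L x - clip L y) * (x - y) \<le> (x - y) * (x - y)" using *[of y x] by (intro mult_right_mono) auto
    then show ?thesis by (simp add: power2_eq_square algebra_simps)
  qed
qed

text \<open>The function is the upper envelope of its tangents.\<close>

lemma huber_tangent:
  assumes "\<bar>k\<bar> \<le> L"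
  shows "2 * k * x - k\<^sup>2 \<le> huber L x"
proof -
  have "huber L x - (2 * k * x - k\<^sup>2) = (clip L x - k) * (2 * x - clip L x - k)"
    by (simp add: huber_def power2_eq_square algebra_simps)
  moreover have "0 \<le> (clip L x - k) * (2 * x - clip L x - k)"
    using assms by (auto simp: clip_def zero_le_mult_iff max_def min_def)
  ultimately show ?thesis by linarith
qed

lemma huber_props:
  assumes L: "0 \<le> L"
  shows "0 \<le> huber L x" "huber L x \<le> 2 * L * \<bar>x\<bar>" "\<bar>x\<bar> \<le> L \<Longrightarrow> huber L x = x\<^sup>2"
proof -
  show "0 \<le> huber L x" using huber_tangent[of 0 L x] L by simp
  have "clip L x * x \<le> L * \<bar>x\<bar>"
    using mult_right_mono[OF clip_bound[OF L, of x] abs_ge_zero[of x]] abs_ge_self[of "clip L x * x"]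
    by (simp add: abs_mult)
  then show "huber L x \<le> 2 * L * \<bar>x\<bar>" using zero_le_power2[of "clip L x"] unfolding huber_def by linarith
  show "\<bar>x\<bar> \<le> L \<Longrightarrow> huber L x = x\<^sup>2" by (simp add: huber_def clip_def power2_eq_square)
qed

text \<open>The first term has mean zero along a martingale. By \<open>clip_contraction\<close> the second one is bounded by
  \<open>2 (y - x)\<^sup>2\<close>, and by \<open>clip_bound\<close> also by \<open>4 L \<bar>y - x\<bar>\<close>.\<close>

lemma huber_increment:
  assumes L: "0 \<le> L"
  shows "huber L y - huber L x \<le> 2 * clip L x * (y - x) + 2 * ((clip L y - clip L x) * (y - x))"
  using huber_tangent[OF clip_bound[OF L, of y], of x] by (simp add: huber_def[of L y] algebra_simps)

context stable_cir_hawkes begin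

definition compensated :: "real \<Rightarrow> 'a \<Rightarrow> real" where
  "compensated t \<omega> = real (N t \<omega>) - (\<alpha> * t + \<beta> * I t \<omega>)"

lemma compensated_measurable: "0 \<le> t \<Longrightarrow> compensated t \<in> borel_measurable (F t)"
proof -
  assume t: "0 \<le> t"
  have [measurable]: "I t \<in> borel_measurable (F t)" "(\<lambda>\<omega>. real (N t \<omega>)) \<in> borel_measurable (F t)"
    using I_measurable N_adapted t by auto
  show ?thesis unfolding compensated_def by measurable
qed

lemma N_mono_path: "\<omega> \<in> space M \<Longrightarrow> 0 \<le> s \<Longrightarrow> s \<le> u \<Longrightarrow> N s \<omega> \<le> N u \<omega>"
  using N_path[of \<omega>] by (auto simp: counting_path_def mono_on_def)

text \<open>With \<open>E (N t)\<close> and \<open>E (I t)\<close> finite, the localized martingales are dominated by \<open>N t + \<alpha> t + \<beta> I t\<close>, so the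
  localization can be removed.\<close>

lemma compensated_orthogonal:
  assumes st: "0 \<le> s" "s \<le> t" "0 < t"
    and Y: "Y \<in> borel_measurable (F s)" and bd: "\<And>\<omega>. \<omega> \<in> space M \<Longrightarrow> \<bar>Y \<omega>\<bar> \<le> k"
  shows "integrable M (\<lambda>\<omega>. Y \<omega> * compensated t \<omega>)" "integrable M (\<lambda>\<omega>. Y \<omega> * compensated s \<omega>)"
    "(\<integral>\<omega>. Y \<omega> * compensated t \<omega> \<partial>M) = (\<integral>\<omega>. Y \<omega> * compensated s \<omega> \<partial>M)"
proof -
  obtain \<tau> :: "nat \<Rightarrow> 'a \<Rightarrow> real" where \<tau>0: "\<And>n \<omega>. \<omega> \<in> space M \<Longrightarrow> 0 \<le> \<tau> n \<omega>"
    and \<tau>lim: "AE \<omega> in M. filterlim (\<lambda>n. \<tau> n \<omega>) at_top sequentially"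
    and mart: "\<And>n. is_martingale (\<lambda>t \<omega>. real (N (min t (\<tau> n \<omega>)) \<omega>) - \<Lambda> (min t (\<tau> n \<omega>)) \<omega>)"
    using compensated_local_martingale by blast
  define X where "X j u \<omega> = real (N (min u (\<tau> j \<omega>)) \<omega>) - \<Lambda> (min u (\<tau> j \<omega>)) \<omega>" for j u \<omega>
  have X: "is_martingale (X j)" for j using mart[of j] by (simp add: X_def[abs_def])
  have [measurable]: "X j u \<in> borel_measurable M" if "0 \<le> u" for j u using X[of j] that by (auto simp: is_martingale_def)
  note [measurable] = F_borel[OF Y] F_borel[OF compensated_measurable]
  define S where "S \<omega> = real (N t \<omega>) + (\<alpha> * t + \<beta> * I t \<omega>)" for \<omega>
  have Si: "integrable M S" unfolding S_def using first_moments[OF st(3)] by auto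
  have bound: "\<bar>X j u \<omega>\<bar> \<le> S \<omega>" if g: "regular_path \<omega>" and u: "0 \<le> u" "u \<le> t" for j u \<omega>
  proof -
    note G = regular_path_props[OF g]
    have m: "0 \<le> min u (\<tau> j \<omega>)" "min u (\<tau> j \<omega>) \<le> t" using \<tau>0[OF G(1)] u by auto
    have "real (N (min u (\<tau> j \<omega>)) \<omega>) \<le> real (N t \<omega>)" using N_mono_path[OF G(1) m] by simp
    moreover have "\<alpha> * min u (\<tau> j \<omega>) \<le> \<alpha> * t" "\<beta> * I (min u (\<tau> j \<omega>)) \<omega> \<le> \<beta> * I t \<omega>"
      using pos G(4)[OF m] m by (auto intro!: mult_left_mono)
    moreover have "0 \<le> \<alpha> * min u (\<tau> j \<omega>)" "0 \<le> \<beta> * I (min u (\<tau> j \<omega>)) \<omega>" using pos m G(5)[OF m(1)] by simp_all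
    ultimately show ?thesis unfolding X_def G(6)[OF m(1)] S_def by (simp add: abs_le_iff)
  qed
  have lim: "integrable M (\<lambda>\<omega>. Y \<omega> * compensated u \<omega>) \<and>
      (\<lambda>j. \<integral>\<omega>. Y \<omega> * X j u \<omega> \<partial>M) \<longlonglongrightarrow> (\<integral>\<omega>. Y \<omega> * compensated u \<omega> \<partial>M)" if u: "0 \<le> u" "u \<le> t" for u
  proof -
    have 1: "AE \<omega> in M. (\<lambda>j. Y \<omega> * X j u \<omega>) \<longlonglongrightarrow> Y \<omega> * compensated u \<omega>"
      using AE_regular_path \<tau>lim
    proof eventually_elim
      case (elim \<omega>)
      note g = elim(1) and l = elim(2)
      have "\<forall>\<^sub>F j in sequentially. u \<le> \<tau> j \<omega>" using l by (simp add: filterlim_at_top)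
      then have "\<forall>\<^sub>F j in sequentially. Y \<omega> * X j u \<omega> = Y \<omega> * compensated u \<omega>"
        by eventually_elim (simp add: X_def compensated_def min_absorb1 regular_path_props(6)[OF g u(1)])
      then show ?case by (rule tendsto_eventually)
    qed
    have 2: "AE \<omega> in M. norm (Y \<omega> * X j u \<omega>) \<le> \<bar>k\<bar> * S \<omega>" for j
      using AE_regular_path
    proof eventually_elim
      case g: (elim \<omega>)
      have "\<bar>Y \<omega>\<bar> \<le> \<bar>k\<bar>" using bd[OF regular_path_props(1)[OF g]] by simp
      then show ?case
        using bound[OF g u] by (simp add: abs_mult mult_mono)
    qed
    have m1: "(\<lambda>\<omega>. Y \<omega> * compensated u \<omega>) \<in> borel_measurable M" using u by measurable
    have m2: "(\<lambda>\<omega>. Y \<omega> * X j u \<omega>) \<in> borel_measurable M" for j using u by measurable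
    have iw: "integrable M (\<lambda>\<omega>. \<bar>k\<bar> * S \<omega>)" using Si by simp
    show ?thesis
      using integrable_dominated_convergence[OF m1 m2 iw 1 2] integral_dominated_convergence[OF m1 m2 iw 1 2] by simp
  qed
  show "integrable M (\<lambda>\<omega>. Y \<omega> * compensated t \<omega>)" "integrable M (\<lambda>\<omega>. Y \<omega> * compensated s \<omega>)"
    using lim[of t] lim[of s] st by auto
  have "(\<integral>\<omega>. Y \<omega> * X j t \<omega> \<partial>M) = (\<integral>\<omega>. Y \<omega> * X j s \<omega> \<partial>M)" for j
    by (rule martingale_orthogonal(3)[OF X st(1,2) Y bd])
  then show "(\<integral>\<omega>. Y \<omega> * compensated t \<omega> \<partial>M) = (\<integral>\<omega>. Y \<omega> * compensated s \<omega> \<partial>M)"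
    using LIMSEQ_unique[OF conjunct2[OF lim[of t]]] lim[of s] st by simp
qed

text \<open>The increments of the compensated process over a grid are \<open>x - y\<close> with \<open>x\<close> an increment of \<open>N\<close> and \<open>y\<close>
  one of the compensator, both nonnegative. On a fine grid \<open>x\<close> is \<open>0\<close> or \<open>1\<close> and \<open>y \<le> 1\<close>, hence \<open>(x - y)\<^sup>2 \<le> x + y\<close>, and
  these sum to \<open>S = N t + \<alpha> t + \<beta> I t\<close>. On coarser grids the remainder is still dominated by \<open>4 L S\<close>,
  which is integrable, so the exceptional paths are negligible in the limit.\<close>

lemma compensated_huber_bound:
  assumes t: "0 < t" and L: "0 \<le> L"
  shows "integrable M (\<lambda>\<omega>. huber L (compensated t \<omega>))"
    "(\<integral>\<omega>. huber L (compensated t \<omega>) \<partial>M) \<le> 2 * (\<integral>\<omega>. real (N t \<omega>) + (\<alpha> * t + \<beta> * I t \<omega>) \<partial>M)"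
proof -
  have t0: "0 \<le> t" using t by simp
  define p where "p = uniform_grid t"
  note p = uniform_grid_props[OF t0, folded p_def]
  define S where "S \<omega> = real (N t \<omega>) + (\<alpha> * t + \<beta> * I t \<omega>)" for \<omega>
  have Si: "integrable M S" unfolding S_def using first_moments[OF t] by auto
  have ci: "integrable M (compensated u)" if "0 \<le> u" "u \<le> t" for u
    using compensated_orthogonal(2)[OF that t, of "\<lambda>_. 1" 1] by simp
  have cm [measurable]: "compensated u \<in> borel_measurable M" if "0 \<le> u" for u
    using F_borel[OF compensated_measurable[OF that]] .
  have hm [measurable]: "clip L \<in> borel_measurable borel" "huber L \<in> borel_measurable borel"
    unfolding clip_def[abs_def] huber_def[abs_def] by measurable
  show hi: "integrable M (\<lambda>\<omega>. huber L (compensated t \<omega>))"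
  proof (rule Bochner_Integration.integrable_bound[OF integrable_mult_right[OF integrable_abs[OF ci[OF t0 order_refl]], of "2 * L"]])
    show "AE \<omega> in M. norm (huber L (compensated t \<omega>)) \<le> norm (2 * L * \<bar>compensated t \<omega>\<bar>)"
      using huber_props[OF L] L by (intro AE_I2) simp
  qed (use t0 in measurable)
  define d where "d n i \<omega> = compensated (p n (Suc i)) \<omega> - compensated (p n i) \<omega>" for n i \<omega>
  define e where "e n i \<omega> = 2 * ((clip L (compensated (p n (Suc i)) \<omega>) - clip L (compensated (p n i) \<omega>)) * d n i \<omega>)" for n i \<omega>
  \<comment> \<open>The total second-order term, which replaces the quadratic variation.\<close>
  define B where "B n \<omega> = (\<Sum>i<Suc n. e n i \<omega>)" for n \<omega>
  have cl: "integrable M (\<lambda>\<omega>. clip L (compensated u \<omega>) * compensated v \<omega>)" if "0 \<le> u" "0 \<le> v" "v \<le> t" for u v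
  proof (rule Bochner_Integration.integrable_bound[OF integrable_mult_right[OF integrable_abs[OF ci[OF that(2,3)]], of L]])
    show "AE \<omega> in M. norm (clip L (compensated u \<omega>) * compensated v \<omega>) \<le> norm (L * \<bar>compensated v \<omega>\<bar>)"
      using clip_bound[OF L] L by (intro AE_I2) (simp add: abs_mult mult_right_mono)
  qed (use that in measurable)
  have di: "integrable M (\<lambda>\<omega>. clip L (compensated (p n i) \<omega>) * d n i \<omega>)"
    "(\<integral>\<omega>. clip L (compensated (p n i) \<omega>) * d n i \<omega> \<partial>M) = 0" if i: "i < Suc n" for n i
  proof -
    have pt: "p n (Suc i) \<le> t" "p n i \<le> t" using p(3)[of "Suc i" n] p(3)[of i n] i by auto
    have pp: "0 < p n (Suc i)" using t by (simp add: p_def uniform_grid_def)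
    have Ym: "(\<lambda>\<omega>. clip L (compensated (p n i) \<omega>)) \<in> borel_measurable (F (p n i))"
      using compensated_measurable[OF p(1)] by measurable
    note o = compensated_orthogonal[OF p(1) p(2) pp Ym, of L]
    show "integrable M (\<lambda>\<omega>. clip L (compensated (p n i) \<omega>) * d n i \<omega>)"
      unfolding d_def right_diff_distrib using cl[OF p(1) p(1) pt(1)] cl[OF p(1) p(1) pt(2)] by simp
    show "(\<integral>\<omega>. clip L (compensated (p n i) \<omega>) * d n i \<omega> \<partial>M) = 0"
      unfolding d_def right_diff_distrib using o(3)[OF clip_bound[OF L]] cl[OF p(1) p(1) pt(1)] cl[OF p(1) p(1) pt(2)]
      by simp
  qed
  have ei: "integrable M (e n i)" if i: "i < Suc n" for n i
  proof -
    have pt: "p n (Suc i) \<le> t" "p n i \<le> t" using p(3)[of "Suc i" n] p(3)[of i n] i by auto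
    have "integrable M (\<lambda>\<omega>. clip L (compensated u \<omega>) * d n i \<omega>)" if "0 \<le> u" for u
      unfolding d_def right_diff_distrib using cl[OF that p(1) pt(1)] cl[OF that p(1) pt(2)] by simp
    then show ?thesis unfolding e_def left_diff_distrib using p(1) by auto
  qed
  have Bi: "integrable M (B n)" for n unfolding B_def by (intro Bochner_Integration.integrable_sum ei) simp
  have [measurable]: "B n \<in> borel_measurable M" "S \<in> borel_measurable M" for n using Bi Si by auto
  have c0: "AE \<omega> in M. compensated 0 \<omega> = 0" using AE_regular_path
    by eventually_elim (use regular_path_props N_path in \<open>auto simp: compensated_def counting_path_def\<close>)
  have main: "(\<integral>\<omega>. huber L (compensated t \<omega>) \<partial>M) \<le> (\<integral>\<omega>. B n \<omega> \<partial>M)" for n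
  proof -
    have "AE \<omega> in M. huber L (compensated t \<omega>) \<le> (\<Sum>i<Suc n. 2 * (clip L (compensated (p n i) \<omega>) * d n i \<omega>)) + B n \<omega>"
      using c0
    proof eventually_elim
      case c: (elim \<omega>)
      have "huber L (compensated t \<omega>) = (\<Sum>i<Suc n. huber L (compensated (p n (Suc i)) \<omega>) - huber L (compensated (p n i) \<omega>))"
        by (subst sum_lessThan_telescope) (simp add: p(4,5) c huber_def clip_def L del: sum.lessThan_Suc)
      also have "\<dots> \<le> (\<Sum>i<Suc n. 2 * (clip L (compensated (p n i) \<omega>) * d n i \<omega>) + e n i \<omega>)"
        using huber_increment[OF L] by (intro sum_mono) (simp add: d_def e_def mult.assoc)
      also have "\<dots> = (\<Sum>i<Suc n. 2 * (clip L (compensated (p n i) \<omega>) * d n i \<omega>)) + B n \<omega>"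
        unfolding B_def by (rule sum.distrib)
      finally show ?case .
    qed
    moreover have si: "integrable M (\<lambda>\<omega>. \<Sum>i<Suc n. 2 * (clip L (compensated (p n i) \<omega>) * d n i \<omega>))"
      by (intro Bochner_Integration.integrable_sum integrable_mult_right di(1)) simp
    ultimately have "(\<integral>\<omega>. huber L (compensated t \<omega>) \<partial>M)
      \<le> (\<integral>\<omega>. (\<Sum>i<Suc n. 2 * (clip L (compensated (p n i) \<omega>) * d n i \<omega>)) + B n \<omega> \<partial>M)"
      using hi Bi by (intro integral_mono_AE) auto
    also have "\<dots> = (\<integral>\<omega>. (\<Sum>i<Suc n. 2 * (clip L (compensated (p n i) \<omega>) * d n i \<omega>)) \<partial>M) + (\<integral>\<omega>. B n \<omega> \<partial>M)"
      by (rule Bochner_Integration.integral_add[OF si Bi])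
    also have "(\<integral>\<omega>. (\<Sum>i<Suc n. 2 * (clip L (compensated (p n i) \<omega>) * d n i \<omega>)) \<partial>M)
      = (\<Sum>i<Suc n. (\<integral>\<omega>. 2 * (clip L (compensated (p n i) \<omega>) * d n i \<omega>) \<partial>M))"
      by (intro Bochner_Integration.integral_sum integrable_mult_right di(1)) simp
    also have "\<dots> = 0" by (intro sum.neutral ballI) (simp add: di(2))
    finally show ?thesis by simp
  qed
  have pathwise: "AE \<omega> in M. (\<forall>n. B n \<omega> \<le> 4 * L * S \<omega>) \<and> (\<forall>\<^sub>F n in sequentially. B n \<omega> \<le> 2 * S \<omega>) \<and> 0 \<le> S \<omega>"
    using AE_regular_path
  proof eventually_elim
    case g: (elim \<omega>)
    note G = regular_path_props[OF g]
    define x where "x n i = real (N (p n (Suc i)) \<omega>) - real (N (p n i) \<omega>)" for n i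
    define y where "y n i = \<alpha> * (p n (Suc i) - p n i) + \<beta> * (I (p n (Suc i)) \<omega> - I (p n i) \<omega>)" for n i
    have x0: "0 \<le> x n i" for n i using N_mono_path[OF G(1) p(1) p(2)] by (simp add: x_def)
    have y0: "0 \<le> y n i" for n i using pos G(4)[OF p(1) p(2)] p(2) by (simp add: y_def)
    have dxy: "d n i \<omega> = x n i - y n i" for n i
      by (simp add: d_def x_def y_def compensated_def algebra_simps)
    have sums: "(\<Sum>i<Suc n. x n i + y n i) = S \<omega>" for n
    proof -
      have "(\<Sum>i<Suc n. x n i + y n i) = (\<Sum>i<Suc n. (\<lambda>i. real (N (p n i) \<omega>) + (\<alpha> * p n i + \<beta> * I (p n i) \<omega>)) (Suc i)
          - (\<lambda>i. real (N (p n i) \<omega>) + (\<alpha> * p n i + \<beta> * I (p n i) \<omega>)) i)"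
        by (intro sum.cong) (auto simp: x_def y_def algebra_simps)
      also have "\<dots> = S \<omega>"
        using G(3) N_path[OF G(1)] by (subst sum_lessThan_telescope) (simp add: p(4,5) S_def counting_path_def)
      finally show ?thesis .
    qed
    have e1: "e n i \<omega> \<le> 4 * L * (x n i + y n i)" for n i
    proof -
      have "\<bar>clip L (compensated (p n (Suc i)) \<omega>) - clip L (compensated (p n i) \<omega>)\<bar> \<le> 2 * L"
        using clip_bound[OF L, of "compensated (p n (Suc i)) \<omega>"] clip_bound[OF L, of "compensated (p n i) \<omega>"] by linarith
      moreover have "\<bar>d n i \<omega>\<bar> \<le> x n i + y n i" using x0[of n i] y0[of n i] dxy[of n i] by linarith
      ultimately have "\<bar>(clip L (compensated (p n (Suc i)) \<omega>) - clip L (compensated (p n i) \<omega>)) * d n i \<omega>\<bar> \<le> 2 * L * (x n i + y n i)"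
        unfolding abs_mult using L by (intro mult_mono) auto
      then show ?thesis unfolding e_def by linarith
    qed
    have B1: "B n \<omega> \<le> 4 * L * S \<omega>" for n
    proof -
      have "B n \<omega> \<le> (\<Sum>i<Suc n. 4 * L * (x n i + y n i))" unfolding B_def by (intro sum_mono e1)
      also have "\<dots> = 4 * L * S \<omega>" unfolding sum_distrib_left[symmetric] sums ..
      finally show ?thesis .
    qed
    obtain e1' where e1': "0 < e1'" "\<And>s u. 0 \<le> s \<Longrightarrow> s \<le> u \<Longrightarrow> u \<le> t \<Longrightarrow> u < s + e1' \<Longrightarrow> N u \<omega> \<le> N s \<omega> + 1"
      using counting_path_small_increments[OF N_path[OF G(1)] t0] by metis
    have "continuous_on {0..t} (\<lambda>u. \<alpha> * u + \<beta> * I u \<omega>)" by (intro continuous_intros G(2))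
    from continuous_small_increments[OF this zero_less_one]
    obtain e2 where e2: "0 < e2" "\<And>s u. 0 \<le> s \<Longrightarrow> s \<le> u \<Longrightarrow> u \<le> t \<Longrightarrow> u < s + e2 \<Longrightarrow>
      (\<alpha> * u + \<beta> * I u \<omega>) - (\<alpha> * s + \<beta> * I s \<omega>) < 1" by metis
    have B2: "\<forall>\<^sub>F n in sequentially. B n \<omega> \<le> 2 * S \<omega>"
      using uniform_grid_fine[OF e1'(1), of t] uniform_grid_fine[OF e2(1), of t]
    proof eventually_elim
      fix n assume n: "t / real (Suc n) < e1'" "t / real (Suc n) < e2"
      have "e n i \<omega> \<le> 2 * (x n i + y n i)" if i: "i < Suc n" for i
      proof -
        have pt: "p n (Suc i) \<le> t" using p(3)[of "Suc i" n] i by auto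
        have "N (p n (Suc i)) \<omega> \<le> N (p n i) \<omega> + 1"
          by (rule e1'(2)[OF p(1) p(2) pt]) (use n p(6) in auto)
        then have "N (p n (Suc i)) \<omega> = N (p n i) \<omega> \<or> N (p n (Suc i)) \<omega> = N (p n i) \<omega> + 1"
          using N_mono_path[OF G(1) p(1) p(2), of n i] by linarith
        then have xx: "x n i * x n i = x n i" by (auto simp: x_def)
        have "y n i \<le> 1"
          using e2(2)[OF p(1) p(2) pt] n p(6)[of n i] by (simp add: y_def algebra_simps)
        then have yy: "y n i * y n i \<le> y n i" using y0[of n i] mult_left_mono[of "y n i" 1 "y n i"] by simp
        have "e n i \<omega> \<le> 2 * (d n i \<omega>)\<^sup>2"
          unfolding e_def d_def using clip_contraction(2)[of L "compensated (p n (Suc i)) \<omega>" "compensated (p n i) \<omega>"] by simp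
        also have "(d n i \<omega>)\<^sup>2 = x n i * x n i + y n i * y n i - 2 * (x n i * y n i)"
          by (simp add: dxy power2_eq_square algebra_simps)
        also have "2 * (x n i * x n i + y n i * y n i - 2 * (x n i * y n i)) \<le> 2 * (x n i + y n i)"
        proof -
          have "0 \<le> 2 * (x n i * y n i)" using mult_nonneg_nonneg[OF x0[of n i] y0[of n i]] by simp
          then have "x n i * x n i + y n i * y n i - 2 * (x n i * y n i) \<le> x n i + y n i - 0"
            by (rule diff_mono[OF add_mono[OF eq_refl[OF xx] yy]])
          then show ?thesis by simp
        qed
        finally show ?thesis by simp
      qed
      then have "B n \<omega> \<le> (\<Sum>i<Suc n. 2 * (x n i + y n i))" unfolding B_def by (intro sum_mono) simp
      also have "\<dots> = 2 * S \<omega>" unfolding sum_distrib_left[symmetric] sums ..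
      finally show "B n \<omega> \<le> 2 * S \<omega>" .
    qed
    have "0 \<le> S \<omega>" unfolding sums[of 0, symmetric] using x0 y0 by (intro sum_nonneg) simp
    then show ?case
      using B1 B2 by blast
  qed
  have ex: "integrable M (\<lambda>\<omega>. max (B n \<omega> - 2 * S \<omega>) 0)" for n
    using Bi Si by (intro integrable_max) auto
  have "(\<lambda>n. \<integral>\<omega>. max (B n \<omega> - 2 * S \<omega>) 0 \<partial>M) \<longlonglongrightarrow> (\<integral>\<omega>. 0 \<partial>M)"
  proof (rule integral_dominated_convergence[where w="\<lambda>\<omega>. 4 * L * S \<omega>"])
    show "AE \<omega> in M. (\<lambda>n. max (B n \<omega> - 2 * S \<omega>) 0) \<longlonglongrightarrow> 0"
      using pathwise
    proof eventually_elim
      case (elim \<omega>)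
      then have "\<forall>\<^sub>F n in sequentially. B n \<omega> \<le> 2 * S \<omega>" by blast
      then have "\<forall>\<^sub>F n in sequentially. max (B n \<omega> - 2 * S \<omega>) 0 = 0" by eventually_elim simp
      then show ?case by (rule tendsto_eventually)
    qed
    show "AE \<omega> in M. norm (max (B n \<omega> - 2 * S \<omega>) 0) \<le> 4 * L * S \<omega>" for n
      using pathwise
    proof eventually_elim
      fix \<omega> assume *: "(\<forall>n. B n \<omega> \<le> 4 * L * S \<omega>) \<and> (\<forall>\<^sub>F n in sequentially. B n \<omega> \<le> 2 * S \<omega>) \<and> 0 \<le> S \<omega>"
      then have "B n \<omega> \<le> 4 * L * S \<omega>" "0 \<le> S \<omega>" "0 \<le> 4 * L * S \<omega>" using L by auto
      then show "norm (max (B n \<omega> - 2 * S \<omega>) 0) \<le> 4 * L * S \<omega>" by (simp add: max_def)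
    qed
  qed (use Si in auto)
  then have lim: "(\<lambda>n. 2 * (\<integral>\<omega>. S \<omega> \<partial>M) + (\<integral>\<omega>. max (B n \<omega> - 2 * S \<omega>) 0 \<partial>M)) \<longlonglongrightarrow> 2 * (\<integral>\<omega>. S \<omega> \<partial>M) + 0"
    by (intro tendsto_add tendsto_const) simp
  have "(\<integral>\<omega>. huber L (compensated t \<omega>) \<partial>M) \<le> 2 * (\<integral>\<omega>. S \<omega> \<partial>M) + 0"
  proof (rule LIMSEQ_le_const[OF lim], intro exI allI impI)
    fix n
    have "(\<integral>\<omega>. B n \<omega> \<partial>M) \<le> (\<integral>\<omega>. 2 * S \<omega> + max (B n \<omega> - 2 * S \<omega>) 0 \<partial>M)"
      using Bi Si ex by (intro integral_mono) auto
    also have "\<dots> = 2 * (\<integral>\<omega>. S \<omega> \<partial>M) + (\<integral>\<omega>. max (B n \<omega> - 2 * S \<omega>) 0 \<partial>M)"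
      using Si ex by (subst Bochner_Integration.integral_add) auto
    finally show "(\<integral>\<omega>. huber L (compensated t \<omega>) \<partial>M) \<le> 2 * (\<integral>\<omega>. S \<omega> \<partial>M) + (\<integral>\<omega>. max (B n \<omega> - 2 * S \<omega>) 0 \<partial>M)"
      using main[of n] by linarith
  qed
  then show "(\<integral>\<omega>. huber L (compensated t \<omega>) \<partial>M) \<le> 2 * (\<integral>\<omega>. real (N t \<omega>) + (\<alpha> * t + \<beta> * I t \<omega>) \<partial>M)"
    by (simp add: S_def)
qed

text \<open>The bound on the Huber function does not depend on \<open>L\<close>, and \<open>huber L x\<close> tends to \<open>x\<^sup>2\<close> as \<open>L \<rightarrow> \<infinity>\<close>.\<close>

lemma compensated_second_moment:
  assumes t: "0 < t"
  shows "(\<integral>\<^sup>+\<omega>. ennreal ((compensated t \<omega>)\<^sup>2) \<partial>M)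
    \<le> ennreal (2 * (\<integral>\<omega>. real (N t \<omega>) + (\<alpha> * t + \<beta> * I t \<omega>) \<partial>M))" (is "_ \<le> ?K")
proof -
  have [measurable]: "compensated t \<in> borel_measurable M"
    using F_borel[OF compensated_measurable] t by simp
  have [measurable]: "huber L \<in> borel_measurable borel" for L
    unfolding clip_def[abs_def] huber_def[abs_def] by measurable
  have "(\<integral>\<^sup>+\<omega>. ennreal ((compensated t \<omega>)\<^sup>2) \<partial>M)
    = (\<integral>\<^sup>+\<omega>. liminf (\<lambda>n. ennreal (huber (real n) (compensated t \<omega>))) \<partial>M)"
  proof (rule nn_integral_cong)
    fix \<omega>
    obtain m :: nat where m: "\<bar>compensated t \<omega>\<bar> \<le> real m" using real_arch_simple by blast
    have "\<forall>\<^sub>F n in sequentially. ennreal (huber (real n) (compensated t \<omega>)) = ennreal ((compensated t \<omega>)\<^sup>2)"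
      using eventually_ge_at_top[of m] by eventually_elim (use m in \<open>simp add: huber_props(3)\<close>)
    then show "ennreal ((compensated t \<omega>)\<^sup>2) = liminf (\<lambda>n. ennreal (huber (real n) (compensated t \<omega>)))"
      by (rule liminf_eventually_const[symmetric])
  qed
  also have "\<dots> \<le> liminf (\<lambda>n. \<integral>\<^sup>+\<omega>. ennreal (huber (real n) (compensated t \<omega>)) \<partial>M)"
    by (rule nn_integral_liminf) measurable
  also have "\<dots> \<le> liminf (\<lambda>n::nat. ?K)"
  proof (intro Liminf_mono always_eventually allI)
    fix n :: nat
    have "(\<integral>\<^sup>+\<omega>. ennreal (huber (real n) (compensated t \<omega>)) \<partial>M) = ennreal (\<integral>\<omega>. huber (real n) (compensated t \<omega>) \<partial>M)"
      using compensated_huber_bound(1)[OF t] huber_props(1) by (intro nn_integral_eq_integral) auto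
    also have "\<dots> \<le> ?K" by (intro ennreal_leI compensated_huber_bound(2)[OF t]) simp
    finally show "(\<integral>\<^sup>+\<omega>. ennreal (huber (real n) (compensated t \<omega>)) \<partial>M) \<le> ?K" .
  qed
  also have "\<dots> = ?K" by (rule Liminf_const) simp
  finally show ?thesis .
qed

end

section \<open>Law of large numbers\<close>

lemma (in prob_space) tendsto_L2_of_linear_variance:
  assumes X: "\<And>t. 0 < t \<Longrightarrow> X t \<in> borel_measurable M"
    and i: "\<And>t. 0 < t \<Longrightarrow> integrable M (\<lambda>\<omega>. (X t \<omega> - m * t)\<^sup>2)"
    and le: "\<And>t. 0 < t \<Longrightarrow> (\<integral>\<omega>. (X t \<omega> - m * t)\<^sup>2 \<partial>M) \<le> K * (1 + t)"
  shows "tendsto_L2 M (\<lambda>t \<omega>. X t \<omega> / t) (\<lambda>_. m)"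
  unfolding tendsto_L2_def
proof (intro conjI allI impI)
  fix t :: real assume t: "0 < t"
  note [measurable] = X[OF t]
  show "square_integrable M (\<lambda>\<omega>. X t \<omega> / t)"
    unfolding square_integrable_def
  proof
    show "integrable M (\<lambda>\<omega>. (X t \<omega> / t)\<^sup>2)"
    proof (rule Bochner_Integration.integrable_bound)
      show "integrable M (\<lambda>\<omega>. (2 * (X t \<omega> - m * t)\<^sup>2 + 2 * (m * t)\<^sup>2) / t\<^sup>2)" using i[OF t] by simp
      have "x\<^sup>2 \<le> 2 * (x - y)\<^sup>2 + 2 * y\<^sup>2" for x y :: real
        using zero_le_power2[of "x - 2 * y"] by (simp add: power2_eq_square algebra_simps)
      then show "AE \<omega> in M. norm ((X t \<omega> / t)\<^sup>2) \<le> norm ((2 * (X t \<omega> - m * t)\<^sup>2 + 2 * (m * t)\<^sup>2) / t\<^sup>2)"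
        by (intro AE_I2) (simp add: power_divide divide_right_mono)
    qed measurable
  qed measurable
next
  show "square_integrable M (\<lambda>_. m)" by (simp add: square_integrable_def)
  have eq: "(\<integral>\<omega>. (X t \<omega> / t - m)\<^sup>2 \<partial>M) = (\<integral>\<omega>. (X t \<omega> - m * t)\<^sup>2 \<partial>M) / t\<^sup>2" if t: "0 < t" for t
  proof -
    have "(x / t - m)\<^sup>2 = (x - m * t)\<^sup>2 / t\<^sup>2" for x
      using t by (simp add: power_divide[symmetric] diff_divide_distrib)
    then show ?thesis by simp
  qed
  show "((\<lambda>t. \<integral>\<omega>. (X t \<omega> / t - m)\<^sup>2 \<partial>M) \<longlongrightarrow> 0) at_top"
  proof (rule tendsto_sandwich)
    show "\<forall>\<^sub>F t in at_top. 0 \<le> (\<integral>\<omega>. (X t \<omega> / t - m)\<^sup>2 \<partial>M)" by simp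
    show "\<forall>\<^sub>F t in at_top. (\<integral>\<omega>. (X t \<omega> / t - m)\<^sup>2 \<partial>M) \<le> K * (1 + t) / t\<^sup>2"
      using eventually_gt_at_top[of 0] by eventually_elim (simp add: eq le divide_right_mono)
    show "((\<lambda>t. K * (1 + t) / t\<^sup>2) \<longlongrightarrow> 0) at_top" by real_asymp
  qed simp
qed

context stable_cir_hawkes begin

definition \<kappa> :: real where "\<kappa> = b - a * \<beta>"

definition \<mu> :: real where "\<mu> = (b * c + a * \<alpha>) / (b - a * \<beta>)"

lemma kappa_pos: "0 < \<kappa>" using stable by (simp add: \<kappa>_def)

lemma centred_equation:
  assumes g: "regular_path \<omega>" and s: "0 \<le> s"
  shows "R s \<omega> - \<mu> + \<kappa> * (I s \<omega> - \<mu> * s) = r - \<mu> + a * compensated s \<omega> + \<sigma> * Z s \<omega>"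
proof -
  have "\<kappa> * \<mu> = b * c + a * \<alpha>" using kappa_pos by (simp add: \<kappa>_def \<mu>_def)
  then have "\<kappa> * (I s \<omega> - \<mu> * s) = \<kappa> * I s \<omega> - (b * c + a * \<alpha>) * s" by (simp add: right_diff_distrib mult.assoc[symmetric])
  then show ?thesis
    unfolding regular_path_props(7)[OF g s] compensated_def by (simp add: \<kappa>_def algebra_simps)
qed

lemma noise_growth:
  obtains K where "0 \<le> K" "\<And>t. 0 < t \<Longrightarrow> integrable M (\<lambda>\<omega>. (compensated t \<omega>)\<^sup>2)"
    "\<And>t. 0 < t \<Longrightarrow> (\<integral>\<omega>. (compensated t \<omega>)\<^sup>2 \<partial>M) \<le> K * (1 + t)"
    "\<And>t. 0 < t \<Longrightarrow> (\<integral>\<omega>. (r - \<mu> + a * compensated t \<omega> + \<sigma> * Z t \<omega>)\<^sup>2 \<partial>M) \<le> K * (1 + t)"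
    "\<And>t. 0 < t \<Longrightarrow> integrable M (\<lambda>\<omega>. (r - \<mu> + a * compensated t \<omega> + \<sigma> * Z t \<omega>)\<^sup>2)"
proof -
  obtain L where L: "0 \<le> L" "\<And>t. 0 < t \<Longrightarrow> (\<integral>\<omega>. I t \<omega> \<partial>M) \<le> L * (1 + t)"
    "\<And>t. 0 < t \<Longrightarrow> (\<integral>\<omega>. real (N t \<omega>) \<partial>M) \<le> L * (1 + t)"
    "\<And>t. 0 < t \<Longrightarrow> (\<integral>\<omega>. (Z t \<omega>)\<^sup>2 \<partial>M) \<le> L * (1 + t)"
    using linear_moment_growth by metis
  define K1 where "K1 = 2 * (L + \<alpha> + \<beta> * L)"
  have K1: "0 \<le> K1" using L(1) pos by (simp add: K1_def)
  have comp: "integrable M (\<lambda>\<omega>. (compensated t \<omega>)\<^sup>2) \<and> (\<integral>\<omega>. (compensated t \<omega>)\<^sup>2 \<partial>M) \<le> K1 * (1 + t)" if t: "0 < t" for t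
  proof -
    have [measurable]: "compensated t \<in> borel_measurable M"
      using F_borel[OF compensated_measurable] t by simp
    note fm = first_moments[OF t]
    have "(\<integral>\<omega>. real (N t \<omega>) + (\<alpha> * t + \<beta> * I t \<omega>) \<partial>M) = (\<integral>\<omega>. real (N t \<omega>) \<partial>M) + (\<alpha> * t + \<beta> * (\<integral>\<omega>. I t \<omega> \<partial>M))"
      using fm(1,2) by (simp add: prob_space)
    also have "\<dots> \<le> L * (1 + t) + (\<alpha> * (1 + t) + \<beta> * (L * (1 + t)))"
      using L(2,3)[OF t] pos t by (intro add_mono mult_left_mono) auto
    finally have "2 * (\<integral>\<omega>. real (N t \<omega>) + (\<alpha> * t + \<beta> * I t \<omega>) \<partial>M) \<le> K1 * (1 + t)"
      by (simp add: K1_def algebra_simps)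
    then have le: "(\<integral>\<^sup>+\<omega>. ennreal ((compensated t \<omega>)\<^sup>2) \<partial>M) \<le> ennreal (K1 * (1 + t))"
      using order_trans[OF compensated_second_moment[OF t] ennreal_leI] by blast
    show ?thesis using integrable_of_nn_integral_le[OF _ _ _ le] K1 t by simp
  qed
  define K where "K = K1 + 3 * ((r - \<mu>)\<^sup>2 + a\<^sup>2 * K1 + \<sigma>\<^sup>2 * L)"
  have K1K: "K1 \<le> K" unfolding K_def using K1 L(1) by simp
  have noise: "integrable M (\<lambda>\<omega>. (r - \<mu> + a * compensated t \<omega> + \<sigma> * Z t \<omega>)\<^sup>2) \<and>
      (\<integral>\<omega>. (r - \<mu> + a * compensated t \<omega> + \<sigma> * Z t \<omega>)\<^sup>2 \<partial>M) \<le> K * (1 + t)" if t: "0 < t" for t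
  proof -
    have [measurable]: "compensated t \<in> borel_measurable M" "Z t \<in> borel_measurable M"
      using F_borel[OF compensated_measurable] Z_borel t by auto
    let ?b = "\<lambda>\<omega>. 3 * (r - \<mu>)\<^sup>2 + (3 * a\<^sup>2 * (compensated t \<omega>)\<^sup>2 + 3 * \<sigma>\<^sup>2 * (Z t \<omega>)\<^sup>2)"
    have sq: "(x + y + z)\<^sup>2 \<le> 3 * x\<^sup>2 + (3 * y\<^sup>2 + 3 * z\<^sup>2)" for x y z :: real
      using zero_le_power2[of "x - y"] zero_le_power2[of "y - z"] zero_le_power2[of "x - z"]
      by (simp add: power2_eq_square algebra_simps)
    have le: "(r - \<mu> + a * compensated t \<omega> + \<sigma> * Z t \<omega>)\<^sup>2 \<le> ?b \<omega>" for \<omega>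
      using sq[of "r - \<mu>" "a * compensated t \<omega>" "\<sigma> * Z t \<omega>"] by (simp add: power_mult_distrib mult.assoc)
    have bi: "integrable M ?b" using comp[OF t] first_moments(4)[OF t] by simp
    have i: "integrable M (\<lambda>\<omega>. (r - \<mu> + a * compensated t \<omega> + \<sigma> * Z t \<omega>)\<^sup>2)"
      by (rule Bochner_Integration.integrable_bound[OF bi]) (auto intro!: AE_I2 order_trans[OF le])
    have "(\<integral>\<omega>. (r - \<mu> + a * compensated t \<omega> + \<sigma> * Z t \<omega>)\<^sup>2 \<partial>M) \<le> (\<integral>\<omega>. ?b \<omega> \<partial>M)"
      by (rule integral_mono[OF i bi le])
    also have "\<dots> = 3 * (r - \<mu>)\<^sup>2 + (3 * a\<^sup>2 * (\<integral>\<omega>. (compensated t \<omega>)\<^sup>2 \<partial>M) + 3 * \<sigma>\<^sup>2 * (\<integral>\<omega>. (Z t \<omega>)\<^sup>2 \<partial>M))"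
      using comp[OF t] first_moments(4)[OF t] by (simp add: prob_space)
    also have "\<dots> \<le> 3 * (r - \<mu>)\<^sup>2 * (1 + t) + (3 * a\<^sup>2 * (K1 * (1 + t)) + 3 * \<sigma>\<^sup>2 * (L * (1 + t)))"
    proof (intro add_mono mult_left_mono)
      show "3 * (r - \<mu>)\<^sup>2 \<le> 3 * (r - \<mu>)\<^sup>2 * (1 + t)"
        using mult_left_mono[of 1 "1 + t" "3 * (r - \<mu>)\<^sup>2"] t by simp
    qed (use comp[OF t] L(4)[OF t] in auto)
    also have "\<dots> \<le> K * (1 + t)"
    proof -
      have "0 \<le> K1 * (1 + t)" using K1 t by simp
      then show ?thesis by (simp add: K_def algebra_simps)
    qed
    finally show ?thesis using i by blast
  qed
  show thesis
  proof (rule that)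
    show "0 \<le> K" using K1 K1K by simp
    show "(\<integral>\<omega>. (compensated t \<omega>)\<^sup>2 \<partial>M) \<le> K * (1 + t)" if t: "0 < t" for t
    proof -
      have "K1 * (1 + t) \<le> K * (1 + t)" using K1K t by (intro mult_right_mono) auto
      then show ?thesis using comp[OF t] by linarith
    qed
  qed (use comp noise in auto)
qed

text \<open>Integrates the pathwise energy estimate. The weight \<open>exp (\<kappa> s)\<close> is essential: it has integral at most
  \<open>exp (\<kappa> t) / \<kappa>\<close>, so that a linear bound on the noise gives again a linear bound.\<close>

lemma centred_integral_growth:
  obtains K where "0 \<le> K" "\<And>t. 0 < t \<Longrightarrow> integrable M (\<lambda>\<omega>. (I t \<omega> - \<mu> * t)\<^sup>2)"
    "\<And>t. 0 < t \<Longrightarrow> (\<integral>\<omega>. (I t \<omega> - \<mu> * t)\<^sup>2 \<partial>M) \<le> K * (1 + t)"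
proof -
  obtain K where "0 \<le> K" "\<And>t. 0 < t \<Longrightarrow> integrable M (\<lambda>\<omega>. (compensated t \<omega>)\<^sup>2)"
    "\<And>t. 0 < t \<Longrightarrow> (\<integral>\<omega>. (compensated t \<omega>)\<^sup>2 \<partial>M) \<le> K * (1 + t)"
    and K2: "\<And>t. 0 < t \<Longrightarrow> (\<integral>\<omega>. (r - \<mu> + a * compensated t \<omega> + \<sigma> * Z t \<omega>)\<^sup>2 \<partial>M) \<le> K * (1 + t)"
    and K3: "\<And>t. 0 < t \<Longrightarrow> integrable M (\<lambda>\<omega>. (r - \<mu> + a * compensated t \<omega> + \<sigma> * Z t \<omega>)\<^sup>2)"
    using noise_growth by blast
  note K = \<open>0 \<le> K\<close> K2 K3
  note k = kappa_pos
  have bound: "(\<integral>\<^sup>+\<omega>. ennreal ((I t \<omega> - \<mu> * t)\<^sup>2) \<partial>M) \<le> ennreal (K / \<kappa>\<^sup>2 * (1 + t))" if t: "0 < t" for t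
  proof -
    have t0: "0 \<le> t" using t by simp
    have [measurable]: "I t \<in> borel_measurable M" using I_borel t0 by simp
    let ?q = "\<lambda>s \<omega>. exp (\<kappa> * s) * (R s \<omega> - \<mu> + \<kappa> * (I s \<omega> - \<mu> * s))\<^sup>2"
    have idb: "(\<lambda>x. x) \<in> restrict_space lborel {0..t} \<rightarrow>\<^sub>M borel" by (rule measurable_restrict_space1) simp
    have fm: "(\<lambda>x. fst x) \<in> restrict_space lborel {0..t} \<Otimes>\<^sub>M M \<rightarrow>\<^sub>M borel"
      by (rule measurable_compose[OF measurable_fst idb])
    have qm: "(\<lambda>(s, \<omega>). ?q s \<omega>) \<in> borel_measurable (restrict_space lborel {0..t} \<Otimes>\<^sub>M M)"
      using R_jointly_measurable[OF t0] I_jointly_measurable[OF t0] fm unfolding split_beta by measurable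
    have qs: "(\<integral>\<^sup>+\<omega>. ennreal (?q s \<omega>) \<partial>M) \<le> ennreal (exp (\<kappa> * s) * (K * (1 + t)))" if s: "0 < s" "s \<le> t" for s
    proof -
      have "(\<integral>\<^sup>+\<omega>. ennreal (?q s \<omega>) \<partial>M) = (\<integral>\<^sup>+\<omega>. ennreal (exp (\<kappa> * s) * (r - \<mu> + a * compensated s \<omega> + \<sigma> * Z s \<omega>)\<^sup>2) \<partial>M)"
      proof (rule nn_integral_cong_AE)
        show "AE \<omega> in M. ennreal (?q s \<omega>) = ennreal (exp (\<kappa> * s) * (r - \<mu> + a * compensated s \<omega> + \<sigma> * Z s \<omega>)\<^sup>2)"
          using AE_regular_path
        proof eventually_elim
          case (elim \<omega>)
          note eq = centred_equation[OF this less_imp_le[OF s(1)]]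
          show ?case unfolding eq ..
        qed
      qed
      also have "\<dots> = ennreal (\<integral>\<omega>. exp (\<kappa> * s) * (r - \<mu> + a * compensated s \<omega> + \<sigma> * Z s \<omega>)\<^sup>2 \<partial>M)"
        using K(3)[OF s(1)] by (intro nn_integral_eq_integral) auto
      also have "\<dots> \<le> ennreal (exp (\<kappa> * s) * (K * (1 + t)))"
      proof (rule ennreal_leI)
        have "K * (1 + s) \<le> K * (1 + t)" using K(1) s by (intro mult_left_mono) auto
        then have "(\<integral>\<omega>. (r - \<mu> + a * compensated s \<omega> + \<sigma> * Z s \<omega>)\<^sup>2 \<partial>M) \<le> K * (1 + t)"
          using K(2)[OF s(1)] by linarith
        then show "(\<integral>\<omega>. exp (\<kappa> * s) * (r - \<mu> + a * compensated s \<omega> + \<sigma> * Z s \<omega>)\<^sup>2 \<partial>M) \<le> exp (\<kappa> * s) * (K * (1 + t))"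
          by simp
      qed
      finally show ?thesis .
    qed
    have "ennreal (\<kappa> * exp (\<kappa> * t)) * (\<integral>\<^sup>+\<omega>. ennreal ((I t \<omega> - \<mu> * t)\<^sup>2) \<partial>M)
       = (\<integral>\<^sup>+\<omega>. ennreal (\<kappa> * exp (\<kappa> * t) * (I t \<omega> - \<mu> * t)\<^sup>2) \<partial>M)"
      using k by (subst nn_integral_cmult[symmetric]) (auto simp: ennreal_mult)
    also have "\<dots> \<le> (\<integral>\<^sup>+\<omega>. (\<integral>\<^sup>+s. ennreal (?q s \<omega>) * indicator {0..t} s \<partial>lborel) \<partial>M)"
    proof (rule nn_integral_mono_AE)
      show "AE \<omega> in M. ennreal (\<kappa> * exp (\<kappa> * t) * (I t \<omega> - \<mu> * t)\<^sup>2) \<le> (\<integral>\<^sup>+s. ennreal (?q s \<omega>) * indicator {0..t} s \<partial>lborel)"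
        using AE_regular_path
      proof eventually_elim
        case g: (elim \<omega>)
        then have int: "\<forall>t\<ge>0. set_integrable lborel {0..t} (\<lambda>s. R s \<omega>)"
          and fin: "finite {s \<in> {0<..<t}. \<not> isCont (\<lambda>s. R s \<omega>) s}"
          by (auto simp: regular_path_def)
        show ?case
          unfolding I_def by (rule ode_energy_bound[OF int fin t0 k])
      qed
    qed
    also have "\<dots> \<le> (\<integral>\<^sup>+s. ennreal (exp (\<kappa> * s) * (K * (1 + t))) * indicator {0..t} s \<partial>lborel)"
      by (rule expectation_time_integral_le[OF qm qs])
    also have "\<dots> = ennreal (exp (\<kappa> * t) * (K * (1 + t) / \<kappa>) - exp (\<kappa> * 0) * (K * (1 + t) / \<kappa>))"
    proof (rule nn_integral_FTC_Icc)
      show "((\<lambda>s. exp (\<kappa> * s) * (K * (1 + t) / \<kappa>)) has_real_derivative exp (\<kappa> * s) * (K * (1 + t))) (at s)" for s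
        using k by (auto intro!: derivative_eq_intros)
    qed (use t0 K(1) in auto)
    also have "\<dots> \<le> ennreal (exp (\<kappa> * t) * (K * (1 + t) / \<kappa>))"
      using K(1) t0 k by (intro ennreal_leI) simp
    finally have le: "ennreal (\<kappa> * exp (\<kappa> * t)) * (\<integral>\<^sup>+\<omega>. ennreal ((I t \<omega> - \<mu> * t)\<^sup>2) \<partial>M)
      \<le> ennreal (exp (\<kappa> * t) * (K * (1 + t) / \<kappa>))" .
    have "(\<integral>\<^sup>+\<omega>. ennreal ((I t \<omega> - \<mu> * t)\<^sup>2) \<partial>M)
      = ennreal (1 / (\<kappa> * exp (\<kappa> * t))) * (ennreal (\<kappa> * exp (\<kappa> * t)) * (\<integral>\<^sup>+\<omega>. ennreal ((I t \<omega> - \<mu> * t)\<^sup>2) \<partial>M))"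
      using k by (simp add: mult.assoc[symmetric] ennreal_mult[symmetric])
    also have "\<dots> \<le> ennreal (1 / (\<kappa> * exp (\<kappa> * t))) * ennreal (exp (\<kappa> * t) * (K * (1 + t) / \<kappa>))"
      by (intro mult_left_mono le) simp
    also have "\<dots> = ennreal (K / \<kappa>\<^sup>2 * (1 + t))"
      using k K(1) t0 by (simp add: ennreal_mult[symmetric] power2_eq_square)
    finally show ?thesis .
  qed
  show thesis
  proof (rule that[of "K / \<kappa>\<^sup>2"])
    show "0 \<le> K / \<kappa>\<^sup>2" using K(1) by simp
    fix t :: real assume t: "0 < t"
    have [measurable]: "I t \<in> borel_measurable M" using I_borel t by simp
    show "integrable M (\<lambda>\<omega>. (I t \<omega> - \<mu> * t)\<^sup>2)" "(\<integral>\<omega>. (I t \<omega> - \<mu> * t)\<^sup>2 \<partial>M) \<le> K / \<kappa>\<^sup>2 * (1 + t)"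
      using integrable_of_nn_integral_le[OF _ _ _ bound[OF t]] K(1) t by simp_all
  qed
qed

lemma time_average_R: "tendsto_L2 M (\<lambda>t \<omega>. I t \<omega> / t) (\<lambda>_. \<mu>)"
proof -
  obtain K where "0 \<le> K" "\<And>t. 0 < t \<Longrightarrow> integrable M (\<lambda>\<omega>. (I t \<omega> - \<mu> * t)\<^sup>2)"
    "\<And>t. 0 < t \<Longrightarrow> (\<integral>\<omega>. (I t \<omega> - \<mu> * t)\<^sup>2 \<partial>M) \<le> K * (1 + t)"
    using centred_integral_growth by metis
  then show ?thesis using I_borel by (intro tendsto_L2_of_linear_variance[of I \<mu> K]) auto
qed

lemma time_average_N: "tendsto_L2 M (\<lambda>t \<omega>. real (N t \<omega>) / t) (\<lambda>_. \<alpha> + \<beta> * \<mu>)"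
proof -
  obtain K where K: "0 \<le> K" "\<And>t. 0 < t \<Longrightarrow> integrable M (\<lambda>\<omega>. (I t \<omega> - \<mu> * t)\<^sup>2)"
    "\<And>t. 0 < t \<Longrightarrow> (\<integral>\<omega>. (I t \<omega> - \<mu> * t)\<^sup>2 \<partial>M) \<le> K * (1 + t)"
    using centred_integral_growth by metis
  obtain K' where K': "0 \<le> K'" "\<And>t. 0 < t \<Longrightarrow> integrable M (\<lambda>\<omega>. (compensated t \<omega>)\<^sup>2)"
    "\<And>t. 0 < t \<Longrightarrow> (\<integral>\<omega>. (compensated t \<omega>)\<^sup>2 \<partial>M) \<le> K' * (1 + t)"
    using noise_growth by metis
  have "integrable M (\<lambda>\<omega>. (real (N t \<omega>) - (\<alpha> + \<beta> * \<mu>) * t)\<^sup>2) \<and>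
    (\<integral>\<omega>. (real (N t \<omega>) - (\<alpha> + \<beta> * \<mu>) * t)\<^sup>2 \<partial>M) \<le> (2 * K' + 2 * \<beta>\<^sup>2 * K) * (1 + t)" if t: "0 < t" for t
  proof -
    have [measurable]: "(\<lambda>\<omega>. real (N t \<omega>)) \<in> borel_measurable M" using N_borel t by simp
    let ?b = "\<lambda>\<omega>. 2 * (compensated t \<omega>)\<^sup>2 + 2 * \<beta>\<^sup>2 * (I t \<omega> - \<mu> * t)\<^sup>2"
    have sq: "(x + y)\<^sup>2 \<le> 2 * x\<^sup>2 + 2 * y\<^sup>2" for x y :: real
      using zero_le_power2[of "x - y"] by (simp add: power2_eq_square algebra_simps)
    have "real (N t \<omega>) - (\<alpha> + \<beta> * \<mu>) * t = compensated t \<omega> + \<beta> * (I t \<omega> - \<mu> * t)" for \<omega>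
      by (simp add: compensated_def algebra_simps)
    then have le: "(real (N t \<omega>) - (\<alpha> + \<beta> * \<mu>) * t)\<^sup>2 \<le> ?b \<omega>" for \<omega>
      using sq[of "compensated t \<omega>" "\<beta> * (I t \<omega> - \<mu> * t)"] by (simp add: power_mult_distrib mult.assoc)
    have bi: "integrable M ?b" using K(2)[OF t] K'(2)[OF t] by simp
    have i: "integrable M (\<lambda>\<omega>. (real (N t \<omega>) - (\<alpha> + \<beta> * \<mu>) * t)\<^sup>2)"
      by (rule Bochner_Integration.integrable_bound[OF bi]) (auto intro!: AE_I2 order_trans[OF le])
    have "(\<integral>\<omega>. (real (N t \<omega>) - (\<alpha> + \<beta> * \<mu>) * t)\<^sup>2 \<partial>M) \<le> (\<integral>\<omega>. ?b \<omega> \<partial>M)"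
      by (rule integral_mono[OF i bi le])
    also have "\<dots> = 2 * (\<integral>\<omega>. (compensated t \<omega>)\<^sup>2 \<partial>M) + 2 * \<beta>\<^sup>2 * (\<integral>\<omega>. (I t \<omega> - \<mu> * t)\<^sup>2 \<partial>M)"
      using K(2)[OF t] K'(2)[OF t] by simp
    also have "\<dots> \<le> 2 * (K' * (1 + t)) + 2 * \<beta>\<^sup>2 * (K * (1 + t))"
      using K(3)[OF t] K'(3)[OF t] by (intro add_mono mult_left_mono) auto
    finally show ?thesis using i by (simp add: algebra_simps)
  qed
  then show ?thesis using N_borel
    by (intro tendsto_L2_of_linear_variance[of "\<lambda>t \<omega>. real (N t \<omega>)" _ "2 * K' + 2 * \<beta>\<^sup>2 * K"]) auto
qed

end

theorem theorem3:
  fixes M :: "'a measure" and F :: "real \<Rightarrow> 'a measure"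
    and a b c \<alpha> \<beta> \<sigma> r :: real
    and W :: "real \<Rightarrow> 'a \<Rightarrow> real" and N :: "real \<Rightarrow> 'a \<Rightarrow> nat" and R :: "real \<Rightarrow> 'a \<Rightarrow> real"
  assumes "a > 0" "b > 0" "c > 0" "\<alpha> > 0" "\<beta> > 0" "\<sigma> > 0"
    and "b > a * \<beta>" and "2 * b * c \<ge> \<sigma>\<^sup>2"
    and "cir_hawkes M F a b c \<alpha> \<beta> \<sigma> W N R"
    and "r \<ge> 0" and "AE \<omega> in M. R 0 \<omega> = r"
  shows "tendsto_L2 M (\<lambda>t \<omega>. 1 / t * (LBINT s:{0..t}. R s \<omega>))
           (\<lambda>_. (b * c + a * \<alpha>) / (b - a * \<beta>))
       \<and> tendsto_L2 M (\<lambda>t \<omega>. real (N t \<omega>) / t)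
           (\<lambda>_. b * (\<alpha> + \<beta> * c) / (b - a * \<beta>))"
proof -
  interpret C: cir_hawkes M F a b c \<alpha> \<beta> \<sigma> W N R by fact
  obtain Z where Z: "C.ito_integral W (\<lambda>s \<omega>. sqrt (R s \<omega>)) Z"
    "AE \<omega> in M. \<forall>t\<ge>0.
         R t \<omega> = R 0 \<omega> + (LBINT s:{0..t}. b * (c - R s \<omega>)) + a * real (N t \<omega>) + \<sigma> * Z t \<omega>"
    using C.SDE by (elim exE conjE)
  interpret S: stable_cir_hawkes M F a b c \<alpha> \<beta> \<sigma> W N R Z r
    by unfold_locales (use assms Z in auto)
  have "\<alpha> + \<beta> * S.\<mu> = b * (\<alpha> + \<beta> * c) / (b - a * \<beta>)"
    using assms(7) by (simp add: S.\<mu>_def field_simps)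
  then show ?thesis
    using S.time_average_R S.time_average_N by (simp add: S.I_def S.\<mu>_def)
qed

end
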